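(* Fix an integer $n\ge1$. Let $S_n$ be the real symmetric $2n\times 2n$ matrix with zero diagonal and independent standard normal entries above the diagonal, let $H_n:=\operatorname{haf}(S_n)$ and $\widehat H_n:=H_n/\sqrt{(2n-1)!!}$, and let $\sigma_n^{\mathrm{sym}}:=(\mathbb E H_n^2)^{1/2}$. Let $H_{k,n}$, $\sigma_{k,n}$, $B^{\mathbb R}_{k,n}$ and $b_n^{\mathbb R}$ be as defined in the context. Then, as $k\to\infty$ with $n$ fixed, $$k^{-n/2}H_{k,n}\Rightarrow H_n\ \text{(convergence in distribution)},\qquad k^{-n/2}\sigma_{k,n}\longrightarrow\sigma_n^{\mathrm{sym}},$$ and $$(\sigma_n^{\mathrm{sym}})^2=(2n-1)!!,\qquad B^{\mathbb R}_{k,n}\longrightarrow b_n^{\mathbb R}.$$ Moreover, $\widehat H_n$ has a bounded continuous even density $f_{\widehat H_n}$, this density is maximal at zero, and $$\|f_{\widehat H_n}\|_\infty=f_{\widehat H_n}(0)\le\frac{b_n^{\mathbb R}}{2}\le\frac{1}{\sqrt\pi}n^{3/8}.$$ For every $z\in\mathbb R$ and $\varepsilon\ge0$, $$\mathbb P\{|H_n-z|\le\varepsilon\sigma_n^{\mathrm{sym}}\}\le\min\{1,b_n^{\mathbb R}\varepsilon\}\le\min\left\{1,\frac{2}{\sqrt\pi}n^{3/8}\varepsilon\right\}.$$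
   Context: For a symmetric $2n\times2n$ matrix $S$, $\operatorname{haf}(S)=\sum_{\mathfrak m\in\mathcal M_{2n}}\prod_{\{i,j\}\in\mathfrak m}S_{ij}$, where $\mathcal M_{2n}$ is the set of perfect matchings of $\{1,\ldots,2n\}$. For integers $n,k\ge1$, let $X\in\mathbb R^{k\times2n}$ have independent standard normal entries and columns $x_1,\ldots,x_{2n}\in\mathbb R^k$, let $$H_{k,n}=\sum_{\mathfrak m\in\mathcal M_{2n}}\prod_{\{i,j\}\in\mathfrak m}\langle x_i,x_j\rangle,$$ and put $\sigma_{k,n}:=(\mathbb E H_{k,n}^2)^{1/2}$. For $d>1$ put $\gamma_d:=\mathbb E[(\chi_d^2)^{-1/2}]=2^{-1/2}\Gamma((d-1)/2)/\Gamma(d/2)$, where $\chi_d^2$ is chi-square with $d$ degrees of freedom. For $k\ge n+1$, $$B^{\mathbb R}_{k,n}:=\sqrt{\frac2\pi}\,\sigma_{k,n}\left(\prod_{j=0}^{n-1}\gamma_{k-j}\right)\left(\prod_{r=2}^{n}\gamma_{2r-1}\right),\qquad b_n^{\mathbb R}:=\sqrt{\frac2\pi}\,\sqrt{(2n-1)!!}\,\prod_{r=2}^n\gamma_{2r-1}.$$ Empty products equal one. *)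

theory Defs
  imports "HOL-Probability.Probability"
begin

section \<open>Perfect matchings and hafnians\<close>

definition perfect_matchings :: "'a set \<Rightarrow> 'a set set set" where
  "perfect_matchings A = {m. partition_on A m \<and> (\<forall>e\<in>m. card e = 2)}"

text \<open>
  Matrices are functions of two indices, numbered from 1. The factor belonging to an edge
  \<open>e = {i, j}\<close> is read off as the entry at \<open>(Min e, Max e)\<close>; for a symmetric matrix,
  the only kind to which the hafnian is applied, this is the entry at \<open>(i, j)\<close>
  irrespective of the order of \<open>i\<close> and \<open>j\<close>.
\<close>

definition hafnian :: "nat \<Rightarrow> (nat \<Rightarrow> nat \<Rightarrow> real) \<Rightarrow> real" where
  "hafnian n S = (\<Sum>m\<in>perfect_matchings {1..2 * n}. \<Prod>e\<in>m. S (Min e) (Max e))"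

definition gram :: "nat \<Rightarrow> (nat \<Rightarrow> nat \<Rightarrow> real) \<Rightarrow> nat \<Rightarrow> nat \<Rightarrow> real" where
  "gram k X i j = (\<Sum>a=1..k. X a i * X a j)"

definition gram_hafnian :: "nat \<Rightarrow> nat \<Rightarrow> (nat \<Rightarrow> nat \<Rightarrow> real) \<Rightarrow> real" where
  "gram_hafnian k n X = hafnian n (gram k X)"

fun double_fact :: "nat \<Rightarrow> nat" where
  "double_fact 0 = 1"
| "double_fact (Suc 0) = 1"
| "double_fact (Suc (Suc m)) = Suc (Suc m) * double_fact m"


section \<open>Gaussian matrices\<close>

definition std_gaussian_family :: "'a measure \<Rightarrow> 'i set \<Rightarrow> ('i \<Rightarrow> 'a \<Rightarrow> real) \<Rightarrow> bool" where
  "std_gaussian_family P I Z \<longleftrightarrow>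
     prob_space P \<and>
     prob_space.indep_vars P (\<lambda>_. borel) Z I \<and>
     (\<forall>i\<in>I. distributed P lborel (Z i) std_normal_density)"

definition gaussian_matrix ::
  "'a measure \<Rightarrow> nat \<Rightarrow> nat \<Rightarrow> ('a \<Rightarrow> nat \<Rightarrow> nat \<Rightarrow> real) \<Rightarrow> bool" where
  "gaussian_matrix P k m X \<longleftrightarrow>
     std_gaussian_family P ({1..k} \<times> {1..m}) (\<lambda>(a, i) \<omega>. X \<omega> a i)"

definition sym_gaussian_matrix ::
  "'a measure \<Rightarrow> nat \<Rightarrow> ('a \<Rightarrow> nat \<Rightarrow> nat \<Rightarrow> real) \<Rightarrow> bool" where
  "sym_gaussian_matrix P m S \<longleftrightarrow>
     (\<forall>\<omega>\<in>space P. \<forall>i\<in>{1..m}. \<forall>j\<in>{1..m}. S \<omega> i j = S \<omega> j i) \<and>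
     (\<forall>\<omega>\<in>space P. \<forall>i\<in>{1..m}. S \<omega> i i = 0) \<and>
     std_gaussian_family P {(i, j). 1 \<le> i \<and> i < j \<and> j \<le> m} (\<lambda>(i, j) \<omega>. S \<omega> i j)"

definition rms :: "'a measure \<Rightarrow> ('a \<Rightarrow> real) \<Rightarrow> real" where
  "rms P Y = sqrt (\<integral>\<omega>. (Y \<omega>)\<^sup>2 \<partial>P)"


section \<open>The constants\<close>

text \<open>The chi-square distribution with a real number \<open>d > 0\<close> of degrees of freedom.\<close>

definition chi_square_density :: "real \<Rightarrow> real \<Rightarrow> real" where
  "chi_square_density d x =
     (if x > 0 then x powr (d / 2 - 1) * exp (- x / 2) / (2 powr (d / 2) * Gamma (d / 2)) else 0)"

definition chi_square :: "real \<Rightarrow> real measure" where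
  "chi_square d = density lborel (chi_square_density d)"

definition gamma_const :: "real \<Rightarrow> real" where
  "gamma_const d = (\<integral>x. x powr (- 1 / 2) \<partial>chi_square d)"

lemma gamma_const_eq:
  assumes d: "d > 1"
  shows "gamma_const d = 2 powr (- 1 / 2) * Gamma ((d - 1) / 2) / Gamma (d / 2)"
proof -
  define s where "s = (d - 1) / 2"
  have s: "s > 0" "d = 2 * s + 1" using d by (auto simp: s_def field_simps)
  have Gpos: "Gamma (d / 2) > 0" "Gamma s > 0" using d s by (auto intro!: Gamma_real_pos)
  let ?C = "2 powr (d / 2) * Gamma (d / 2)"
  let ?g = "\<lambda>t::real. indicator {0..} t * t powr (s - 1) / exp t"
  have "gamma_const d = (\<integral>x. chi_square_density d x *\<^sub>R x powr (- 1 / 2) \<partial>lborel)"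
    unfolding gamma_const_def chi_square_def
    by (rule integral_density)
       (use Gpos in \<open>auto simp: chi_square_density_def[abs_def] intro!: divide_nonneg_nonneg\<close>)
  also have "\<dots> = 2 * (\<integral>x. chi_square_density d (2 * x) * (2 * x) powr (- 1 / 2) \<partial>lborel)"
    using lborel_integral_real_affine[of 2 "\<lambda>x. chi_square_density d x *\<^sub>R x powr (- 1 / 2)" 0]
    by simp
  also have "(\<lambda>x. chi_square_density d (2 * x) * (2 * x) powr (- 1 / 2)) =
               (\<lambda>x. 2 powr (s - 1) / ?C * ?g x)"
  proof
    fix x :: real
    show "chi_square_density d (2 * x) * (2 * x) powr (- 1 / 2) = 2 powr (s - 1) / ?C * ?g x"
    proof (cases "x > 0")
      case True
      have "(2 * x) powr (d / 2 - 1) * (2 * x) powr (- 1 / 2) = (2 * x) powr (s - 1)"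
        unfolding powr_add[symmetric] by (simp add: s(2) add_divide_distrib)
      also have "\<dots> = 2 powr (s - 1) * x powr (s - 1)"
        using True by (simp add: powr_mult)
      finally have e: "(2 * x) powr (d / 2 - 1) * (2 * x) powr (- 1 / 2) =
                         2 powr (s - 1) * x powr (s - 1)" .
      have "chi_square_density d (2 * x) * (2 * x) powr (- 1 / 2) =
              ((2 * x) powr (d / 2 - 1) * (2 * x) powr (- 1 / 2)) * exp (- x) / ?C"
        using True by (simp add: chi_square_density_def)
      also have "\<dots> = 2 powr (s - 1) * x powr (s - 1) * exp (- x) / ?C"
        by (simp only: e)
      also have "\<dots> = 2 powr (s - 1) / ?C * ?g x"
        using True by (simp add: exp_minus inverse_eq_divide)
      finally show ?thesis .
    qed (auto simp: chi_square_density_def indicator_def)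
  qed
  also have "(\<integral>x. 2 powr (s - 1) / ?C * ?g x \<partial>lborel) = 2 powr (s - 1) / ?C * Gamma s"
  proof -
    have "(\<integral>x. ?g x \<partial>lborel) = enn2real (\<integral>\<^sup>+x. ennreal (?g x) \<partial>lborel)"
      by (rule integral_eq_nn_integral) auto
    also have "\<dots> = Gamma s"
      using Gpos by (simp flip: Gamma_conv_nn_integral_real[OF s(1)])
    finally show ?thesis by (subst integral_mult_right_zero) simp
  qed
  also have "2 * (2 powr (s - 1) / ?C * Gamma s) = 2 powr (- 1 / 2) * Gamma s / Gamma (d / 2)"
  proof -
    have "2 * 2 powr (s - 1) = 2 powr (d / 2) * (2::real) powr (- 1 / 2)"
      using powr_add[of "2::real" 1 "s - 1"] powr_add[of "2::real" "d / 2" "- 1 / 2"]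
      by (simp add: s(2) field_simps)
    then have "2 * (2 powr (s - 1) / ?C * Gamma s)
                 = 2 powr (d / 2) * 2 powr (- 1 / 2) * Gamma s / ?C"
      by (metis (no_types, lifting) mult.assoc times_divide_eq_left times_divide_eq_right)
    then show ?thesis by simp
  qed
  finally show ?thesis by (simp add: s_def)
qed

text \<open>Relevant only for \<open>k \<ge> n + 1\<close>, when every \<open>gamma_const\<close> has an argument above 1.\<close>

definition B_real ::
  "'a measure \<Rightarrow> nat \<Rightarrow> nat \<Rightarrow> ('a \<Rightarrow> nat \<Rightarrow> nat \<Rightarrow> real) \<Rightarrow> real" where
  "B_real P k n X =
     sqrt (2 / pi) * rms P (\<lambda>\<omega>. gram_hafnian k n (X \<omega>)) *
     (\<Prod>j<n. gamma_const (real k - real j)) *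
     (\<Prod>r=2..n. gamma_const (2 * real r - 1))"

definition b_real :: "nat \<Rightarrow> real" where
  "b_real n =
     sqrt (2 / pi) * sqrt (real (double_fact (2 * n - 1))) *
     (\<Prod>r=2..n. gamma_const (2 * real r - 1))"

end

theory Submission
  imports Defs
begin

text \<open>
  A hafnian is linear in each row of its matrix. Singling out one vertex gives
  \<open>H\<^sub>n = \<langle>\<rho>, v\<rangle>\<close>, where \<open>\<rho>\<close> is the Gaussian row of that vertex and the entries of \<open>v\<close> are
  the hafnians that remain when the vertex and one of its neighbours are deleted. Given the other
  rows, \<open>H\<^sub>n\<close> is centred normal with variance \<open>\<bar>v\<bar>\<^sup>2\<close>. So \<open>H\<^sub>n\<close> is a variance mixture of centred
  normal laws; as soon as \<open>E (1 / \<bar>v\<bar>)\<close> is finite it has a continuous even density that is maximal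
  at zero, and its value there is \<open>E (1 / \<bar>v\<bar>) / sqrt (2 \<pi>)\<close>, which is also the integral of the
  (nonnegative) characteristic function of \<open>H\<^sub>n\<close> divided by \<open>2 \<pi>\<close>.

  That integral is bounded by induction on \<open>n\<close>. For a deterministic row \<open>\<theta>\<close> the form \<open>\<langle>\<theta>, v\<rangle>\<close> is a
  hafnian with a deterministic border. The heart of the proof is that moving the whole mass of the
  border to one vertex can only increase the modulus of the characteristic function
  (\<open>norm_border_char_le\<close>), so that
  \<open>\<bar>E exp (i u \<langle>\<theta>, v\<rangle>)\<bar> \<le> \<bar>E exp (i u \<bar>\<theta>\<bar> H\<^sub>n\<^sub>-\<^sub>1)\<bar>\<close>. Averaging over a Gaussian \<open>\<theta>\<close> in dimension
  \<open>2 n - 1\<close> and integrating over \<open>u\<close> costs the factor \<open>E (1 / \<bar>\<theta>\<bar>) = \<gamma>\<^sub>2\<^sub>n\<^sub>-\<^sub>1\<close>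
  (\<open>nn_integral_haf_char_step\<close>), whence the product of the \<open>\<gamma>\<close> constants.

  To compare two borders that differ at vertices \<open>i\<close> and \<open>j\<close> only, all edges that avoid both vertices
  are fixed. What is left is the Gaussian average of a phase
  \<open>s \<langle>b, w\<rangle> + t \<langle>a, w\<rangle> + \<langle>a, B b\<rangle>\<close> with \<open>B\<close> symmetric, where \<open>s\<close> and \<open>t\<close> are the two border entries.
  Rotating two independent copies by 45 degrees evaluates the squared modulus of this average, a
  further rotation shows that it depends on \<open>s\<^sup>2 + t\<^sup>2\<close> only, and for \<open>t = 0\<close> the average is positive
  (\<open>norm_oscillating\<close>).

  The bound \<open>n powr (3 / 8)\<close> comes from
  \<open>sqrt (2 x) * \<gamma>\<^sub>2\<^sub>x \<le> (x / (x - 1)) powr (3 / 8)\<close>, applied at \<open>x = r - 1 / 2\<close>, where the product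
  over \<open>r\<close> telescopes.

  For the limit \<open>k \<rightarrow> \<infinity>\<close> the normalised Gram entries \<open>\<langle>x\<^sub>i, x\<^sub>j\<rangle> / sqrt k\<close> are replaced by fresh
  independent normal variables, one vertex after the other (\<open>hyb_step\<close>). Given everything that does
  not touch the vertex, the hafnian is centred normal before and after the replacement, and the two
  conditional variances differ by \<open>\<Sum> h\<^sub>l h\<^sub>m (\<langle>x\<^sub>l, x\<^sub>m\<rangle> / k - \<delta>\<^sub>l\<^sub>m)\<close>, whose mean absolute value is
  of order \<open>1 / sqrt k\<close>. For the test function \<open>exp (i u t)\<close> this gives convergence in distribution by
  the continuity theorem of Levy; for the test function \<open>t\<^sup>2\<close> it gives the limit of the second moments.
\<close>

section \<open>Products of standard normal measures\<close>

abbreviation std_normal :: "real measure" where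
  "std_normal \<equiv> std_normal_distribution"

definition gauss :: "'i set \<Rightarrow> ('i \<Rightarrow> real) measure" where
  "gauss I = Pi\<^sub>M I (\<lambda>_. std_normal)"

lemma prob_space_std_normal: "prob_space std_normal"
  using real_dist_normal_dist by (simp add: real_distribution_def)

lemma product_sigma_finite_std_normal: "product_sigma_finite (\<lambda>_. std_normal)"
  by (intro product_sigma_finite.intro prob_space_imp_sigma_finite prob_space_std_normal)

lemma prob_space_gauss: "prob_space (gauss I)"
  unfolding gauss_def by (intro prob_space_PiM prob_space_std_normal)

lemma sets_gauss [measurable_cong]: "sets (gauss I) = sets (Pi\<^sub>M I (\<lambda>_. borel))"
  unfolding gauss_def by (intro sets_PiM_cong) auto

lemma space_gauss: "space (gauss I) = (\<Pi>\<^sub>E i\<in>I. UNIV)"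
  unfolding gauss_def by (simp add: space_PiM)

lemma sigma_finite_gauss: "sigma_finite_measure (gauss I)"
  by (meson finite_measure.axioms(1) prob_space.axioms(1) prob_space_gauss)

lemma pair_sigma_finite_gauss: "pair_sigma_finite (gauss I) (gauss J)"
  by (intro pair_sigma_finite.intro sigma_finite_gauss)

lemma prob_space_gauss_pair: "prob_space (gauss I \<Otimes>\<^sub>M gauss J)"
proof -
  interpret pair_prob_space "gauss I" "gauss J"
    by (intro pair_prob_space.intro pair_sigma_finite_gauss prob_space_gauss)
  show ?thesis by unfold_locales
qed

lemma emeasure_gauss_box:
  assumes "finite I" "\<And>i. i \<in> I \<Longrightarrow> A i \<in> sets borel"
  shows "emeasure (gauss I) (Pi\<^sub>E I A) = (\<Prod>i\<in>I. emeasure std_normal (A i))"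
proof -
  interpret product_sigma_finite "\<lambda>_. std_normal"
    by (rule product_sigma_finite_std_normal)
  show ?thesis using assms unfolding gauss_def by (subst emeasure_PiM) auto
qed

text \<open>A measure on a finite product of real lines is determined by its values on boxes.\<close>

lemma gauss_eqI:
  assumes I: "finite I" and M: "prob_space M" and sM: "sets M = sets (Pi\<^sub>M I (\<lambda>_. borel))"
    and box: "\<And>A. (\<And>i. i \<in> I \<Longrightarrow> A i \<in> sets borel) \<Longrightarrow>
      emeasure M (Pi\<^sub>E I A) = (\<Prod>i\<in>I. emeasure std_normal (A i))"
  shows "M = gauss I"
proof -
  interpret M: prob_space M by fact
  show ?thesis
  proof (rule measure_eqI_PiM_finite[where A = "\<lambda>_::nat. \<Pi>\<^sub>E i\<in>I. UNIV" and M = "\<lambda>_. borel"])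
    show "sets M = sets (Pi\<^sub>M I (\<lambda>_. borel))" by fact
    show "sets (gauss I) = sets (Pi\<^sub>M I (\<lambda>_. borel))" by (rule sets_gauss)
    show "range (\<lambda>_::nat. \<Pi>\<^sub>E i\<in>I. UNIV) \<subseteq> prod_algebra I (\<lambda>_. borel::real measure)"
      using I by (auto intro!: prod_algebraI_finite)
      fix A assume "\<And>i. i \<in> I \<Longrightarrow> A i \<in> sets (borel :: real measure)"
    then show "emeasure M (Pi\<^sub>E I A) = emeasure (gauss I) (Pi\<^sub>E I A)"
      using I by (simp add: box emeasure_gauss_box)
  qed (use I in \<open>auto simp: space_PiM M.emeasure_eq_measure\<close>)
qed

text \<open>Every disintegration of a Gaussian family used below (fixing a row, an edge set, a vertex) is
  a relabelling of the index set as a disjoint sum, described by a bijection \<open>\<phi>\<close>; the two parts of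
  the sum are then integrated one after the other.\<close>

definition assemble :: "('i \<Rightarrow> 'a + 'b) \<Rightarrow> 'i set \<Rightarrow> ('a \<Rightarrow> real) \<Rightarrow> ('b \<Rightarrow> real) \<Rightarrow> 'i \<Rightarrow> real" where
  "assemble \<phi> I x y = (\<lambda>i\<in>I. case \<phi> i of Inl a \<Rightarrow> x a | Inr b \<Rightarrow> y b)"

lemma measurable_assemble:
  assumes "\<phi> ` I \<subseteq> A <+> B"
  shows "(\<lambda>z. assemble \<phi> I (fst z) (snd z)) \<in>
    Pi\<^sub>M A (\<lambda>_. borel) \<Otimes>\<^sub>M Pi\<^sub>M B (\<lambda>_. borel) \<rightarrow>\<^sub>M Pi\<^sub>M I (\<lambda>_. borel)"
  unfolding assemble_def
proof (rule measurable_restrict)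
  fix i assume "i \<in> I"
  then have "\<phi> i \<in> A <+> B" using assms by auto
  then show "(\<lambda>z. case \<phi> i of Inl a \<Rightarrow> fst z a | Inr b \<Rightarrow> snd z b) \<in>
    borel_measurable (Pi\<^sub>M A (\<lambda>_. borel) \<Otimes>\<^sub>M Pi\<^sub>M B (\<lambda>_. borel))"
    by (auto simp: Plus_def intro!: measurable_compose[OF measurable_fst] measurable_compose[OF measurable_snd]
        measurable_component_singleton)
qed

lemma measurable_assemble' [measurable]:
  assumes "bij_betw \<phi> I (A <+> B)"
  shows "(\<lambda>z. assemble \<phi> I (fst z) (snd z)) \<in> gauss A \<Otimes>\<^sub>M gauss B \<rightarrow>\<^sub>M gauss I"
proof -
  have "\<phi> ` I \<subseteq> A <+> B" using assms by (simp add: bij_betw_def)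
  from measurable_assemble[OF this] show ?thesis
    by (simp cong: measurable_cong_sets add: sets_gauss sets_pair_measure_cong[OF sets_gauss sets_gauss])
qed

text \<open>The preimage of a box under \<open>assemble \<phi> I\<close> is a product of two boxes, so that the masses
  agree factor by factor.\<close>

lemma distr_assemble:
  assumes I: "finite I" and bij: "bij_betw \<phi> I (A <+> B)"
  shows "distr (gauss A \<Otimes>\<^sub>M gauss B) (gauss I) (\<lambda>z. assemble \<phi> I (fst z) (snd z)) = gauss I"
    (is "distr ?M _ ?T = _")
proof (rule gauss_eqI[OF I])
  have fin: "finite A" "finite B"
    using bij_betw_finite[OF bij] I by (auto simp: finite_Plus_iff)
  have img: "\<phi> ` I = A <+> B" using bij by (simp add: bij_betw_def)
  note T = measurable_assemble'[OF bij]
  interpret MM: prob_space ?M by (rule prob_space_gauss_pair)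
  show "prob_space (distr ?M (gauss I) ?T)" by (rule MM.prob_space_distr[OF T])
  show "sets (distr ?M (gauss I) ?T) = sets (Pi\<^sub>M I (\<lambda>_. borel))" by (simp add: sets_gauss)
  fix X assume X: "\<And>i. i \<in> I \<Longrightarrow> X i \<in> sets (borel :: real measure)"
  define \<psi> where "\<psi> = the_inv_into I \<phi>"
  have inj: "inj_on \<phi> I" using bij by (simp add: bij_betw_def)
  have \<psi>: "\<psi> (\<phi> i) = i" if "i \<in> I" for i
    using that inj by (simp add: \<psi>_def the_inv_into_f_f)
  have \<psi>': "\<psi> c \<in> I" "\<phi> (\<psi> c) = c" if "c \<in> A <+> B" for c
    using that img inj by (auto simp: \<psi>_def f_the_inv_into_f the_inv_into_into)
  have XA: "X (\<psi> (Inl a)) \<in> sets borel" if "a \<in> A" for a using \<psi>' that by (intro X) auto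
  have XB: "X (\<psi> (Inr a)) \<in> sets borel" if "a \<in> B" for a using \<psi>' that by (intro X) auto
  have "?T -` Pi\<^sub>E I X \<inter> space ?M = (\<Pi>\<^sub>E a\<in>A. X (\<psi> (Inl a))) \<times> (\<Pi>\<^sub>E b\<in>B. X (\<psi> (Inr b)))"
  proof (intro set_eqI iffI)
    fix z assume z: "z \<in> ?T -` Pi\<^sub>E I X \<inter> space ?M"
    have *: "(case \<phi> i of Inl a \<Rightarrow> fst z a | Inr b \<Rightarrow> snd z b) \<in> X i" if "i \<in> I" for i
      using z that by (auto simp: assemble_def PiE_iff split: if_splits)
    have "fst z a \<in> X (\<psi> (Inl a))" if "a \<in> A" for a
      using *[of "\<psi> (Inl a)"] \<psi>'[OF InlI[OF that]] by simp
    moreover have "snd z a \<in> X (\<psi> (Inr a))" if "a \<in> B" for a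
      using *[of "\<psi> (Inr a)"] \<psi>'[OF InrI[OF that]] by simp
    ultimately show "z \<in> (\<Pi>\<^sub>E a\<in>A. X (\<psi> (Inl a))) \<times> (\<Pi>\<^sub>E b\<in>B. X (\<psi> (Inr b)))"
      using z by (cases z) (auto simp: space_pair_measure space_gauss PiE_iff)
  next
    fix z assume z: "z \<in> (\<Pi>\<^sub>E a\<in>A. X (\<psi> (Inl a))) \<times> (\<Pi>\<^sub>E b\<in>B. X (\<psi> (Inr b)))"
    have "(case \<phi> i of Inl a \<Rightarrow> fst z a | Inr b \<Rightarrow> snd z b) \<in> X i" if "i \<in> I" for i
    proof -
      have "\<phi> i \<in> A <+> B" using img that by auto
      then show ?thesis using z \<psi>[OF that] by (cases z) (auto simp: PiE_iff split: sum.split)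
    qed
    then show "z \<in> ?T -` Pi\<^sub>E I X \<inter> space ?M"
      using z by (cases z) (auto simp: assemble_def space_pair_measure space_gauss PiE_iff)
  qed
  then have "emeasure (distr ?M (gauss I) ?T) (Pi\<^sub>E I X) =
      emeasure ?M ((\<Pi>\<^sub>E a\<in>A. X (\<psi> (Inl a))) \<times> (\<Pi>\<^sub>E b\<in>B. X (\<psi> (Inr b))))"
    using X I by (subst emeasure_distr[OF T]) (auto simp: sets_gauss intro!: sets_PiM_I_finite)
  also have "\<dots> = emeasure (gauss A) (\<Pi>\<^sub>E a\<in>A. X (\<psi> (Inl a))) * emeasure (gauss B) (\<Pi>\<^sub>E b\<in>B. X (\<psi> (Inr b)))"
    using XA XB fin sigma_finite_gauss
    by (subst sigma_finite_measure.emeasure_pair_measure_Times) (auto simp: sets_gauss intro!: sets_PiM_I_finite)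
  also have "\<dots> = (\<Prod>a\<in>A. emeasure std_normal (X (\<psi> (Inl a)))) * (\<Prod>b\<in>B. emeasure std_normal (X (\<psi> (Inr b))))"
    using XA XB fin by (simp add: emeasure_gauss_box)
  also have "\<dots> = (\<Prod>c\<in>A <+> B. emeasure std_normal (X (\<psi> c)))"
    using fin by (simp add: prod.Plus comp_def)
  also have "\<dots> = (\<Prod>i\<in>I. emeasure std_normal (X i))"
    by (rule prod.reindex_bij_betw[OF bij, symmetric, THEN trans]) (auto intro!: prod.cong simp: \<psi>)
  finally show "emeasure (distr ?M (gauss I) ?T) (Pi\<^sub>E I X) = (\<Prod>i\<in>I. emeasure std_normal (X i))" .
qed

lemma integral_assemble:
  fixes f :: "_ \<Rightarrow> 'c::{banach, second_countable_topology}"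
  assumes I: "finite I" and bij: "bij_betw \<phi> I (A <+> B)" and f: "integrable (gauss I) f"
  shows "integrable (gauss A \<Otimes>\<^sub>M gauss B) (\<lambda>z. f (assemble \<phi> I (fst z) (snd z)))"
    and "(\<integral>z. f z \<partial>gauss I) = (\<integral>x. \<integral>y. f (assemble \<phi> I x y) \<partial>gauss B \<partial>gauss A)"
proof -
  note T = measurable_assemble'[OF bij] and D = distr_assemble[OF I bij]
  interpret pair_sigma_finite "gauss A" "gauss B" by (rule pair_sigma_finite_gauss)
  have fm: "f \<in> borel_measurable (gauss I)" using f by auto
  have "integrable (distr (gauss A \<Otimes>\<^sub>M gauss B) (gauss I) (\<lambda>z. assemble \<phi> I (fst z) (snd z))) f"
    using f by (simp add: D)
  then show int: "integrable (gauss A \<Otimes>\<^sub>M gauss B) (\<lambda>z. f (assemble \<phi> I (fst z) (snd z)))"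
    by (rule integrable_distr[OF T])
  have "(\<integral>z. f z \<partial>gauss I) = (\<integral>z. f (assemble \<phi> I (fst z) (snd z)) \<partial>(gauss A \<Otimes>\<^sub>M gauss B))"
    using integral_distr[OF T fm] by (simp add: D)
  also have "\<dots> = (\<integral>x. \<integral>y. f (assemble \<phi> I x y) \<partial>gauss B \<partial>gauss A)"
    using integral_fst'[OF int] by simp
  finally show "(\<integral>z. f z \<partial>gauss I) = (\<integral>x. \<integral>y. f (assemble \<phi> I x y) \<partial>gauss B \<partial>gauss A)" .
qed

lemma nn_integral_assemble:
  assumes I: "finite I" and bij: "bij_betw \<phi> I (A <+> B)" and f: "f \<in> borel_measurable (gauss I)"
  shows "(\<integral>\<^sup>+z. f z \<partial>gauss I) = (\<integral>\<^sup>+x. \<integral>\<^sup>+y. f (assemble \<phi> I x y) \<partial>gauss B \<partial>gauss A)"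
proof -
  note T = measurable_assemble'[OF bij] and D = distr_assemble[OF I bij]
  have "(\<integral>\<^sup>+z. f z \<partial>gauss I) = (\<integral>\<^sup>+z. f (assemble \<phi> I (fst z) (snd z)) \<partial>(gauss A \<Otimes>\<^sub>M gauss B))"
    using nn_integral_distr[OF T, of f] f by (simp add: D)
  also have "\<dots> = (\<integral>\<^sup>+x. \<integral>\<^sup>+y. f (assemble \<phi> I x y) \<partial>gauss B \<partial>gauss A)"
    using measurable_compose[OF T f]
    by (subst sigma_finite_measure.nn_integral_fst[OF sigma_finite_gauss, symmetric]) auto
  finally show ?thesis .
qed


lemma nn_integral_std_normal:
  assumes [measurable]: "f \<in> borel_measurable borel"
  shows "(\<integral>\<^sup>+x. f x \<partial>std_normal) = (\<integral>\<^sup>+x. ennreal (std_normal_density x) * f x \<partial>lborel)"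
  by (subst nn_integral_density) auto

lemma nn_integral_std_normal_pair:
  assumes [measurable]: "f \<in> borel_measurable (borel \<Otimes>\<^sub>M borel)"
  shows "(\<integral>\<^sup>+z. f z \<partial>(std_normal \<Otimes>\<^sub>M std_normal)) =
    (\<integral>\<^sup>+x. \<integral>\<^sup>+y. ennreal (exp (-(x\<^sup>2+y\<^sup>2)/2) / (2*pi)) * f (x,y) \<partial>lborel \<partial>lborel)"
proof -
  interpret prob_space std_normal by (rule prob_space_std_normal)
  have "(\<integral>\<^sup>+z. f z \<partial>(std_normal \<Otimes>\<^sub>M std_normal)) = (\<integral>\<^sup>+x. \<integral>\<^sup>+y. f (x,y) \<partial>std_normal \<partial>std_normal)"
    by (subst nn_integral_fst[symmetric]) auto
  also have "\<dots> = (\<integral>\<^sup>+x. ennreal (std_normal_density x) * (\<integral>\<^sup>+y. ennreal (std_normal_density y) * f (x,y) \<partial>lborel) \<partial>lborel)"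
    by (subst nn_integral_std_normal, simp, subst nn_integral_std_normal) auto
  also have "\<dots> = (\<integral>\<^sup>+x. \<integral>\<^sup>+y. ennreal (std_normal_density x) * (ennreal (std_normal_density y) * f (x,y)) \<partial>lborel \<partial>lborel)"
    by (intro nn_integral_cong nn_integral_cmult[symmetric]) auto
  also have "\<dots> = (\<integral>\<^sup>+x. \<integral>\<^sup>+y. ennreal (exp (-(x\<^sup>2+y\<^sup>2)/2) / (2*pi)) * f (x,y) \<partial>lborel \<partial>lborel)"
  proof (intro nn_integral_cong)
    fix x y :: real
    have "std_normal_density x * std_normal_density y = exp (-(x\<^sup>2+y\<^sup>2)/2) / (2*pi)"
      by (simp add: std_normal_density_def mult_exp_exp add_divide_distrib)
    then show "ennreal (std_normal_density x) * (ennreal (std_normal_density y) * f (x,y)) =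
        ennreal (exp (-(x\<^sup>2+y\<^sup>2)/2) / (2*pi)) * f (x,y)"
      by (simp add: mult.assoc[symmetric] ennreal_mult'[symmetric])
  qed
  finally show ?thesis .
qed

text \<open>The joint density depends on \<open>x\<^sup>2 + y\<^sup>2\<close> only, so it is enough that the rotation preserves
  area. It is written as two affine substitutions, each in one variable with the other one fixed; this
  is possible for \<open>c \<noteq> 0\<close>, and the two scaling factors \<open>1 / c\<close> and \<open>c\<close> cancel.\<close>

lemma std_normal_pair_rotation:
  assumes cs: "c\<^sup>2 + s\<^sup>2 = 1" and c: "c \<noteq> 0"
  shows "distr (std_normal \<Otimes>\<^sub>M std_normal) (std_normal \<Otimes>\<^sub>M std_normal)
      (\<lambda>(x,y). (c * x + s * y, c * y - s * x)) = std_normal \<Otimes>\<^sub>M std_normal"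
    (is "distr ?D _ ?R = _")
proof (rule measure_eqI)
  show "sets (distr ?D ?D ?R) = sets ?D" by simp
  have R [measurable]: "?R \<in> ?D \<rightarrow>\<^sub>M ?D" by measurable
  fix A assume "A \<in> sets (distr ?D ?D ?R)"
  then have A [measurable]: "A \<in> sets (borel \<Otimes>\<^sub>M borel)" by simp
  define g :: "real \<Rightarrow> real \<Rightarrow> ennreal"
    where "g x y = ennreal (exp (-(x\<^sup>2+y\<^sup>2)/2) / (2*pi)) * indicator A (x,y)" for x y
  have g [measurable]: "case_prod g \<in> borel_measurable (borel \<Otimes>\<^sub>M borel)"
    unfolding g_def by measurable
  have c2: "c * c + s * s = 1" using cs by (simp add: power2_eq_square)
  have rot: "g (c * x + s * y) (c * y - s * x) =
      ennreal (exp (-(x\<^sup>2+y\<^sup>2)/2) / (2*pi)) * indicator A (?R (x,y))" for x y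
  proof -
    have "(c * x + s * y)\<^sup>2 + (c * y - s * x)\<^sup>2 = (c\<^sup>2 + s\<^sup>2) * (x\<^sup>2 + y\<^sup>2)"
      by (simp add: power2_eq_square algebra_simps)
    then show ?thesis by (simp add: g_def cs)
  qed
  have "emeasure (distr ?D ?D ?R) A = (\<integral>\<^sup>+z. indicator A (?R z) \<partial>?D)"
    using A R by (subst nn_integral_indicator[symmetric], simp, subst nn_integral_distr) auto
  also have "\<dots> = (\<integral>\<^sup>+x. \<integral>\<^sup>+y. g (c * x + s * y) (c * y - s * x) \<partial>lborel \<partial>lborel)"
    by (subst nn_integral_std_normal_pair) (auto simp: rot)
  also have "\<dots> = (\<integral>\<^sup>+y. \<integral>\<^sup>+x. g (c * x + s * y) (c * y - s * x) \<partial>lborel \<partial>lborel)"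
    by (rule lborel_pair.Fubini'[symmetric]) measurable
  also have "\<dots> = (\<integral>\<^sup>+y. ennreal \<bar>1/c\<bar> * (\<integral>\<^sup>+u. g u (y/c - s/c * u) \<partial>lborel) \<partial>lborel)"
  proof (intro nn_integral_cong)
    fix y :: real
    have eq: "c * y - s * (- (s * y / c) + 1 / c * u) = y/c - s/c * u" for u
    proof -
      have "c * y - s * (- (s * y / c) + 1 / c * u) = (c * c + s * s) * y / c - s/c*u"
        using c by (simp add: field_simps)
      then show ?thesis by (simp add: c2)
    qed
    have "(\<integral>\<^sup>+x. g (c * x + s * y) (c * y - s * x) \<partial>lborel) =
        ennreal \<bar>1/c\<bar> * (\<integral>\<^sup>+u. g (c * (- (s * y / c) + 1 / c * u) + s * y)
            (c * y - s * (- (s * y / c) + 1 / c * u)) \<partial>lborel)"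
      using c by (subst nn_integral_real_affine[where c = "1/c" and t = "- (s * y / c)"]) auto
    also have "\<dots> = ennreal \<bar>1/c\<bar> * (\<integral>\<^sup>+u. g u (y/c - s/c * u) \<partial>lborel)"
      unfolding eq using c by (simp add: algebra_simps)
    finally show "(\<integral>\<^sup>+x. g (c * x + s * y) (c * y - s * x) \<partial>lborel) =
        ennreal \<bar>1/c\<bar> * (\<integral>\<^sup>+u. g u (y/c - s/c * u) \<partial>lborel)" .
  qed
  also have "\<dots> = ennreal \<bar>1/c\<bar> * (\<integral>\<^sup>+y. \<integral>\<^sup>+u. g u (y/c - s/c * u) \<partial>lborel \<partial>lborel)"
    by (subst nn_integral_cmult) auto
  also have "(\<integral>\<^sup>+y. \<integral>\<^sup>+u. g u (y/c - s/c * u) \<partial>lborel \<partial>lborel) =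
      (\<integral>\<^sup>+u. \<integral>\<^sup>+y. g u (y/c - s/c * u) \<partial>lborel \<partial>lborel)"
    by (rule lborel_pair.Fubini') measurable
  also have "\<dots> = (\<integral>\<^sup>+u. ennreal \<bar>c\<bar> * (\<integral>\<^sup>+v. g u v \<partial>lborel) \<partial>lborel)"
  proof (intro nn_integral_cong)
    fix u :: real
    have "(\<integral>\<^sup>+y. g u (y/c - s/c * u) \<partial>lborel) =
        ennreal \<bar>c\<bar> * (\<integral>\<^sup>+v. g u ((s * u + c * v)/c - s/c * u) \<partial>lborel)"
      using c by (subst nn_integral_real_affine[where c = c and t = "s * u"]) auto
    also have "(\<lambda>v. (s * u + c * v)/c - s/c * u) = (\<lambda>v. v)" using c by (simp add: field_simps)
    then have "(\<integral>\<^sup>+v. g u ((s * u + c * v)/c - s/c * u) \<partial>lborel) = (\<integral>\<^sup>+v. g u v \<partial>lborel)"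
      by (metis (no_types, lifting))
    finally show "(\<integral>\<^sup>+y. g u (y/c - s/c * u) \<partial>lborel) = ennreal \<bar>c\<bar> * (\<integral>\<^sup>+v. g u v \<partial>lborel)" .
  qed
  also have "\<dots> = ennreal \<bar>c\<bar> * (\<integral>\<^sup>+u. \<integral>\<^sup>+v. g u v \<partial>lborel \<partial>lborel)"
    by (subst nn_integral_cmult) auto
  also have "ennreal \<bar>1/c\<bar> * (ennreal \<bar>c\<bar> * (\<integral>\<^sup>+u. \<integral>\<^sup>+v. g u v \<partial>lborel \<partial>lborel)) =
      (\<integral>\<^sup>+u. \<integral>\<^sup>+v. g u v \<partial>lborel \<partial>lborel)"
    using c by (simp add: mult.assoc[symmetric] ennreal_mult'[symmetric])
  also have "\<dots> = emeasure ?D A"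
    unfolding g_def by (subst nn_integral_std_normal_pair[symmetric]) auto
  finally show "emeasure (distr ?D ?D ?R) A = emeasure ?D A" .
qed

text \<open>A family of independent pairs is a pair of independent families. Both are compared with the
  Gaussian family on \<open>I \<times> UNIV\<close>, the boolean recording the component.\<close>

lemma distr_zip_gauss:
  assumes I: "finite I"
  shows "distr (\<Pi>\<^sub>M i\<in>I. std_normal \<Otimes>\<^sub>M std_normal) (gauss I \<Otimes>\<^sub>M gauss I)
      (\<lambda>z. (\<lambda>i\<in>I. fst (z i), \<lambda>i\<in>I. snd (z i))) = gauss I \<Otimes>\<^sub>M gauss I"
    (is "distr ?P _ ?U = _")
proof -
  let ?D = "std_normal \<Otimes>\<^sub>M std_normal"
  let ?\<phi> = "\<lambda>(i, b). if b then Inl i else Inr i"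
  let ?K = "I \<times> (UNIV :: bool set)"
  let ?J = "\<lambda>z. \<lambda>(i, b)\<in>?K. if b then fst (z i) else snd (z i)"
  let ?V = "\<lambda>x. (\<lambda>i\<in>I. x (i, True), \<lambda>i\<in>I. x (i, False))"
  interpret D: pair_prob_space std_normal std_normal
    by (intro pair_prob_space.intro pair_sigma_finite.intro prob_space_imp_sigma_finite prob_space_std_normal)
  have pD: "prob_space ?D" by unfold_locales
  interpret PP: product_prob_space "\<lambda>_. ?D" I by (intro product_prob_spaceI pD)
  have bij: "bij_betw ?\<phi> ?K (I <+> I)"
    by (rule bij_betwI[where g = "case_sum (\<lambda>i. (i, True)) (\<lambda>i. (i, False))"]) (auto split: if_splits)
  have V: "?V \<in> gauss ?K \<rightarrow>\<^sub>M gauss I \<Otimes>\<^sub>M gauss I" by measurable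
  have J: "?J \<in> ?P \<rightarrow>\<^sub>M gauss ?K"
  proof -
    have "?J \<in> ?P \<rightarrow>\<^sub>M Pi\<^sub>M ?K (\<lambda>_. borel)"
      by (rule measurable_restrict) (auto intro!: measurable_compose[OF measurable_component_singleton])
    then show ?thesis by (simp cong: measurable_cong_sets add: sets_gauss)
  qed
  have dJ: "distr ?P (gauss ?K) ?J = gauss ?K"
  proof (rule gauss_eqI)
    show "finite ?K" using I by simp
    show "prob_space (distr ?P (gauss ?K) ?J)" by (rule PP.prob_space_distr[OF J])
    show "sets (distr ?P (gauss ?K) ?J) = sets (Pi\<^sub>M ?K (\<lambda>_. borel))" by (simp add: sets_gauss)
    fix A assume A: "\<And>k. k \<in> ?K \<Longrightarrow> A k \<in> sets (borel :: real measure)"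
    have "?J -` (Pi\<^sub>E ?K A) \<inter> space ?P = (\<Pi>\<^sub>E i\<in>I. A (i, True) \<times> A (i, False))"
      by (auto simp: space_PiM PiE_iff space_pair_measure Pi_iff mem_Times_iff all_bool_eq split: if_splits)
    then have "emeasure (distr ?P (gauss ?K) ?J) (Pi\<^sub>E ?K A) = emeasure ?P (\<Pi>\<^sub>E i\<in>I. A (i, True) \<times> A (i, False))"
      using A I by (subst emeasure_distr[OF J]) (auto simp: sets_gauss intro!: sets_PiM_I_finite)
    also have "\<dots> = (\<Prod>i\<in>I. emeasure ?D (A (i, True) \<times> A (i, False)))"
      using A I by (subst PP.emeasure_PiM) auto
    also have "\<dots> = (\<Prod>i\<in>I. \<Prod>b\<in>UNIV. emeasure std_normal (A (i, b)))"
      using A by (intro prod.cong refl) (simp add: sigma_finite_measure.emeasure_pair_measure_Times[OF prob_space_imp_sigma_finite[OF prob_space_std_normal]] UNIV_bool mult.commute)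
    also have "\<dots> = (\<Prod>k\<in>?K. emeasure std_normal (A k))"
      by (simp add: prod.cartesian_product split_def)
    finally show "emeasure (distr ?P (gauss ?K) ?J) (Pi\<^sub>E ?K A) = (\<Prod>k\<in>?K. emeasure std_normal (A k))" .
  qed
  have VA: "?V (assemble ?\<phi> ?K (fst z) (snd z)) = z" if "z \<in> space (gauss I \<Otimes>\<^sub>M gauss I)" for z
    using that by (cases z) (auto simp: assemble_def space_pair_measure space_gauss PiE_iff extensional_def fun_eq_iff)
  have "gauss I \<Otimes>\<^sub>M gauss I = distr (gauss I \<Otimes>\<^sub>M gauss I) (gauss I \<Otimes>\<^sub>M gauss I) (\<lambda>z. ?V (assemble ?\<phi> ?K (fst z) (snd z)))"
    by (subst distr_cong[OF refl refl VA]) (auto simp: distr_id2)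
  also have "\<dots> = distr (distr (gauss I \<Otimes>\<^sub>M gauss I) (gauss ?K) (\<lambda>z. assemble ?\<phi> ?K (fst z) (snd z))) (gauss I \<Otimes>\<^sub>M gauss I) ?V"
    using distr_distr[OF V measurable_assemble'[OF bij]] by (simp add: comp_def)
  also have "\<dots> = distr (gauss ?K) (gauss I \<Otimes>\<^sub>M gauss I) ?V"
    using I bij by (subst distr_assemble) auto
  also have "\<dots> = distr (distr ?P (gauss ?K) ?J) (gauss I \<Otimes>\<^sub>M gauss I) ?V" by (simp only: dJ)
  also have "\<dots> = distr ?P (gauss I \<Otimes>\<^sub>M gauss I) (?V \<circ> ?J)" by (rule distr_distr[OF V J])
  also have "\<dots> = distr ?P (gauss I \<Otimes>\<^sub>M gauss I) ?U"
    by (intro distr_cong refl) (auto simp: fun_eq_iff)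
  finally show ?thesis by simp
qed

text \<open>Two independent copies of a Gaussian family are rotated index by index.\<close>

lemma distr_gauss_rotation:
  assumes I: "finite I" and cs: "c\<^sup>2 + s\<^sup>2 = 1" and c: "c \<noteq> 0"
  shows "distr (gauss I \<Otimes>\<^sub>M gauss I) (gauss I \<Otimes>\<^sub>M gauss I)
      (\<lambda>z. (\<lambda>i\<in>I. c * fst z i + s * snd z i, \<lambda>i\<in>I. c * snd z i - s * fst z i)) = gauss I \<Otimes>\<^sub>M gauss I"
    (is "distr ?M _ ?R = _")
proof -
  let ?D = "std_normal \<Otimes>\<^sub>M std_normal"
  let ?P = "\<Pi>\<^sub>M i\<in>I. ?D"
  let ?U = "\<lambda>z. (\<lambda>i\<in>I. fst (z i), \<lambda>i\<in>I. snd (z i))"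
  let ?r = "\<lambda>(x,y). (c * x + s * y, c * y - s * x)"
  interpret D: pair_prob_space std_normal std_normal
    by (intro pair_prob_space.intro pair_sigma_finite.intro prob_space_imp_sigma_finite prob_space_std_normal)
  have pD: "prob_space ?D" by unfold_locales
  have U: "?U \<in> ?P \<rightarrow>\<^sub>M ?M"
  proof -
    have "?U \<in> ?P \<rightarrow>\<^sub>M Pi\<^sub>M I (\<lambda>_. borel) \<Otimes>\<^sub>M Pi\<^sub>M I (\<lambda>_. borel)"
      by (intro measurable_Pair measurable_restrict)
         (auto intro!: measurable_compose[OF measurable_component_singleton])
    then show ?thesis
      by (simp cong: measurable_cong_sets add: sets_pair_measure_cong[OF sets_gauss sets_gauss])
  qed
  have R: "?R \<in> ?M \<rightarrow>\<^sub>M ?M" by measurable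
  have r: "?r \<in> ?D \<rightarrow>\<^sub>M ?D" by measurable
  have C: "compose I ?r \<in> ?P \<rightarrow>\<^sub>M ?P"
    unfolding compose_def using r by (intro measurable_restrict) (auto intro: measurable_compose[OF measurable_component_singleton])
  have "distr ?M ?M ?R = distr (distr ?P ?M ?U) ?M ?R" by (simp only: distr_zip_gauss[OF I])
  also have "\<dots> = distr ?P ?M (?R \<circ> ?U)" by (rule distr_distr[OF R U])
  also have "\<dots> = distr ?P ?M (?U \<circ> compose I ?r)"
    by (intro distr_cong refl) (auto simp: fun_eq_iff compose_def split_def)
  also have "\<dots> = distr (distr ?P ?P (compose I ?r)) ?M ?U" by (rule distr_distr[OF U C, symmetric])
  also have "distr ?P ?P (compose I ?r) = ?P"
    using I pD r by (subst distr_PiM_finite_prob_space') (auto simp only: std_normal_pair_rotation[OF cs c])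
  also have "distr ?P ?M ?U = ?M" by (rule distr_zip_gauss[OF I])
  finally show ?thesis .
qed


lemma integrable_iexp_std_normal: "integrable std_normal (\<lambda>z. iexp (t * z))"
proof -
  interpret prob_space std_normal by (rule prob_space_std_normal)
  show ?thesis by (rule integrable_const_bound[where B = 1]) auto
qed

text \<open>The exponential of a sum is a product, which integrates factor by factor.\<close>

lemma gauss_iexp_linear:
  assumes I: "finite I"
  shows "(\<integral>x. iexp (\<Sum>i\<in>I. c i * x i) \<partial>gauss I) = complex_of_real (exp (- (\<Sum>i\<in>I. (c i)\<^sup>2) / 2))"
proof -
  interpret product_sigma_finite "\<lambda>_. std_normal" by (rule product_sigma_finite_std_normal)
  have "(\<integral>x. iexp (\<Sum>i\<in>I. c i * x i) \<partial>gauss I) = (\<integral>x. (\<Prod>i\<in>I. iexp (c i * x i)) \<partial>gauss I)"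
    using I by (simp add: exp_sum[symmetric] sum_distrib_left)
  also have "\<dots> = (\<Prod>i\<in>I. \<integral>z. iexp (c i * z) \<partial>std_normal)"
    unfolding gauss_def using I integrable_iexp_std_normal by (intro product_integral_prod) auto
  also have "\<dots> = (\<Prod>i\<in>I. complex_of_real (exp (- (c i)\<^sup>2 / 2)))"
    using fun_cong[OF char_std_normal_distribution] by (intro prod.cong refl) (simp add: char_def)
  also have "\<dots> = complex_of_real (exp (- (\<Sum>i\<in>I. (c i)\<^sup>2) / 2))"
    by (simp flip: of_real_prod exp_sum[OF I] add: sum_negf sum_divide_distrib)
  finally show ?thesis .
qed

lemma measurable_gauss_component [measurable (raw)]: 
  "i \<in> I \<Longrightarrow> (\<lambda>x. x i) \<in> borel_measurable (gauss I)"
  by (simp cong: measurable_cong_sets add: sets_gauss)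

text \<open>Both sides have the same characteristic function.\<close>

lemma distr_gauss_linear:
  assumes I: "finite I"
  shows "distr (gauss I) borel (\<lambda>x. \<Sum>i\<in>I. c i * x i) =
    distr std_normal borel (\<lambda>z. sqrt (\<Sum>i\<in>I. (c i)\<^sup>2) * z)"
proof (rule Levy_uniqueness)
  interpret G: prob_space "gauss I" by (rule prob_space_gauss)
  interpret N: prob_space std_normal by (rule prob_space_std_normal)
  have m: "(\<lambda>x. \<Sum>i\<in>I. c i * x i) \<in> borel_measurable (gauss I)" by measurable
  show "real_distribution (distr (gauss I) borel (\<lambda>x. \<Sum>i\<in>I. c i * x i))"
    using G.real_distribution_distr[OF m] by simp
  show "real_distribution (distr std_normal borel (\<lambda>z. sqrt (\<Sum>i\<in>I. (c i)\<^sup>2) * z))"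
    by (rule N.real_distribution_distr) simp
  show "char (distr (gauss I) borel (\<lambda>x. \<Sum>i\<in>I. c i * x i)) =
      char (distr std_normal borel (\<lambda>z. sqrt (\<Sum>i\<in>I. (c i)\<^sup>2) * z))"
  proof
    fix t
    have "char (distr (gauss I) borel (\<lambda>x. \<Sum>i\<in>I. c i * x i)) t =
        (\<integral>x. iexp (t * (\<Sum>i\<in>I. c i * x i)) \<partial>gauss I)"
      unfolding char_def by (subst integral_distr[OF m]) auto
    also have "\<dots> = (\<integral>x. iexp (\<Sum>i\<in>I. t * c i * x i) \<partial>gauss I)"
      by (simp add: sum_distrib_left mult.assoc)
    also have "\<dots> = complex_of_real (exp (- (t\<^sup>2 * (\<Sum>i\<in>I. (c i)\<^sup>2)) / 2))"
      by (subst gauss_iexp_linear[OF I]) (simp add: power_mult_distrib sum_distrib_left)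
    also have "t\<^sup>2 * (\<Sum>i\<in>I. (c i)\<^sup>2) = (t * sqrt (\<Sum>i\<in>I. (c i)\<^sup>2))\<^sup>2"
      by (simp add: power_mult_distrib sum_nonneg)
    also have "complex_of_real (exp (- (t * sqrt (\<Sum>i\<in>I. (c i)\<^sup>2))\<^sup>2 / 2)) =
        char std_normal (t * sqrt (\<Sum>i\<in>I. (c i)\<^sup>2))"
      by (simp add: char_std_normal_distribution)
    also have "\<dots> = char (distr std_normal borel (\<lambda>z. sqrt (\<Sum>i\<in>I. (c i)\<^sup>2) * z)) t"
      unfolding char_def by (subst integral_distr) (auto simp: mult_ac)
    finally show "char (distr (gauss I) borel (\<lambda>x. \<Sum>i\<in>I. c i * x i)) t =
        char (distr std_normal borel (\<lambda>z. sqrt (\<Sum>i\<in>I. (c i)\<^sup>2) * z)) t" .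
  qed
qed

lemma integral_gauss_linear:
  fixes f :: "real \<Rightarrow> 'b::{banach, second_countable_topology}"
  assumes I: "finite I" and f: "f \<in> borel_measurable borel"
  shows "(\<integral>x. f (\<Sum>i\<in>I. c i * x i) \<partial>gauss I) = (\<integral>z. f (sqrt (\<Sum>i\<in>I. (c i)\<^sup>2) * z) \<partial>std_normal)"
proof -
  have m: "(\<lambda>x. \<Sum>i\<in>I. c i * x i) \<in> borel_measurable (gauss I)" by measurable
  show ?thesis
    using integral_distr[OF m f] integral_distr[OF _ f, of "\<lambda>z. sqrt (\<Sum>i\<in>I. (c i)\<^sup>2) * z" std_normal]
    by (simp add: distr_gauss_linear[OF I])
qed

lemma nn_integral_gauss_linear:
  assumes I: "finite I" and f: "f \<in> borel_measurable borel"
  shows "(\<integral>\<^sup>+x. f (\<Sum>i\<in>I. c i * x i) \<partial>gauss I) = (\<integral>\<^sup>+z. f (sqrt (\<Sum>i\<in>I. (c i)\<^sup>2) * z) \<partial>std_normal)"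
proof -
  have m: "(\<lambda>x. \<Sum>i\<in>I. c i * x i) \<in> borel_measurable (gauss I)" by measurable
  show ?thesis
    using nn_integral_distr[OF m, of f] nn_integral_distr[of "\<lambda>z. sqrt (\<Sum>i\<in>I. (c i)\<^sup>2) * z" std_normal borel f] f
    by (simp add: distr_gauss_linear[OF I])
qed

lemma nn_integral_std_normal_moment:
  shows "(\<integral>\<^sup>+z. ennreal (z ^ (2 * k)) \<partial>std_normal) = ennreal (fact (2 * k) / (2^k * fact k))"
  using std_normal_distribution_even_moments[of k]
  by (subst nn_integral_eq_integral) auto

lemma nn_integral_gauss_linear_moment:
  assumes I: "finite I"
  shows "(\<integral>\<^sup>+x. ennreal ((\<Sum>i\<in>I. c i * x i) ^ (2 * k)) \<partial>gauss I) =
    ennreal (fact (2 * k) / (2^k * fact k) * (\<Sum>i\<in>I. (c i)\<^sup>2) ^ k)"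
proof -
  have "(\<integral>\<^sup>+x. ennreal ((\<Sum>i\<in>I. c i * x i) ^ (2 * k)) \<partial>gauss I) =
      (\<integral>\<^sup>+z. ennreal ((sqrt (\<Sum>i\<in>I. (c i)\<^sup>2) * z) ^ (2 * k)) \<partial>std_normal)"
    by (subst nn_integral_gauss_linear[OF I, of "\<lambda>x. ennreal (x ^ (2 * k))"]) auto
  also have "\<dots> = (\<integral>\<^sup>+z. ennreal ((\<Sum>i\<in>I. (c i)\<^sup>2) ^ k) * ennreal (z ^ (2 * k)) \<partial>std_normal)"
    by (intro nn_integral_cong) (simp add: power_mult power_mult_distrib sum_nonneg ennreal_mult'[symmetric])
  also have "\<dots> = ennreal ((\<Sum>i\<in>I. (c i)\<^sup>2) ^ k) * ennreal (fact (2 * k) / (2^k * fact k))"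
    by (subst nn_integral_cmult) (auto simp: nn_integral_std_normal_moment)
  also have "\<dots> = ennreal (fact (2 * k) / (2^k * fact k) * (\<Sum>i\<in>I. (c i)\<^sup>2) ^ k)"
    by (simp add: ennreal_mult'[symmetric] mult.commute sum_nonneg)
  finally show ?thesis .
qed

lemma integral_gauss_rotation:
  fixes f :: "_ \<Rightarrow> 'b::{banach, second_countable_topology}"
  assumes I: "finite I" and cs: "c\<^sup>2 + s\<^sup>2 = 1" and c: "c \<noteq> 0"
    and f: "f \<in> borel_measurable (gauss I \<Otimes>\<^sub>M gauss I)"
  shows "(\<integral>z. f z \<partial>(gauss I \<Otimes>\<^sub>M gauss I)) =
    (\<integral>z. f (\<lambda>i\<in>I. c * fst z i + s * snd z i, \<lambda>i\<in>I. c * snd z i - s * fst z i) \<partial>(gauss I \<Otimes>\<^sub>M gauss I))"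
proof -
  have "(\<lambda>z. (\<lambda>i\<in>I. c * fst z i + s * snd z i, \<lambda>i\<in>I. c * snd z i - s * fst z i))
      \<in> gauss I \<Otimes>\<^sub>M gauss I \<rightarrow>\<^sub>M gauss I \<Otimes>\<^sub>M gauss I" by measurable
  from integral_distr[OF this f] show ?thesis by (simp add: distr_gauss_rotation[OF I cs c])
qed

section \<open>Oscillating Gaussian integrals and rotation\<close>

text \<open>The squared norm of \<open>s w + B a\<close>. It is the variance that appears when the row \<open>b\<close> is
  integrated out of the phase \<open>s \<langle>b, w\<rangle> + \<langle>a, B b\<rangle>\<close>.\<close>

definition quad_form :: "'i set \<Rightarrow> ('i \<Rightarrow> real) \<Rightarrow> ('i \<Rightarrow> 'i \<Rightarrow> real) \<Rightarrow> real \<Rightarrow> ('i \<Rightarrow> real) \<Rightarrow> real" where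
  "quad_form R w B s a = (\<Sum>l\<in>R. (s * w l + (\<Sum>m\<in>R. B l m * a m))\<^sup>2)"

text \<open>The average of \<open>exp (i (s \<langle>b, w\<rangle> + t \<langle>a, w\<rangle> + \<langle>a, B b\<rangle>))\<close> over independent Gaussian
  families \<open>a\<close> and \<open>b\<close>, with \<open>b\<close> already integrated out.\<close>

definition oscillating :: "'i set \<Rightarrow> ('i \<Rightarrow> real) \<Rightarrow> ('i \<Rightarrow> 'i \<Rightarrow> real) \<Rightarrow> real \<Rightarrow> real \<Rightarrow> complex" where
  "oscillating R w B s t =
     (\<integral>a. iexp (t * (\<Sum>l\<in>R. w l * a l)) * exp (- quad_form R w B s a / 2) \<partial>gauss R)"

lemma measurable_quad_form [measurable]: "quad_form R w B s \<in> borel_measurable (gauss R)"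
  unfolding quad_form_def by measurable

lemma quad_form_nonneg: "quad_form R w B s a \<ge> 0"
  unfolding quad_form_def by (intro sum_nonneg) auto

lemma integrable_gauss_bounded:
  fixes f :: "_ \<Rightarrow> 'b::{banach, second_countable_topology}"
  assumes "f \<in> borel_measurable (gauss R)" "\<And>x. norm (f x) \<le> K"
  shows "integrable (gauss R) f"
proof -
  interpret prob_space "gauss R" by (rule prob_space_gauss)
  show ?thesis by (rule integrable_const_bound[where B = K]) (use assms in auto)
qed

lemma integrable_gauss_pair_bounded:
  fixes f :: "_ \<Rightarrow> 'b::{banach, second_countable_topology}"
  assumes "f \<in> borel_measurable (gauss R \<Otimes>\<^sub>M gauss S)" "\<And>x. norm (f x) \<le> K"
  shows "integrable (gauss R \<Otimes>\<^sub>M gauss S) f"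
proof -
  interpret prob_space "gauss R \<Otimes>\<^sub>M gauss S" by (rule prob_space_gauss_pair)
  show ?thesis by (rule integrable_const_bound[where B = K]) (use assms in auto)
qed

lemma integral_gauss_pair_mult:
  fixes f g :: "_ \<Rightarrow> complex"
  assumes [measurable]: "f \<in> borel_measurable (gauss R)" "g \<in> borel_measurable (gauss S)"
    and b: "\<And>x. norm (f x) \<le> 1" "\<And>x. norm (g x) \<le> 1"
  shows "(\<integral>z. f (fst z) * g (snd z) \<partial>(gauss R \<Otimes>\<^sub>M gauss S)) =
    (\<integral>x. f x \<partial>gauss R) * (\<integral>x. g x \<partial>gauss S)"
proof -
  interpret pair_sigma_finite "gauss R" "gauss S" by (rule pair_sigma_finite_gauss)
  have "integrable (gauss R \<Otimes>\<^sub>M gauss S) (\<lambda>z. f (fst z) * g (snd z))"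
    using b by (intro integrable_gauss_pair_bounded[where K = 1]) (auto simp: norm_mult intro!: mult_le_one)
  from integral_fst'[OF this] show ?thesis by simp
qed

lemma iexp_exp_mult:
  "iexp x * complex_of_real (exp (- p / 2)) * (iexp y * complex_of_real (exp (- q / 2))) =
    iexp (x + y) * complex_of_real (exp (- (p + q) / 2))"
proof -
  have "exp (- p / 2) * exp (- q / 2) = exp (- (p + q) / 2)"
    by (simp add: exp_add[symmetric] add_divide_distrib)
  then show ?thesis by (simp add: ring_distribs exp_add flip: of_real_mult)
qed

text \<open>The phase \<open>s \<langle>b, w\<rangle> + \<langle>a, B b\<rangle>\<close> with \<open>B\<close> symmetric may be integrated over \<open>a\<close> or over
  \<open>b\<close> first. The first order leads to the right-hand side and the second one to the left-hand side,
  which is visibly positive.\<close>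

lemma oscillating_exchange:
  assumes R: "finite R" and sym: "\<And>l m. l \<in> R \<Longrightarrow> m \<in> R \<Longrightarrow> B l m = B m l"
  shows "oscillating R w B s 0 = oscillating R w B 0 s"
proof -
  define f where "f a b = iexp (\<Sum>l\<in>R. (s * w l + (\<Sum>m\<in>R. B l m * a m)) * b l)" for a b
  interpret pair_sigma_finite "gauss R" "gauss R" by (rule pair_sigma_finite_gauss)
  have fm [measurable]: "(\<lambda>(a, b). f a b) \<in> borel_measurable (gauss R \<Otimes>\<^sub>M gauss R)"
    unfolding f_def by measurable
  have int: "integrable (gauss R \<Otimes>\<^sub>M gauss R) (\<lambda>(a, b). f a b)"
    by (rule integrable_gauss_pair_bounded[where K = 1]) (auto simp: f_def)
  have "oscillating R w B s 0 = (\<integral>a. \<integral>b. f a b \<partial>gauss R \<partial>gauss R)"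
    unfolding f_def gauss_iexp_linear[OF R] by (simp add: oscillating_def quad_form_def exp_of_real)
  also have "\<dots> = (\<integral>b. \<integral>a. f a b \<partial>gauss R \<partial>gauss R)"
    using Fubini_integral[OF int] by simp
  also have "(\<lambda>b. \<integral>a. f a b \<partial>gauss R) =
      (\<lambda>b. iexp (s * (\<Sum>l\<in>R. w l * b l)) * exp (- quad_form R w B 0 b / 2))"
  proof
    fix b
    have "f a b = iexp (s * (\<Sum>l\<in>R. w l * b l)) * iexp (\<Sum>m\<in>R. (\<Sum>l\<in>R. B m l * b l) * a m)" for a
    proof -
      have "(\<Sum>l\<in>R. \<Sum>m\<in>R. B l m * a m * b l) = (\<Sum>m\<in>R. \<Sum>l\<in>R. B m l * b l * a m)"
        by (subst sum.swap) (auto intro!: sum.cong simp: sym mult_ac)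
      then have "(\<Sum>l\<in>R. (s * w l + (\<Sum>m\<in>R. B l m * a m)) * b l) =
          s * (\<Sum>l\<in>R. w l * b l) + (\<Sum>m\<in>R. (\<Sum>l\<in>R. B m l * b l) * a m)"
        by (simp add: sum.distrib algebra_simps sum_distrib_left sum_distrib_right)
      then show ?thesis by (simp add: f_def exp_add[symmetric] algebra_simps)
    qed
    then show "(\<integral>a. f a b \<partial>gauss R) = iexp (s * (\<Sum>l\<in>R. w l * b l)) * exp (- quad_form R w B 0 b / 2)"
      by (simp only: integral_mult_right_zero gauss_iexp_linear[OF R]) (simp add: quad_form_def exp_of_real)
  qed
  also have "(\<integral>b. iexp (s * (\<Sum>l\<in>R. w l * b l)) * exp (- quad_form R w B 0 b / 2) \<partial>gauss R) = oscillating R w B 0 s"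
    by (simp add: oscillating_def)
  finally show ?thesis .
qed

lemma oscillating_real:
  "oscillating R w B s 0 = complex_of_real (\<integral>a. exp (- quad_form R w B s a / 2) \<partial>gauss R)"
  unfolding oscillating_def integral_complex_of_real[symmetric] by (simp add: exp_of_real)

text \<open>Rotating two independent copies carries the coefficients \<open>(s, t)\<close> of the
  two linear terms to \<open>(sqrt (s\<^sup>2 + t\<^sup>2), 0)\<close> and leaves \<open>\<bar>B a\<bar>\<^sup>2 + \<bar>B b\<bar>\<^sup>2\<close> unchanged. Hence
  \<open>s \<mapsto> oscillating R w B s 0\<close> behaves like a Gaussian function of \<open>s\<close>.\<close>

lemma oscillating_mult:
  assumes R: "finite R" and sym: "\<And>l m. l \<in> R \<Longrightarrow> m \<in> R \<Longrightarrow> B l m = B m l"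
  shows "oscillating R w B s 0 * oscillating R w B t 0 =
    oscillating R w B (sqrt (s\<^sup>2 + t\<^sup>2)) 0 * oscillating R w B 0 0"
proof -
  have main: "oscillating R w B 0 s * oscillating R w B 0 t =
      oscillating R w B 0 (sqrt (s\<^sup>2 + t\<^sup>2)) * oscillating R w B 0 0" if s: "s \<noteq> 0" for s t
  proof -
    define r where "r = sqrt (s\<^sup>2 + t\<^sup>2)"
    define c d where "c = s / r" and "d = - t / r"
    have r: "r > 0" "r\<^sup>2 = s\<^sup>2 + t\<^sup>2" using s by (auto simp: r_def sum_power2_gt_zero_iff)
    have cd: "c\<^sup>2 + d\<^sup>2 = 1" "c \<noteq> 0" using r s by (auto simp: c_def d_def power_divide add_divide_distrib[symmetric])
    have cd': "s * c - t * d = r" "s * d + t * c = 0"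
      using r by (auto simp: c_def d_def power2_eq_square field_simps)
    define g where "g t a = iexp (t * (\<Sum>l\<in>R. w l * a l)) * exp (- quad_form R w B 0 a / 2)" for t a
    have gm [measurable]: "g t \<in> borel_measurable (gauss R)" for t unfolding g_def by measurable
    have gb: "norm (g t x) \<le> 1" for t x
      unfolding g_def using quad_form_nonneg[of R w B 0 x] by (simp add: norm_mult)
    have gO: "oscillating R w B 0 t = (\<integral>x. g t x \<partial>gauss R)" for t by (simp add: oscillating_def g_def)
    have rot: "g s (\<lambda>i\<in>R. c * a i + d * b i) * g t (\<lambda>i\<in>R. c * b i - d * a i) = g r a * g 0 b" for a b
    proof -
      have 1: "(\<Sum>l\<in>R. w l * (c * a l + d * b l)) = c * (\<Sum>l\<in>R. w l * a l) + d * (\<Sum>l\<in>R. w l * b l)"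
        "(\<Sum>l\<in>R. w l * (c * b l - d * a l)) = c * (\<Sum>l\<in>R. w l * b l) - d * (\<Sum>l\<in>R. w l * a l)"
        by (simp_all add: algebra_simps sum.distrib sum_subtractf sum_distrib_left)
      have 2: "(\<Sum>m\<in>R. B l m * (c * a m + d * b m)) = c * (\<Sum>m\<in>R. B l m * a m) + d * (\<Sum>m\<in>R. B l m * b m)"
        "(\<Sum>m\<in>R. B l m * (c * b m - d * a m)) = c * (\<Sum>m\<in>R. B l m * b m) - d * (\<Sum>m\<in>R. B l m * a m)" for l
        by (simp_all add: algebra_simps sum.distrib sum_subtractf sum_distrib_left)
      have 3: "(c * x + d * y)\<^sup>2 + (c * y - d * x)\<^sup>2 = x\<^sup>2 + y\<^sup>2" for x y :: real
      proof -
        have "(c * x + d * y)\<^sup>2 + (c * y - d * x)\<^sup>2 = (c\<^sup>2 + d\<^sup>2) * (x\<^sup>2 + y\<^sup>2)"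
          by (simp add: power2_eq_square algebra_simps)
        then show ?thesis by (simp add: cd)
      qed
      have Q: "quad_form R w B 0 (\<lambda>i\<in>R. c * a i + d * b i) + quad_form R w B 0 (\<lambda>i\<in>R. c * b i - d * a i) =
          quad_form R w B 0 a + quad_form R w B 0 b"
        by (simp add: quad_form_def sum.distrib[symmetric] 2 3 cong: sum.cong)
      have L: "s * (\<Sum>l\<in>R. w l * (\<lambda>i\<in>R. c * a i + d * b i) l) + t * (\<Sum>l\<in>R. w l * (\<lambda>i\<in>R. c * b i - d * a i) l) =
          r * (\<Sum>l\<in>R. w l * a l) + 0 * (\<Sum>l\<in>R. w l * b l)"
      proof -
        have "s * (\<Sum>l\<in>R. w l * (c * a l + d * b l)) + t * (\<Sum>l\<in>R. w l * (c * b l - d * a l)) =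
            (s * c - t * d) * (\<Sum>l\<in>R. w l * a l) + (s * d + t * c) * (\<Sum>l\<in>R. w l * b l)"
          unfolding 1 by (simp add: algebra_simps)
        then show ?thesis by (simp add: cd' cong: sum.cong)
      qed
      show ?thesis
        unfolding g_def iexp_exp_mult by (simp only: Q L)
    qed
    have "oscillating R w B 0 s * oscillating R w B 0 t =
        (\<integral>z. g s (fst z) * g t (snd z) \<partial>(gauss R \<Otimes>\<^sub>M gauss R))"
      unfolding gO by (rule integral_gauss_pair_mult[symmetric]) (auto simp: gb)
    also have "\<dots> = (\<integral>z. g r (fst z) * g 0 (snd z) \<partial>(gauss R \<Otimes>\<^sub>M gauss R))"
      by (subst integral_gauss_rotation[OF R cd]) (auto simp: rot)
    also have "\<dots> = oscillating R w B 0 r * oscillating R w B 0 0"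
      unfolding gO by (rule integral_gauss_pair_mult) (auto simp: gb)
    finally show ?thesis by (simp add: r_def)
  qed
  have ex: "oscillating R w B u 0 = oscillating R w B 0 u" for u
    by (rule oscillating_exchange[OF R sym])
  \<comment> \<open>The rotation has cosine \<open>s / r\<close>, which must not vanish; for \<open>s = 0\<close> the roles are exchanged.\<close>
  consider "s \<noteq> 0" | "t \<noteq> 0" | "s = 0" "t = 0" by blast
  then show ?thesis
  proof cases
    case 1
    then show ?thesis using main[OF 1, of t] by (simp only: ex[of s] ex[of t] ex[of "sqrt (s\<^sup>2 + t\<^sup>2)"])
  next
    case 2
    then show ?thesis using main[OF 2, of s]
      by (simp only: ex[of s] ex[of t] ex[of "sqrt (s\<^sup>2 + t\<^sup>2)"] add.commute[of "t\<^sup>2"] mult.commute[of "oscillating R w B 0 t"])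
  next
    case 3
    then show ?thesis by simp
  qed
qed

text \<open>The squared modulus is an integral over two independent copies. After a rotation by 45 degrees
  it splits into one factor depending on \<open>s\<close> and one depending on \<open>t\<close>, namely the values of
  \<open>oscillating R w B\<close> at \<open>(sqrt 2 s, 0)\<close> and \<open>(0, sqrt 2 t)\<close>. By the exchange and multiplication
  rules above, their product is the square of the value at \<open>(sqrt (s\<^sup>2 + t\<^sup>2), 0)\<close>.\<close>

lemma norm_oscillating:
  assumes R: "finite R" and sym: "\<And>l m. l \<in> R \<Longrightarrow> m \<in> R \<Longrightarrow> B l m = B m l"
  shows "norm (oscillating R w B s t) =
    (\<integral>a. exp (- quad_form R w B (sqrt (s\<^sup>2 + t\<^sup>2)) a / 2) \<partial>gauss R)"
proof -
  define k where "k s = (\<integral>a. exp (- quad_form R w B s a / 2) \<partial>gauss R)" for s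
  have k: "oscillating R w B s 0 = complex_of_real (k s)" for s by (simp add: k_def oscillating_real)
  have ex: "oscillating R w B u 0 = oscillating R w B 0 u" for u
    by (rule oscillating_exchange[OF R sym])
  note mult = oscillating_mult[where B = B, OF R sym]
  define c :: real where "c = 1 / sqrt 2"
  have c: "c\<^sup>2 + c\<^sup>2 = 1" "c \<noteq> 0" "c * c = 1/2" "c + c = sqrt 2"
    by (auto simp: c_def power_divide real_divide_square_eq field_simps)
  define g where "g s t a = iexp (t * (\<Sum>l\<in>R. w l * a l)) * exp (- quad_form R w B s a / 2)" for s t a
  have gm [measurable]: "g s t \<in> borel_measurable (gauss R)" for s t unfolding g_def by measurable
  have gb: "norm (g s t x) \<le> 1" for s t x
    unfolding g_def using quad_form_nonneg[of R w B s x] by (simp add: norm_mult)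
  have gO: "oscillating R w B s t = (\<integral>x. g s t x \<partial>gauss R)" for s t by (simp add: oscillating_def g_def)
  have cg: "cnj (g s t a) = g s (- t) a" for s t a
    by (simp add: g_def exp_cnj)
  have cO: "cnj (oscillating R w B s t) = oscillating R w B s (- t)"
    unfolding gO cg[symmetric] by (rule Bochner_Integration.integral_cnj[symmetric])
  have rot: "g s t (\<lambda>i\<in>R. c * a i + c * b i) * g s (-t) (\<lambda>i\<in>R. c * b i - c * a i) =
      g 0 (sqrt 2 * t) a * g (sqrt 2 * s) 0 b" for a b
  proof -
    have 1: "(\<Sum>l\<in>R. w l * (c * a l + c * b l)) = c * (\<Sum>l\<in>R. w l * a l) + c * (\<Sum>l\<in>R. w l * b l)"
      "(\<Sum>l\<in>R. w l * (c * b l - c * a l)) = c * (\<Sum>l\<in>R. w l * b l) - c * (\<Sum>l\<in>R. w l * a l)"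
      by (simp_all add: algebra_simps sum.distrib sum_subtractf sum_distrib_left)
    have 2: "(\<Sum>m\<in>R. B l m * (c * a m + c * b m)) = c * (\<Sum>m\<in>R. B l m * a m) + c * (\<Sum>m\<in>R. B l m * b m)"
      "(\<Sum>m\<in>R. B l m * (c * b m - c * a m)) = c * (\<Sum>m\<in>R. B l m * b m) - c * (\<Sum>m\<in>R. B l m * a m)" for l
      by (simp_all add: algebra_simps sum.distrib sum_subtractf sum_distrib_left)
    have 3: "(v + (c * x + c * y))\<^sup>2 + (v + (c * y - c * x))\<^sup>2 = (0 * v' + x)\<^sup>2 + (sqrt 2 * v + y)\<^sup>2" for x y v v' :: real
    proof -
      have "(v + (c * x + c * y))\<^sup>2 + (v + (c * y - c * x))\<^sup>2 = 2 * v\<^sup>2 + 2 * (c + c) * v * y + 2 * (c * c) * (x\<^sup>2 + y\<^sup>2)"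
        by (simp add: power2_eq_square algebra_simps)
      also have "\<dots> = (0 * v' + x)\<^sup>2 + (sqrt 2 * v + y)\<^sup>2"
        unfolding c by (simp add: power2_sum power_mult_distrib algebra_simps)
      finally show ?thesis .
    qed
    have Q: "quad_form R w B s (\<lambda>i\<in>R. c * a i + c * b i) + quad_form R w B s (\<lambda>i\<in>R. c * b i - c * a i) =
        quad_form R w B 0 a + quad_form R w B (sqrt 2 * s) b"
      unfolding quad_form_def sum.distrib[symmetric]
      by (intro sum.cong refl) (simp add: 2 3[where v'=0, simplified] cong: sum.cong, simp add: mult.assoc)
    have "t * (\<Sum>l\<in>R. w l * (c * a l + c * b l)) + - t * (\<Sum>l\<in>R. w l * (c * b l - c * a l)) =
        sqrt 2 * t * (\<Sum>l\<in>R. w l * a l)"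
      unfolding 1 c(4)[symmetric] by (simp add: algebra_simps)
    then have L: "t * (\<Sum>l\<in>R. w l * (\<lambda>i\<in>R. c * a i + c * b i) l) + - t * (\<Sum>l\<in>R. w l * (\<lambda>i\<in>R. c * b i - c * a i) l) =
        sqrt 2 * t * (\<Sum>l\<in>R. w l * a l) + 0 * (\<Sum>l\<in>R. w l * b l)"
      by (simp cong: sum.cong)
    show ?thesis
      unfolding g_def iexp_exp_mult by (simp only: Q L)
  qed
  have "oscillating R w B s t * cnj (oscillating R w B s t) =
      (\<integral>z. g s t (fst z) * g s (-t) (snd z) \<partial>(gauss R \<Otimes>\<^sub>M gauss R))"
    unfolding cO unfolding gO by (rule integral_gauss_pair_mult[symmetric]) (auto simp: gb)
  also have "\<dots> = (\<integral>z. g 0 (sqrt 2 * t) (fst z) * g (sqrt 2 * s) 0 (snd z) \<partial>(gauss R \<Otimes>\<^sub>M gauss R))"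
    by (subst integral_gauss_rotation[OF R c(1,2)]) (auto simp: rot)
  also have "\<dots> = oscillating R w B 0 (sqrt 2 * t) * oscillating R w B (sqrt 2 * s) 0"
    unfolding gO by (rule integral_gauss_pair_mult) (auto simp: gb)
  also have "\<dots> = oscillating R w B (sqrt 2 * s) 0 * oscillating R w B (sqrt 2 * t) 0"
    by (subst ex[of "sqrt 2 * t"], rule mult.commute)
  also have "\<dots> = oscillating R w B (sqrt ((sqrt 2 * s)\<^sup>2 + (sqrt 2 * t)\<^sup>2)) 0 * oscillating R w B 0 0"
    by (rule mult)
  also have "sqrt ((sqrt 2 * s)\<^sup>2 + (sqrt 2 * t)\<^sup>2) = sqrt ((sqrt (s\<^sup>2 + t\<^sup>2))\<^sup>2 + (sqrt (s\<^sup>2 + t\<^sup>2))\<^sup>2)"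
    by (simp add: power_mult_distrib)
  also have "oscillating R w B \<dots> 0 * oscillating R w B 0 0 =
      oscillating R w B (sqrt (s\<^sup>2 + t\<^sup>2)) 0 * oscillating R w B (sqrt (s\<^sup>2 + t\<^sup>2)) 0"
    by (rule mult[symmetric])
  finally have "complex_of_real ((norm (oscillating R w B s t))\<^sup>2) = complex_of_real ((k (sqrt (s\<^sup>2 + t\<^sup>2)))\<^sup>2)"
    by (simp only: complex_norm_square k) (simp only: of_real_mult power2_eq_square)
  then have "(norm (oscillating R w B s t))\<^sup>2 = (k (sqrt (s\<^sup>2 + t\<^sup>2)))\<^sup>2" by (simp only: of_real_eq_iff)
  moreover have "k (sqrt (s\<^sup>2 + t\<^sup>2)) \<ge> 0" unfolding k_def by (intro Bochner_Integration.integral_nonneg) auto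
  ultimately show ?thesis by (simp add: k_def power2_eq_iff_nonneg)
qed

section \<open>Expanding a hafnian along a vertex\<close>

text \<open>Here the matrix is a weight function on the edges, so that symmetry is built in and any finite
  set may serve as the vertex set.\<close>

definition haf :: "'v set \<Rightarrow> ('v set \<Rightarrow> real) \<Rightarrow> real" where
  "haf U w = (\<Sum>m\<in>perfect_matchings U. \<Prod>e\<in>m. w e)"

definition edges :: "'v set \<Rightarrow> 'v set set" where
  "edges U = {e. e \<subseteq> U \<and> card e = 2}"

lemma finite_edges: "finite U \<Longrightarrow> finite (edges U)"
  unfolding edges_def by (rule finite_subset[of _ "Pow U"]) blast+

lemma edges_mono: "U \<subseteq> V \<Longrightarrow> edges U \<subseteq> edges V"
  unfolding edges_def by blast

lemma doubleton_in_edges [simp]: "{a, b} \<in> edges U \<longleftrightarrow> a \<in> U \<and> b \<in> U \<and> a \<noteq> b"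
  by (auto simp: edges_def card_insert_if)

lemma perfect_matching_subset:
  assumes "m \<in> perfect_matchings U" shows "m \<subseteq> edges U"
proof
  fix e assume "e \<in> m"
  moreover have "\<Union>m = U" "\<forall>e\<in>m. card e = 2"
    using assms by (simp_all add: perfect_matchings_def partition_on_def)
  ultimately show "e \<in> edges U" by (auto simp: edges_def)
qed

lemma finite_perfect_matchings: "finite U \<Longrightarrow> finite (perfect_matchings U)"
  by (rule finite_subset[of _ "Pow (edges U)"]) (use perfect_matching_subset in \<open>auto simp: finite_edges\<close>)

lemma finite_perfect_matching: "finite U \<Longrightarrow> m \<in> perfect_matchings U \<Longrightarrow> finite m"
  by (rule finite_subset[OF perfect_matching_subset finite_edges])

lemma perfect_matchings_empty: "perfect_matchings {} = {{}}"
  by (auto simp: perfect_matchings_def partition_on_empty)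

lemma haf_empty [simp]: "haf {} w = 1"
  by (simp add: haf_def perfect_matchings_empty)

lemma haf_cong: "(\<And>e. e \<in> edges U \<Longrightarrow> w e = w' e) \<Longrightarrow> haf U w = haf U w'"
  unfolding haf_def by (intro sum.cong prod.cong refl) (use perfect_matching_subset in blast)

lemma insert_perfect_matching:
  assumes "i \<in> U" "l \<in> U" "i \<noteq> l" and m: "m \<in> perfect_matchings (U - {i, l})"
  shows "insert {i, l} m \<in> perfect_matchings U"
proof -
  have "\<Union>m = U - {i, l}" using m by (simp add: perfect_matchings_def partition_on_def)
  then have "disjnt {i, l} (\<Union>m)" by (auto simp: disjnt_def)
  from partition_on_insert[OF this, of U] show ?thesis
    using assms by (simp add: perfect_matchings_def)
qed

lemma remove_perfect_matching:
  assumes m: "m \<in> perfect_matchings U" and e: "{i, l} \<in> m"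
  shows "m - {{i, l}} \<in> perfect_matchings (U - {i, l})"
proof -
  have p: "partition_on U m" using m by (simp add: perfect_matchings_def)
  have "disjnt {i, l} f" if "f \<in> m - {{i, l}}" for f
    using that e partition_onD2[OF p] by (metis DiffE pairwiseD singletonI)
  then have "disjnt {i, l} (\<Union>(m - {{i, l}}))" by (simp add: disjnt_Union2)
  from partition_on_insert[OF this, of U] have "partition_on (U - {i, l}) (m - {{i, l}})"
    using p e by (simp only: insert_Diff) blast
  then show ?thesis using m by (simp add: perfect_matchings_def)
qed

text \<open>Every perfect matching contains exactly one edge at \<open>i\<close>; removing this edge leaves a perfect
  matching of the other vertices.\<close>

lemma haf_expand:
  assumes U: "finite U" and i: "i \<in> U"
  shows "haf U w = (\<Sum>l\<in>U - {i}. w {i, l} * haf (U - {i, l}) w)"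
proof -
  let ?S = "SIGMA l:U - {i}. perfect_matchings (U - {i, l})"
  have notin: "i \<notin> e" if "m \<in> perfect_matchings (U - {i, l})" "e \<in> m" for l m e
    using that perfect_matching_subset[OF that(1)] by (auto simp: edges_def)
  have "bij_betw (\<lambda>(l, m). insert {i, l} m) ?S (perfect_matchings U)"
    unfolding bij_betw_def
  proof
    show "inj_on (\<lambda>(l, m). insert {i, l} m) ?S"
    proof (rule inj_onI)
      fix p p' assume p: "p \<in> ?S" "p' \<in> ?S" and pp: "(\<lambda>(l, m). insert {i, l} m) p = (\<lambda>(l, m). insert {i, l} m) p'"
      obtain l m l' m' where pl: "p = (l, m)" "p' = (l', m')" by (cases p, cases p') auto
      have l: "l \<in> U" "l \<noteq> i" and m: "m \<in> perfect_matchings (U - {i, l})"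
        and l': "l' \<in> U" "l' \<noteq> i" and m': "m' \<in> perfect_matchings (U - {i, l'})"
        and eq: "insert {i, l} m = insert {i, l'} m'"
        using p pp pl by auto
      have "{i, l} \<notin> m'" using notin[OF m'] by blast
      then have "{i, l} = {i, l'}" using eq by blast
      then have ll: "l = l'" using l by (auto simp: doubleton_eq_iff)
      have "{i, l} \<notin> m" using notin[OF m] by blast
      then show "p = p'" using eq ll pl \<open>{i, l} \<notin> m'\<close> by (auto simp: insert_ident)
    qed
    show "(\<lambda>(l, m). insert {i, l} m) ` ?S = perfect_matchings U"
    proof (intro equalityI subsetI)
      fix M assume "M \<in> (\<lambda>(l, m). insert {i, l} m) ` ?S"
      then show "M \<in> perfect_matchings U" using i by clarsimp (metis insert_perfect_matching)
    next
      fix M assume M: "M \<in> perfect_matchings U"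
      then have "\<Union>M = U" by (simp add: perfect_matchings_def partition_on_def)
      then obtain e where e: "e \<in> M" "i \<in> e" using i by blast
      then have "card e = 2" using M by (auto simp: perfect_matchings_def)
      then obtain l where l: "e = {i, l}" "l \<noteq> i"
        using e(2) by (auto simp: card_2_iff doubleton_eq_iff)
      have "l \<in> U" using e l \<open>\<Union>M = U\<close> by auto
      moreover have "M - {{i, l}} \<in> perfect_matchings (U - {i, l})"
        using remove_perfect_matching[OF M] e l by simp
      moreover have "M = insert {i, l} (M - {{i, l}})" using e l by auto
      ultimately show "M \<in> (\<lambda>(l, m). insert {i, l} m) ` ?S"
        using l by (intro image_eqI[where x = "(l, M - {{i, l}})"]) auto
    qed
  qed
  note bij = this
  have "haf U w = (\<Sum>p\<in>?S. \<Prod>e\<in>(\<lambda>(l, m). insert {i, l} m) p. w e)"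
    unfolding haf_def by (rule sum.reindex_bij_betw[OF bij, symmetric])
  also have "\<dots> = (\<Sum>p\<in>?S. w {i, fst p} * (\<Prod>e\<in>snd p. w e))"
  proof (intro sum.cong refl)
    fix p assume p: "p \<in> ?S"
    obtain l m where lm: "p = (l, m)" by (cases p) auto
    then have l: "l \<in> U" "l \<noteq> i" "m \<in> perfect_matchings (U - {i, l})" using p by auto
    have "finite m" using U l by (intro finite_perfect_matching[of "U - {i, l}" m]) auto
    moreover have "{i, l} \<notin> m" using notin[OF l(3)] by blast
    ultimately show "(\<Prod>e\<in>(\<lambda>(l, m). insert {i, l} m) p. w e) = w {i, fst p} * (\<Prod>e\<in>snd p. w e)"
      by (simp add: lm)
  qed
  also have "\<dots> = (\<Sum>l\<in>U - {i}. \<Sum>m\<in>perfect_matchings (U - {i, l}). w {i, l} * (\<Prod>e\<in>m. w e))"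
    using sum.Sigma[of "U - {i}" "\<lambda>l. perfect_matchings (U - {i, l})" "\<lambda>l m. w {i, l} * (\<Prod>e\<in>m. w e)"]
      U finite_perfect_matchings[of "U - {i, _}"] by (simp add: split_def)
  also have "\<dots> = (\<Sum>l\<in>U - {i}. w {i, l} * haf (U - {i, l}) w)"
    by (simp only: haf_def sum_distrib_left)
  finally show ?thesis .
qed

lemma haf_expand_insert:
  assumes "finite U" "v \<notin> U"
  shows "haf (insert v U) w = (\<Sum>l\<in>U. w {v, l} * haf (U - {l}) w)"
proof -
  have d: "insert v U - {v} = U" "insert v U - {v, l} = U - {l}" for l using assms by auto
  show ?thesis using haf_expand[of "insert v U" v w] assms(1) unfolding d by simp
qed

lemma measurable_haf [measurable (raw)]:
  assumes "U \<subseteq> V"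
  shows "haf U \<in> borel_measurable (gauss (edges V))"
  unfolding haf_def
proof (intro borel_measurable_sum borel_measurable_prod)
  fix m e assume "m \<in> perfect_matchings U" "e \<in> m"
  then have "e \<in> edges V" using perfect_matching_subset edges_mono[OF assms] by blast
  then show "(\<lambda>w. w e) \<in> borel_measurable (gauss (edges V))" by measurable
qed

text \<open>An edge of \<open>insert v U\<close> is either an edge of \<open>U\<close> or is given by its end different from \<open>v\<close>.\<close>

definition star_code :: "'v \<Rightarrow> 'v set \<Rightarrow> 'v set + 'v" where
  "star_code v e = (if v \<in> e then Inr (the_elem (e - {v})) else Inl e)"

text \<open>Edge weights on \<open>insert v U\<close> from weights \<open>x\<close> on \<open>U\<close> and a row \<open>a\<close> for the new vertex \<open>v\<close>.\<close>

definition add_star :: "'v \<Rightarrow> 'v set \<Rightarrow> ('v set \<Rightarrow> real) \<Rightarrow> ('v \<Rightarrow> real) \<Rightarrow> 'v set \<Rightarrow> real" where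
  "add_star v U = assemble (star_code v) (edges (insert v U))"

lemma star_code_pair: "l \<noteq> v \<Longrightarrow> star_code v {v, l} = Inr l"
  by (simp add: star_code_def)

lemma bij_star_code:
  assumes "v \<notin> U"
  shows "bij_betw (star_code v) (edges (insert v U)) (edges U <+> U)"
proof (rule bij_betwI[where g = "case_sum id (\<lambda>l. {v, l})"])
  have e: "\<exists>l\<in>U. e = {v, l}" if "e \<in> edges (insert v U)" "v \<in> e" for e
    using that by (auto simp: edges_def card_2_iff doubleton_eq_iff)
  have e': "e \<in> edges U" if "e \<in> edges (insert v U)" "v \<notin> e" for e
    using that by (auto simp: edges_def)
  show "star_code v \<in> edges (insert v U) \<rightarrow> edges U <+> U"
  proof
    fix e assume "e \<in> edges (insert v U)"
    then show "star_code v e \<in> edges U <+> U" using e[of e] e'[of e] assms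
      by (cases "v \<in> e") (auto simp: star_code_def)
  qed
  show "case_sum id (\<lambda>l. {v, l}) \<in> edges U <+> U \<rightarrow> edges (insert v U)"
    using assms subsetD[OF edges_mono[OF subset_insertI]] by (auto simp: Plus_def)
  show "case_sum id (\<lambda>l. {v, l}) (star_code v x) = x" if x: "x \<in> edges (insert v U)" for x
  proof (cases "v \<in> x")
    case True
    then obtain l where l: "l \<in> U" "x = {v, l}" using e[OF x True] by auto
    then have "l \<noteq> v" using assms by auto
    then show ?thesis using l by (simp add: star_code_pair)
  qed (simp add: star_code_def)
  show "star_code v (case_sum id (\<lambda>l. {v, l}) y) = y" if y: "y \<in> edges U <+> U" for y
  proof (cases y)
    case (Inl e)
    then have "v \<notin> e" using y assms by (auto simp: edges_def)
    then show ?thesis using Inl by (simp add: star_code_def)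
  next
    case (Inr l)
    then have "l \<noteq> v" using y assms by auto
    then show ?thesis using Inr by (simp add: star_code_pair)
  qed
qed

lemma add_star_edge: "l \<in> U \<Longrightarrow> v \<notin> U \<Longrightarrow> add_star v U x a {v, l} = a l"
  unfolding add_star_def assemble_def using star_code_pair[of l v] by auto

lemma add_star_old: "e \<in> edges U \<Longrightarrow> v \<notin> U \<Longrightarrow> add_star v U x a e = x e"
proof -
  assume e: "e \<in> edges U" and v: "v \<notin> U"
  then have "v \<notin> e" "e \<in> edges (insert v U)" by (auto simp: edges_def)
  then show ?thesis by (simp add: add_star_def assemble_def star_code_def)
qed

lemma haf_add_star_old:
  assumes "U' \<subseteq> U" "v \<notin> U"
  shows "haf U' (add_star v U x a) = haf U' x"
  using assms edges_mono[OF assms(1)] by (intro haf_cong add_star_old) auto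

lemma haf_add_star:
  assumes "finite U" "U' \<subseteq> U" "v \<notin> U"
  shows "haf (insert v U') (add_star v U x a) = (\<Sum>l\<in>U'. a l * haf (U' - {l}) x)"
proof -
  have "finite U'" "v \<notin> U'" using assms finite_subset by auto
  then have "haf (insert v U') (add_star v U x a) =
      (\<Sum>l\<in>U'. add_star v U x a {v, l} * haf (U' - {l}) (add_star v U x a))"
    by (rule haf_expand_insert)
  also have "\<dots> = (\<Sum>l\<in>U'. a l * haf (U' - {l}) x)"
  proof (intro sum.cong refl arg_cong2[where f = "(*)"])
    fix l assume "l \<in> U'"
    then show "add_star v U x a {v, l} = a l" using assms by (intro add_star_edge) auto
    show "haf (U' - {l}) (add_star v U x a) = haf (U' - {l}) x" using assms by (intro haf_add_star_old) auto
  qed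
  finally show ?thesis .
qed

lemma integral_add_star:
  fixes f :: "_ \<Rightarrow> 'c::{banach, second_countable_topology}"
  assumes U: "finite U" "v \<notin> U" and f: "integrable (gauss (edges (insert v U))) f"
  shows "(\<integral>z. f z \<partial>gauss (edges (insert v U))) =
    (\<integral>x. \<integral>a. f (add_star v U x a) \<partial>gauss U \<partial>gauss (edges U))"
  unfolding add_star_def
  by (rule integral_assemble(2)[OF _ bij_star_code[OF U(2)] f]) (simp add: U finite_edges)

lemma nn_integral_add_star:
  assumes U: "finite U" "v \<notin> U" and f: "f \<in> borel_measurable (gauss (edges (insert v U)))"
  shows "(\<integral>\<^sup>+z. f z \<partial>gauss (edges (insert v U))) =
    (\<integral>\<^sup>+x. \<integral>\<^sup>+a. f (add_star v U x a) \<partial>gauss U \<partial>gauss (edges U))"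
  unfolding add_star_def
  by (rule nn_integral_assemble[OF _ bij_star_code[OF U(2)] f]) (simp add: U finite_edges)

text \<open>The hafnian of a matrix with one additional vertex whose row is the vector \<open>\<theta>\<close>.\<close>

definition bhaf :: "'v set \<Rightarrow> ('v \<Rightarrow> real) \<Rightarrow> ('v set \<Rightarrow> real) \<Rightarrow> real" where
  "bhaf V \<theta> x = (\<Sum>q\<in>V. \<theta> q * haf (V - {q}) x)"

lemma bhaf_add_star_old:
  assumes "U' \<subseteq> U" "v \<notin> U"
  shows "bhaf U' \<theta> (add_star v U x a) = bhaf U' \<theta> x"
proof -
  have "haf (U' - {q}) (add_star v U x a) = haf (U' - {q}) x" for q
    using assms by (intro haf_add_star_old) auto
  then show ?thesis by (simp add: bhaf_def)
qed

text \<open>The expansion along \<open>v\<close> of the hafnian with the bordering vertex included: either \<open>v\<close> is matched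
  with the bordering vertex, or with some \<open>l\<close>, which leaves a bordered hafnian of smaller size.\<close>

lemma bhaf_add_star:
  assumes U: "finite U" "U' \<subseteq> U" "v \<notin> U"
  shows "bhaf (insert v U') \<theta> (add_star v U x a) = \<theta> v * haf U' x + (\<Sum>l\<in>U'. a l * bhaf (U' - {l}) \<theta> x)"
proof -
  have fin: "finite U'" "v \<notin> U'" using U finite_subset by auto
  have "bhaf (insert v U') \<theta> (add_star v U x a) = \<theta> v * haf U' (add_star v U x a) +
      (\<Sum>q\<in>U'. \<theta> q * haf (insert v U' - {q}) (add_star v U x a))"
    unfolding bhaf_def using fin by simp
  also have "haf U' (add_star v U x a) = haf U' x" using U by (intro haf_add_star_old) auto
  also have "(\<Sum>q\<in>U'. \<theta> q * haf (insert v U' - {q}) (add_star v U x a)) =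
      (\<Sum>q\<in>U'. \<Sum>l\<in>U' - {q}. \<theta> q * (a l * haf (U' - {q} - {l}) x))"
  proof (intro sum.cong refl)
    fix q assume q: "q \<in> U'"
    then have "insert v U' - {q} = insert v (U' - {q})" using fin by auto
    moreover have "haf (insert v (U' - {q})) (add_star v U x a) = (\<Sum>l\<in>U' - {q}. a l * haf (U' - {q} - {l}) x)"
      using U by (intro haf_add_star) auto
    ultimately show "\<theta> q * haf (insert v U' - {q}) (add_star v U x a) =
        (\<Sum>l\<in>U' - {q}. \<theta> q * (a l * haf (U' - {q} - {l}) x))"
      by (simp only: sum_distrib_left)
  qed
  also have "\<dots> = (\<Sum>l\<in>U'. \<Sum>q\<in>U' - {l}. \<theta> q * (a l * haf (U' - {q} - {l}) x))"
  proof -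
    have off: "(\<Sum>l\<in>U' - {q}. f l) = (\<Sum>l\<in>U'. if l = q then 0 else f l)" for q and f :: "'a \<Rightarrow> real"
      using fin by (intro sum.mono_neutral_cong_left) auto
    show ?thesis unfolding off
      by (subst sum.swap) (intro sum.cong refl, auto)
  qed
  also have "\<dots> = (\<Sum>l\<in>U'. a l * bhaf (U' - {l}) \<theta> x)"
  proof -
    have "U' - {q} - {l} = U' - {l} - {q}" for q l by auto
    then have "\<theta> q * (a l * haf (U' - {q} - {l}) x) = a l * (\<theta> q * haf (U' - {l} - {q}) x)" for q l
      by (metis mult.left_commute)
    then show ?thesis by (simp only: bhaf_def sum_distrib_left)
  qed
  finally show ?thesis .
qed

section \<open>Concentrating the border of a hafnian\<close>

definition haf_char :: "'v set \<Rightarrow> real \<Rightarrow> complex" where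
  "haf_char U u = (\<integral>x. iexp (u * haf U x) \<partial>gauss (edges U))"

definition border_char :: "'v set \<Rightarrow> ('v \<Rightarrow> real) \<Rightarrow> real \<Rightarrow> complex" where
  "border_char V \<theta> u = (\<integral>x. iexp (u * bhaf V \<theta> x) \<partial>gauss (edges V))"

lemma measurable_bhaf [measurable (raw)]:
  "U \<subseteq> V \<Longrightarrow> bhaf U \<theta> \<in> borel_measurable (gauss (edges V))"
  unfolding bhaf_def by (intro borel_measurable_sum borel_measurable_times measurable_haf) auto

lemma integrable_iexp_gauss:
  assumes "f \<in> borel_measurable (gauss I)"
  shows "integrable (gauss I) (\<lambda>x. iexp (f x))"
  using assms by (intro integrable_gauss_bounded[where K = 1]) auto

text \<open>Expanding along \<open>i\<close> and integrating its row \<open>a\<close>, then expanding the result along \<open>j\<close> with row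
  \<open>b\<close>, isolates the dependence on the border entries \<open>\<theta> i\<close> and \<open>\<theta> j\<close>. The edge between \<open>i\<close> and \<open>j\<close>
  contributes the first factor. The vector \<open>w\<close> consists of the hafnians of \<open>R\<close> without one vertex and the
  matrix \<open>B\<close> of the bordered hafnians of \<open>R\<close> without two.\<close>

lemma border_char_split:
  assumes R: "finite R" and i: "i \<notin> insert j R" and j: "j \<notin> R"
  shows "border_char (insert i (insert j R)) \<theta> u =
    (\<integral>x. complex_of_real (exp (- (u * bhaf R \<theta> x)\<^sup>2 / 2)) *
        oscillating R (\<lambda>l. u * haf (R - {l}) x)
          (\<lambda>l m. if l = m then 0 else u * bhaf (R - {l} - {m}) \<theta> x) (\<theta> j) (\<theta> i) \<partial>gauss (edges R))"
proof -
  define W where "W = insert j R"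
  have W: "finite W" "i \<notin> W" using R i by (auto simp: W_def)
  define g where "g x = iexp (u * \<theta> i * haf W x) *
      complex_of_real (exp (- (\<Sum>l\<in>W. (u * bhaf (W - {l}) \<theta> x)\<^sup>2) / 2))" for x
  have [measurable]: "haf W \<in> borel_measurable (gauss (edges W))"
    "bhaf (W - {l}) \<theta> \<in> borel_measurable (gauss (edges W))" for l
    by (intro measurable_haf measurable_bhaf; blast)+
  have "bhaf (insert i W) \<theta> \<in> borel_measurable (gauss (edges (insert i W)))"
    by (intro measurable_bhaf) blast
  then have "border_char (insert i W) \<theta> u =
      (\<integral>x. \<integral>a. iexp (u * bhaf (insert i W) \<theta> (add_star i W x a)) \<partial>gauss W \<partial>gauss (edges W))"
    unfolding border_char_def by (intro integral_add_star W integrable_iexp_gauss) measurable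
  also have "(\<lambda>x. \<integral>a. iexp (u * bhaf (insert i W) \<theta> (add_star i W x a)) \<partial>gauss W) = g"
  proof
    fix x
    have "iexp (u * bhaf (insert i W) \<theta> (add_star i W x a)) =
        iexp (u * \<theta> i * haf W x) * iexp (\<Sum>l\<in>W. (u * bhaf (W - {l}) \<theta> x) * a l)" for a
    proof -
      have "u * bhaf (insert i W) \<theta> (add_star i W x a) =
          u * \<theta> i * haf W x + (\<Sum>l\<in>W. (u * bhaf (W - {l}) \<theta> x) * a l)"
        unfolding bhaf_add_star[OF W(1) order_refl W(2)] by (simp add: ring_distribs sum_distrib_left mult_ac)
      then show ?thesis by (simp only: of_real_add ring_distribs exp_add)
    qed
    then show "(\<integral>a. iexp (u * bhaf (insert i W) \<theta> (add_star i W x a)) \<partial>gauss W) = g x"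
      by (simp only: integral_mult_right_zero gauss_iexp_linear[OF W(1)] g_def)
  qed
  also have "(\<integral>x. g x \<partial>gauss (edges W)) =
      (\<integral>x. \<integral>b. g (add_star j R x b) \<partial>gauss R \<partial>gauss (edges R))"
    unfolding W_def
  proof (rule integral_add_star[OF R j])
    have "g \<in> borel_measurable (gauss (edges W))" unfolding g_def by measurable
    moreover have "norm (g x) \<le> 1" for x
      unfolding g_def by (simp add: norm_mult sum_nonneg)
    ultimately show "integrable (gauss (edges (insert j R))) g"
      unfolding W_def by (rule integrable_gauss_bounded)
  qed
  also have "(\<lambda>x. \<integral>b. g (add_star j R x b) \<partial>gauss R) =
      (\<lambda>x. complex_of_real (exp (- (u * bhaf R \<theta> x)\<^sup>2 / 2)) *
        oscillating R (\<lambda>l. u * haf (R - {l}) x)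
          (\<lambda>l m. if l = m then 0 else u * bhaf (R - {l} - {m}) \<theta> x) (\<theta> j) (\<theta> i))"
  proof
    fix x
    define w where "w l = u * haf (R - {l}) x" for l
    define B where "B l m = (if l = m then 0 else u * bhaf (R - {l} - {m}) \<theta> x)" for l m
    have "g (add_star j R x b) = complex_of_real (exp (- (u * bhaf R \<theta> x)\<^sup>2 / 2)) *
        (iexp (\<theta> i * (\<Sum>l\<in>R. w l * b l)) * exp (- quad_form R w B (\<theta> j) b / 2))" for b
    proof -
      have 1: "u * \<theta> i * haf W (add_star j R x b) = \<theta> i * (\<Sum>l\<in>R. w l * b l)"
        unfolding W_def haf_add_star[OF R order_refl j] by (simp add: w_def sum_distrib_left mult_ac)
      have 2: "u * bhaf (W - {l}) \<theta> (add_star j R x b) = \<theta> j * w l + (\<Sum>m\<in>R. B l m * b m)" if l: "l \<in> R" for l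
      proof -
        have "W - {l} = insert j (R - {l})" using l j by (auto simp: W_def)
        then have "u * bhaf (W - {l}) \<theta> (add_star j R x b) =
            \<theta> j * w l + (\<Sum>m\<in>R - {l}. u * (b m * bhaf (R - {l} - {m}) \<theta> x))"
          using bhaf_add_star[of R "R - {l}" j \<theta> x b] R j
          by (simp add: w_def ring_distribs sum_distrib_left mult_ac)
        also have "(\<Sum>m\<in>R - {l}. u * (b m * bhaf (R - {l} - {m}) \<theta> x)) = (\<Sum>m\<in>R. B l m * b m)"
          using R by (intro sum.mono_neutral_cong_left) (auto simp: B_def mult_ac)
        finally show ?thesis .
      qed
      have "W - {j} = R" using j by (auto simp: W_def)
      then have 3: "bhaf (W - {j}) \<theta> (add_star j R x b) = bhaf R \<theta> x"
        using bhaf_add_star_old[OF order_refl j] by simp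
      have "(\<Sum>l\<in>W. (u * bhaf (W - {l}) \<theta> (add_star j R x b))\<^sup>2) =
          (u * bhaf (W - {j}) \<theta> (add_star j R x b))\<^sup>2 + (\<Sum>l\<in>R. (u * bhaf (W - {l}) \<theta> (add_star j R x b))\<^sup>2)"
        using sum.insert[OF R j, of "\<lambda>l. (u * bhaf (W - {l}) \<theta> (add_star j R x b))\<^sup>2"]
        by (simp only: W_def[symmetric])
      also have "\<dots> = (u * bhaf R \<theta> x)\<^sup>2 + quad_form R w B (\<theta> j) b"
        unfolding quad_form_def 3 using 2 by simp
      finally have Q: "(\<Sum>l\<in>W. (u * bhaf (W - {l}) \<theta> (add_star j R x b))\<^sup>2) =
          (u * bhaf R \<theta> x)\<^sup>2 + quad_form R w B (\<theta> j) b" .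
      have E: "exp (- (p + q) / 2) = exp (- p / 2) * exp (- q / 2)" for p q :: real
        by (simp add: exp_add[symmetric] add_divide_distrib)
      show ?thesis unfolding g_def 1 Q E by simp
    qed
    then show "(\<integral>b. g (add_star j R x b) \<partial>gauss R) =
        complex_of_real (exp (- (u * bhaf R \<theta> x)\<^sup>2 / 2)) *
        oscillating R (\<lambda>l. u * haf (R - {l}) x)
          (\<lambda>l m. if l = m then 0 else u * bhaf (R - {l} - {m}) \<theta> x) (\<theta> j) (\<theta> i)"
      unfolding w_def[symmetric] B_def[symmetric] oscillating_def
      by (simp only: integral_mult_right_zero)
  qed
  finally show ?thesis by (simp only: W_def)
qed

text \<open>The modulus of the inner integral depends on \<open>\<theta> i\<close> and \<open>\<theta> j\<close> only through
  \<open>(\<theta> i)\<^sup>2 + (\<theta> j)\<^sup>2\<close>, and for the modified border it is positive. So the triangle inequality for the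
  outer integral is an equality for the modified border.\<close>

lemma norm_border_char_le:
  assumes V: "finite V" and ij: "i \<in> V" "j \<in> V" "i \<noteq> j"
  shows "norm (border_char V \<theta> u) \<le>
    norm (border_char V (\<theta>(i := 0, j := sqrt ((\<theta> i)\<^sup>2 + (\<theta> j)\<^sup>2))) u)"
proof -
  define R where "R = V - {i, j}"
  define r where "r = sqrt ((\<theta> i)\<^sup>2 + (\<theta> j)\<^sup>2)"
  define \<theta>' where "\<theta>' = \<theta>(i := 0, j := r)"
  have R: "finite R" "i \<notin> insert j R" "j \<notin> R" and VR: "V = insert i (insert j R)"
    using V ij by (auto simp: R_def)
  define w where "w x l = u * haf (R - {l}) x" for x l
  define B where "B x l m = (if l = m then 0 else u * bhaf (R - {l} - {m}) \<theta> x)" for x l m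
  define K where "K x = (\<integral>a. exp (- quad_form R (w x) (B x) r a / 2) \<partial>gauss R)" for x
  define F where "F x = exp (- (u * bhaf R \<theta> x)\<^sup>2 / 2) * K x" for x
  have th: "bhaf R' \<theta>' x = bhaf R' \<theta> x" if "R' \<subseteq> R" for R' x
  proof -
    have "\<theta>' q = \<theta> q" if "q \<in> R'" for q
      using that \<open>R' \<subseteq> R\<close> R by (auto simp: \<theta>'_def)
    then show ?thesis by (simp add: bhaf_def)
  qed
  have th2: "bhaf R \<theta>' x = bhaf R \<theta> x" "bhaf (R - {l} - {m}) \<theta>' x = bhaf (R - {l} - {m}) \<theta> x" for l m x
    by (rule th; blast)+
  have sym: "B x l m = B x m l" for x l m
  proof -
    have "R - {l} - {m} = R - {m} - {l}" by auto
    then show ?thesis by (simp add: B_def)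
  qed
  have K0: "K x \<ge> 0" for x unfolding K_def by (intro Bochner_Integration.integral_nonneg) auto
  have "norm (border_char V \<theta> u) \<le>
      (\<integral>x. norm (complex_of_real (exp (- (u * bhaf R \<theta> x)\<^sup>2 / 2)) * oscillating R (w x) (B x) (\<theta> j) (\<theta> i)) \<partial>gauss (edges R))"
    unfolding VR border_char_split[OF R] w_def[symmetric] B_def[symmetric]
    by (rule integral_norm_bound)
  also have "\<dots> = (\<integral>x. F x \<partial>gauss (edges R))"
    using norm_oscillating[OF R(1) sym] by (simp add: norm_mult F_def K_def r_def add.commute)
  also have "\<dots> = norm (complex_of_real (\<integral>x. F x \<partial>gauss (edges R)))"
    using K0 by (simp add: F_def)
  also have "complex_of_real (\<integral>x. F x \<partial>gauss (edges R)) = border_char V \<theta>' u"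
  proof -
    have "\<theta>' j = r" "\<theta>' i = 0" using ij by (auto simp: \<theta>'_def)
    then have "border_char V \<theta>' u =
        (\<integral>x. complex_of_real (exp (- (u * bhaf R \<theta> x)\<^sup>2 / 2)) * oscillating R (w x) (B x) r 0 \<partial>gauss (edges R))"
      unfolding VR border_char_split[OF R] th2 w_def[symmetric] B_def[symmetric] by simp
    also have "\<dots> = (\<integral>x. complex_of_real (F x) \<partial>gauss (edges R))"
      by (simp add: oscillating_real F_def K_def)
    finally show ?thesis by simp
  qed
  finally show ?thesis by (simp add: \<theta>'_def r_def)
qed

lemma border_char_cong: "(\<And>q. q \<in> V \<Longrightarrow> \<theta> q = \<theta>' q) \<Longrightarrow> border_char V \<theta> u = border_char V \<theta>' u"
  by (simp add: border_char_def bhaf_def)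

lemma norm_haf_char_minus: "norm (haf_char U (- u)) = norm (haf_char U u)"
proof -
  have "haf_char U (- u) = cnj (haf_char U u)"
    unfolding haf_char_def Bochner_Integration.integral_cnj[symmetric] by (simp add: exp_cnj)
  then show ?thesis by simp
qed

lemma border_char_concentrated:
  assumes V: "finite V" "v \<in> V"
  shows "border_char V (\<lambda>q. if q = v then r else 0) u = haf_char (V - {v}) (u * r)"
proof -
  define U where "U = V - {v}"
  have U: "finite U" "v \<notin> U" "V = insert v U" using V by (auto simp: U_def)
  interpret prob_space "gauss U" by (rule prob_space_gauss)
  have "bhaf V (\<lambda>q. if q = v then r else 0) x = r * haf U x" for x
    using V by (simp add: bhaf_def U_def if_distrib[of "\<lambda>t. t * _"] cong: if_cong)
  then have "border_char V (\<lambda>q. if q = v then r else 0) u = (\<integral>x. iexp (u * r * haf U x) \<partial>gauss (edges V))"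
    by (simp add: border_char_def mult.assoc)
  also have "\<dots> = (\<integral>x. \<integral>a. iexp (u * r * haf U (add_star v U x a)) \<partial>gauss U \<partial>gauss (edges U))"
    unfolding U(3)
  proof (rule integral_add_star[OF U(1,2)])
    have "haf U \<in> borel_measurable (gauss (edges (insert v U)))" by (intro measurable_haf) blast
    then show "integrable (gauss (edges (insert v U))) (\<lambda>x. iexp (u * r * haf U x))"
      by (intro integrable_iexp_gauss borel_measurable_times borel_measurable_const)
  qed
  also have "\<dots> = haf_char U (u * r)"
    by (simp add: haf_add_star_old[OF order_refl U(2)] haf_char_def prob_space)
  finally show ?thesis by (simp add: U_def)
qed

text \<open>The vertices different from \<open>v\<close> hand over their border entries to \<open>v\<close> one at a time. In the end
  the bordering vertex can be matched with \<open>v\<close> only.\<close>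

lemma norm_border_char_le_haf_char:
  assumes V: "finite V" and v: "v \<in> V"
  shows "norm (border_char V \<theta> u) \<le> norm (haf_char (V - {v}) (u * sqrt (\<Sum>q\<in>V. (\<theta> q)\<^sup>2)))"
proof -
  \<comment> \<open>The entry at \<open>v\<close> is known up to its sign only, because it may be negative as long as nothing has been moved.\<close>
  have "\<exists>\<rho>. \<rho>\<^sup>2 = (\<theta> v)\<^sup>2 + (\<Sum>q\<in>K. (\<theta> q)\<^sup>2) \<and>
      norm (border_char V \<theta> u) \<le> norm (border_char V (\<lambda>q. if q \<in> K then 0 else if q = v then \<rho> else \<theta> q) u)"
    if "finite K" "K \<subseteq> V - {v}" for K
    using that
  proof (induction K rule: finite_induct)
    case empty
    have "(\<lambda>q. if q = v then \<theta> v else \<theta> q) = \<theta>" by auto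
    then show ?case by (intro exI[of _ "\<theta> v"]) simp
  next
    case (insert i K)
    then obtain \<rho> where \<rho>: "\<rho>\<^sup>2 = (\<theta> v)\<^sup>2 + (\<Sum>q\<in>K. (\<theta> q)\<^sup>2)"
      and le: "norm (border_char V \<theta> u) \<le> norm (border_char V (\<lambda>q. if q \<in> K then 0 else if q = v then \<rho> else \<theta> q) u)"
      by auto
    let ?\<theta> = "\<lambda>q. if q \<in> K then 0 else if q = v then \<rho> else \<theta> q"
    have iv: "i \<in> V" "i \<noteq> v" "v \<notin> K" "?\<theta> i = \<theta> i" "?\<theta> v = \<rho>" using insert by auto
    have "norm (border_char V ?\<theta> u) \<le> norm (border_char V (?\<theta>(i := 0, v := sqrt ((?\<theta> i)\<^sup>2 + (?\<theta> v)\<^sup>2))) u)"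
      using iv by (intro norm_border_char_le[OF V _ v]) auto
    also have "?\<theta>(i := 0, v := sqrt ((?\<theta> i)\<^sup>2 + (?\<theta> v)\<^sup>2)) =
        (\<lambda>q. if q \<in> insert i K then 0 else if q = v then sqrt ((\<theta> i)\<^sup>2 + \<rho>\<^sup>2) else \<theta> q)"
      unfolding iv using iv(2,3) by (auto simp: fun_eq_iff)
    finally show ?case using le insert.hyps \<rho>
      by (intro exI[of _ "sqrt ((\<theta> i)\<^sup>2 + \<rho>\<^sup>2)"]) (auto simp: add_ac intro!: add_nonneg_nonneg sum_nonneg)
  qed
  from this[of "V - {v}"] V obtain \<rho> where \<rho>: "\<rho>\<^sup>2 = (\<theta> v)\<^sup>2 + (\<Sum>q\<in>V - {v}. (\<theta> q)\<^sup>2)"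
    and le: "norm (border_char V \<theta> u) \<le> norm (border_char V (\<lambda>q. if q \<in> V - {v} then 0 else if q = v then \<rho> else \<theta> q) u)"
    by auto
  have sq: "\<rho>\<^sup>2 = (\<Sum>q\<in>V. (\<theta> q)\<^sup>2)" using \<rho> sum.remove[OF V v, of "\<lambda>q. (\<theta> q)\<^sup>2"] by simp
  have "border_char V (\<lambda>q. if q \<in> V - {v} then 0 else if q = v then \<rho> else \<theta> q) u = haf_char (V - {v}) (u * \<rho>)"
    unfolding border_char_concentrated[OF V v, symmetric] by (rule border_char_cong) auto
  then have "norm (border_char V \<theta> u) \<le> norm (haf_char (V - {v}) (u * \<rho>))" using le by simp
  also have "norm (haf_char (V - {v}) (u * \<rho>)) = norm (haf_char (V - {v}) (u * \<bar>\<rho>\<bar>))"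
    using norm_haf_char_minus[of "V - {v}" "u * \<rho>"] by (cases "\<rho> \<ge> 0") (auto simp: abs_real_def)
  also have "\<bar>\<rho>\<bar> = sqrt (\<Sum>q\<in>V. (\<theta> q)\<^sup>2)" by (simp add: sq[symmetric])
  finally show ?thesis .
qed

section \<open>Gaussian norms and the chi-square constants\<close>

lemma nn_integral_gaussian:
  assumes s: "s > 0"
  shows "(\<integral>\<^sup>+u. ennreal (exp (- (u * s)\<^sup>2 / 2)) \<partial>lborel) = ennreal (sqrt (2 * pi) / s)"
proof -
  have "(\<integral>\<^sup>+u. ennreal (exp (- (u * s)\<^sup>2 / 2)) \<partial>lborel) =
      ennreal \<bar>1 / s\<bar> * (\<integral>\<^sup>+x. ennreal (exp (- ((0 + 1 / s * x) * s)\<^sup>2 / 2)) \<partial>lborel)"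
    using s by (subst nn_integral_real_affine[where c = "1 / s" and t = 0]) auto
  also have "(\<lambda>x. ennreal (exp (- ((0 + 1 / s * x) * s)\<^sup>2 / 2))) =
      (\<lambda>x. ennreal (sqrt (2 * pi)) * ennreal (std_normal_density x))"
    using s by (simp add: std_normal_density_def ennreal_mult'[symmetric] fun_eq_iff)
  also have "(\<integral>\<^sup>+x. ennreal (sqrt (2 * pi)) * ennreal (std_normal_density x) \<partial>lborel) = ennreal (sqrt (2 * pi))"
    by (subst nn_integral_cmult)
       (auto simp: nn_integral_eq_integral[OF integrable_normal_density] integral_normal_density)
  also have "ennreal \<bar>1 / s\<bar> * ennreal (sqrt (2 * pi)) = ennreal (sqrt (2 * pi) / s)"
    using s by (simp add: ennreal_mult'[symmetric])
  finally show ?thesis .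
qed

lemma nn_integral_std_normal_exp_square:
  "(\<integral>\<^sup>+z. ennreal (exp (- (u * z)\<^sup>2 / 2)) \<partial>std_normal) = ennreal (1 / sqrt (1 + u\<^sup>2))"
proof -
  define s where "s = sqrt (1 + u\<^sup>2)"
  have s: "s > 0" "s\<^sup>2 = 1 + u\<^sup>2" unfolding s_def by (auto simp: add_pos_nonneg)
  have "(\<integral>\<^sup>+z. ennreal (exp (- (u * z)\<^sup>2 / 2)) \<partial>std_normal) =
      (\<integral>\<^sup>+z. ennreal (std_normal_density z) * ennreal (exp (- (u * z)\<^sup>2 / 2)) \<partial>lborel)"
    by (rule nn_integral_std_normal) measurable
  also have "\<dots> = (\<integral>\<^sup>+z. ennreal (1 / sqrt (2 * pi)) * ennreal (exp (- (z * s)\<^sup>2 / 2)) \<partial>lborel)"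
    by (intro nn_integral_cong)
       (simp add: std_normal_density_def ennreal_mult'[symmetric] mult_exp_exp power_mult_distrib s(2) field_simps)
  also have "\<dots> = ennreal (1 / sqrt (2 * pi)) * ennreal (sqrt (2 * pi) / s)"
    unfolding nn_integral_gaussian[OF s(1), symmetric] by (rule nn_integral_cmult) measurable
  also have "\<dots> = ennreal (1 / s)" by (simp add: ennreal_mult'[symmetric])
  finally show ?thesis by (simp add: s_def)
qed

lemma measurable_chi_square_density [measurable]: "chi_square_density d \<in> borel_measurable borel"
  unfolding chi_square_density_def by measurable

lemma chi_square_density_nonneg: "d > 0 \<Longrightarrow> chi_square_density d x \<ge> 0"
  by (simp add: chi_square_density_def Gamma_real_pos less_imp_le)

text \<open>The Laplace transform of the chi-square law, reduced to the Gamma integral by the substitution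
  \<open>y = (1 + t) x / 2\<close>.\<close>

lemma nn_integral_chi_square_exp:
  assumes d: "d > 0" and t: "t \<ge> 0"
  shows "(\<integral>\<^sup>+x. ennreal (exp (- t * x / 2)) \<partial>chi_square d) = ennreal ((1 + t) powr (- d / 2))"
proof -
  define c where "c = (1 + t) / 2"
  have c: "c > 0" using t by (simp add: c_def)
  have G: "Gamma (d / 2) > 0" using d by (intro Gamma_real_pos) auto
  define C where "C = 2 powr (d / 2) * Gamma (d / 2)"
  have C: "C > 0" using G by (simp add: C_def)
  have "(\<integral>\<^sup>+x. ennreal (exp (- t * x / 2)) \<partial>chi_square d) =
      (\<integral>\<^sup>+x. ennreal (chi_square_density d x) * ennreal (exp (- t * x / 2)) \<partial>lborel)"
    unfolding chi_square_def by (subst nn_integral_density) auto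
  also have "\<dots> = ennreal \<bar>1 / c\<bar> * (\<integral>\<^sup>+y. ennreal (chi_square_density d (0 + 1 / c * y)) * ennreal (exp (- t * (0 + 1 / c * y) / 2)) \<partial>lborel)"
    using c by (subst nn_integral_real_affine[where c = "1 / c" and t = 0]) auto
  also have "(\<lambda>y. ennreal (chi_square_density d (0 + 1 / c * y)) * ennreal (exp (- t * (0 + 1 / c * y) / 2))) =
      (\<lambda>y. ennreal (c powr (1 - d / 2) / C) * ennreal (indicator {0..} y * y powr (d / 2 - 1) / exp y))"
  proof
    fix y :: real
    show "ennreal (chi_square_density d (0 + 1 / c * y)) * ennreal (exp (- t * (0 + 1 / c * y) / 2)) =
      ennreal (c powr (1 - d / 2) / C) * ennreal (indicator {0..} y * y powr (d / 2 - 1) / exp y)"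
    proof (cases "y > 0")
      case True
      have h1: "(y / c) powr (d / 2 - 1) = y powr (d / 2 - 1) * c powr (1 - d / 2)"
      proof -
        have "c powr (1 - d / 2) = inverse (c powr (d / 2 - 1))"
          using powr_minus[of c "d / 2 - 1"] by (simp only: minus_diff_eq)
        then show ?thesis using True c by (simp only: powr_divide less_imp_le divide_inverse[of "y powr _"])
      qed
      have h2: "exp (- (y / c) / 2) * exp (- t * (y / c) / 2) = exp (- y)"
      proof -
        have "- (y / c) / 2 + - t * (y / c) / 2 = - ((1 + t) / 2 * (y / c))"
          by (simp add: ring_distribs add_divide_distrib)
        also have "(1 + t) / 2 * (y / c) = y" unfolding c_def[symmetric] using c by simp
        finally show ?thesis by (simp only: mult_exp_exp)
      qed
      have h3: "chi_square_density d (y / c) = (y / c) powr (d / 2 - 1) * exp (- (y / c) / 2) / C"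
        using True c by (simp add: chi_square_density_def C_def)
      have "chi_square_density d (y / c) * exp (- t * (y / c) / 2) =
          (y / c) powr (d / 2 - 1) * (exp (- (y / c) / 2) * exp (- t * (y / c) / 2)) / C"
        unfolding h3 by simp
      also have "\<dots> = c powr (1 - d / 2) / C * (y powr (d / 2 - 1) * exp (- y))"
        unfolding h1 h2 by simp
      finally have "chi_square_density d (y / c) * exp (- t * (y / c) / 2) =
          c powr (1 - d / 2) / C * (y powr (d / 2 - 1) * exp (- y))" .
      then have "chi_square_density d (y / c) * exp (- t * (y / c) / 2) =
          c powr (1 - d / 2) / C * (y powr (d / 2 - 1) / exp y)"
        by (simp only: exp_minus divide_inverse)
      moreover have "0 + 1 / c * y = y / c" by simp
      moreover have "0 \<le> c powr (1 - d / 2) / C" "0 \<le> chi_square_density d (y / c)"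
        "indicator {0..} y * y powr (d / 2 - 1) / exp y = y powr (d / 2 - 1) / exp y"
        using C True d by (auto simp: chi_square_density_nonneg)
      ultimately show ?thesis by (simp only: ennreal_mult'[symmetric])
    next
      case False
      then have "chi_square_density d (1 / c * y) = 0" using c
        by (simp add: chi_square_density_def zero_less_divide_iff)
      moreover have "indicator {0..} y * y powr (d / 2 - 1) / exp y = 0" using False by (auto simp: indicator_def)
      ultimately show ?thesis by simp
    qed
  qed
  also have "(\<integral>\<^sup>+y. ennreal (c powr (1 - d / 2) / C) * ennreal (indicator {0..} y * y powr (d / 2 - 1) / exp y) \<partial>lborel) =
      ennreal (c powr (1 - d / 2) / C) * ennreal (Gamma (d / 2))"
    using d by (subst nn_integral_cmult) (auto simp: Gamma_conv_nn_integral_real)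
  also have "ennreal \<bar>1 / c\<bar> * (ennreal (c powr (1 - d / 2) / C) * ennreal (Gamma (d / 2))) =
      ennreal (1 / c * (c powr (1 - d / 2) / C * Gamma (d / 2)))"
    using c C G by (simp add: ennreal_mult'[symmetric])
  also have "1 / c * (c powr (1 - d / 2) / C * Gamma (d / 2)) = (1 + t) powr (- d / 2)"
  proof -
    have "c powr (- d / 2) = c powr (1 - d / 2) / c"
      using c powr_diff[of c "1 - d / 2" 1] by simp
    moreover have "c powr (- d / 2) = (1 + t) powr (- d / 2) * 2 powr (d / 2)"
    proof -
      have "2 powr (- d / 2) = inverse (2 powr (d / 2) :: real)"
        using powr_minus[of 2 "d / 2"] by (simp only: minus_divide_left)
      then show ?thesis unfolding c_def powr_divide by (simp only: divide_inverse inverse_inverse_eq)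
    qed
    ultimately have e: "c powr (1 - d / 2) / c = (1 + t) powr (- d / 2) * 2 powr (d / 2)" by simp
    have "1 / c * (c powr (1 - d / 2) / C * Gamma (d / 2)) = (c powr (1 - d / 2) / c) * (Gamma (d / 2) / C)"
      by simp
    also have "\<dots> = (1 + t) powr (- d / 2) * 2 powr (d / 2) * (Gamma (d / 2) / (2 powr (d / 2) * Gamma (d / 2)))"
      unfolding e C_def by (rule refl)
    also have "\<dots> = (1 + t) powr (- d / 2)" using G by simp
    finally show ?thesis .
  qed
  finally show ?thesis .
qed

lemma gamma_const_pos: "d > 1 \<Longrightarrow> gamma_const d > 0"
  by (simp add: gamma_const_eq Gamma_real_pos)

lemma nn_integral_chi_square_inverse_sqrt:
  assumes d: "d > 1"
  shows "(\<integral>\<^sup>+x. ennreal (x powr (- 1 / 2)) \<partial>chi_square d) = ennreal (gamma_const d)"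
proof -
  have "integrable (chi_square d) (\<lambda>x. x powr (- 1 / 2))"
  proof (rule ccontr)
    assume "\<not> integrable (chi_square d) (\<lambda>x. x powr (- 1 / 2))"
    then have "gamma_const d = 0" unfolding gamma_const_def by (rule not_integrable_integral_eq)
    then show False using gamma_const_pos[OF d] by simp
  qed
  then show ?thesis unfolding gamma_const_def by (rule nn_integral_eq_integral) auto
qed

lemma sigma_finite_chi_square: "sigma_finite_measure (chi_square d)"
  unfolding chi_square_def by (rule sigma_finite_measure.sigma_finite_iff_density_finite[THEN iffD2, OF lborel.sigma_finite_measure_axioms]) auto

text \<open>Since \<open>x powr (- 1 / 2)\<close> is a multiple of the integral of \<open>exp (- u\<^sup>2 x / 2)\<close> over \<open>u\<close>, the mean
  inverse square root of a chi-square variable is an integral of its Laplace transform at \<open>u\<^sup>2\<close>.\<close>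

lemma nn_integral_inverse_power_quadratic:
  assumes d: "d > 1"
  shows "(\<integral>\<^sup>+u. ennreal ((1 + u\<^sup>2) powr (- d / 2)) \<partial>lborel) = ennreal (sqrt (2 * pi) * gamma_const d)"
proof -
  interpret C: sigma_finite_measure "chi_square d" by (rule sigma_finite_chi_square)
  interpret pair_sigma_finite "chi_square d" lborel ..
  have m: "(\<lambda>(x, u). ennreal (exp (- (u\<^sup>2) * x / 2))) \<in> borel_measurable (chi_square d \<Otimes>\<^sub>M lborel)"
  proof -
    have "sets (chi_square d \<Otimes>\<^sub>M lborel) = sets (borel \<Otimes>\<^sub>M borel)"
      by (intro sets_pair_measure_cong) (auto simp: chi_square_def)
    from measurable_cong_sets[OF this refl]
    have "borel_measurable (chi_square d \<Otimes>\<^sub>M lborel) = borel_measurable (borel \<Otimes>\<^sub>M borel)" .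
    moreover have "(\<lambda>(x, u). ennreal (exp (- (u\<^sup>2) * x / 2))) \<in> borel_measurable (borel \<Otimes>\<^sub>M borel)" by measurable
    ultimately show ?thesis by blast
  qed
  have "(\<integral>\<^sup>+u. ennreal ((1 + u\<^sup>2) powr (- d / 2)) \<partial>lborel) =
      (\<integral>\<^sup>+u. \<integral>\<^sup>+x. ennreal (exp (- (u\<^sup>2) * x / 2)) \<partial>chi_square d \<partial>lborel)"
    using d by (intro nn_integral_cong nn_integral_chi_square_exp[symmetric]) auto
  also have "\<dots> = (\<integral>\<^sup>+x. \<integral>\<^sup>+u. ennreal (exp (- (u\<^sup>2) * x / 2)) \<partial>lborel \<partial>chi_square d)"
    by (rule Fubini'[OF m])
  also have "\<dots> = (\<integral>\<^sup>+x. ennreal (sqrt (2 * pi)) * ennreal (x powr (- 1 / 2)) \<partial>chi_square d)"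
  proof (rule nn_integral_cong_AE)
    have "AE x in chi_square d. x > 0"
      unfolding chi_square_def by (subst AE_density) (auto simp: chi_square_density_def)
    then show "AE x in chi_square d. (\<integral>\<^sup>+u. ennreal (exp (- (u\<^sup>2) * x / 2)) \<partial>lborel) = ennreal (sqrt (2 * pi)) * ennreal (x powr (- 1 / 2))"
    proof eventually_elim
      case (elim x)
      have "(\<integral>\<^sup>+u. ennreal (exp (- (u\<^sup>2) * x / 2)) \<partial>lborel) = (\<integral>\<^sup>+u. ennreal (exp (- (u * sqrt x)\<^sup>2 / 2)) \<partial>lborel)"
        using elim by (simp add: power_mult_distrib)
      also have "\<dots> = ennreal (sqrt (2 * pi) / sqrt x)" using elim by (intro nn_integral_gaussian) auto
      also have "sqrt (2 * pi) / sqrt x = sqrt (2 * pi) * x powr (- 1 / 2)"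
      proof -
        have "x powr (- 1 / 2) = inverse (sqrt x)"
          using elim powr_minus[of x "1 / 2"] powr_half_sqrt[of x] by (simp only: minus_divide_left less_imp_le)
        then show ?thesis by (simp only: divide_inverse)
      qed
      finally show ?case by (simp add: ennreal_mult')
    qed
  qed
  also have "\<dots> = ennreal (sqrt (2 * pi)) * ennreal (gamma_const d)"
    unfolding nn_integral_chi_square_inverse_sqrt[OF d, symmetric]
    by (rule nn_integral_cmult) (auto simp: chi_square_def)
  finally show ?thesis by (simp add: ennreal_mult')
qed

lemma nn_integral_gauss_exp_norm:
  assumes V: "finite V"
  shows "(\<integral>\<^sup>+\<rho>. ennreal (exp (- (u * sqrt (\<Sum>q\<in>V. (\<rho> q)\<^sup>2))\<^sup>2 / 2)) \<partial>gauss V) =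
    ennreal ((1 + u\<^sup>2) powr (- real (card V) / 2))"
proof -
  interpret product_sigma_finite "\<lambda>_. std_normal" by (rule product_sigma_finite_std_normal)
  have pos: "1 + u\<^sup>2 > 0" by (simp add: add_pos_nonneg)
  have "(\<integral>\<^sup>+\<rho>. ennreal (exp (- (u * sqrt (\<Sum>q\<in>V. (\<rho> q)\<^sup>2))\<^sup>2 / 2)) \<partial>gauss V) =
      (\<integral>\<^sup>+\<rho>. (\<Prod>q\<in>V. ennreal (exp (- (u * \<rho> q)\<^sup>2 / 2))) \<partial>gauss V)"
  proof (intro nn_integral_cong)
    fix \<rho> :: "'a \<Rightarrow> real"
    have "- (u * sqrt (\<Sum>q\<in>V. (\<rho> q)\<^sup>2))\<^sup>2 / 2 = (\<Sum>q\<in>V. - (u * \<rho> q)\<^sup>2 / 2)"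
      by (simp add: power_mult_distrib sum_nonneg sum_distrib_left sum_negf sum_divide_distrib)
    then show "ennreal (exp (- (u * sqrt (\<Sum>q\<in>V. (\<rho> q)\<^sup>2))\<^sup>2 / 2)) = (\<Prod>q\<in>V. ennreal (exp (- (u * \<rho> q)\<^sup>2 / 2)))"
      using V by (simp only: exp_sum prod_ennreal exp_ge_zero)
  qed
  also have "\<dots> = (\<Prod>q\<in>V. \<integral>\<^sup>+z. ennreal (exp (- (u * z)\<^sup>2 / 2)) \<partial>std_normal)"
    unfolding gauss_def using V by (intro product_nn_integral_prod) auto
  also have "\<dots> = ennreal ((1 / sqrt (1 + u\<^sup>2)) ^ card V)"
    unfolding nn_integral_std_normal_exp_square prod_constant by (simp add: ennreal_power)
  also have "(1 / sqrt (1 + u\<^sup>2)) ^ card V = (1 + u\<^sup>2) powr (- real (card V) / 2)"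
  proof -
    have "1 / sqrt (1 + u\<^sup>2) = (1 + u\<^sup>2) powr (- (1 / 2))"
      using pos by (simp only: powr_minus powr_half_sqrt less_imp_le) (simp only: divide_inverse mult_1_left)
    then show ?thesis using pos by (simp add: powr_power)
  qed
  finally show ?thesis .
qed

text \<open>Substituting \<open>u \<bar>\<rho>\<bar>\<close> for \<open>u\<close> produces the factor \<open>1 / \<bar>\<rho>\<bar>\<close>, whose mean is \<open>\<gamma>\<^sub>d\<close> because
  \<open>\<bar>\<rho>\<bar>\<^sup>2\<close> has the same Laplace transform as a chi-square variable with \<open>d = card V\<close> degrees of freedom.
  The case \<open>\<rho> = 0\<close> is negligible because the mean is finite.\<close>

lemma nn_integral_gauss_norm_scaling:
  assumes V: "finite V" "card V \<ge> 2" and g: "g \<in> borel_measurable borel"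
  shows "(\<integral>\<^sup>+\<rho>. \<integral>\<^sup>+u. g (u * sqrt (\<Sum>q\<in>V. (\<rho> q)\<^sup>2)) \<partial>lborel \<partial>gauss V) =
    ennreal (gamma_const (real (card V))) * (\<integral>\<^sup>+u. g u \<partial>lborel)"
proof -
  define N where "N \<rho> = sqrt (\<Sum>q\<in>V. (\<rho> q)\<^sup>2)" for \<rho> :: "'a \<Rightarrow> real"
  define L where "L \<rho> = (\<integral>\<^sup>+u. ennreal (exp (- (u * N \<rho>)\<^sup>2 / 2)) \<partial>lborel)" for \<rho>
  interpret pair_sigma_finite "gauss V" lborel
    by (intro pair_sigma_finite.intro sigma_finite_gauss lborel.sigma_finite_measure_axioms)
  have Nm [measurable]: "N \<in> borel_measurable (gauss V)" unfolding N_def by measurable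
  have N0: "N \<rho> \<ge> 0" for \<rho> unfolding N_def by (simp add: sum_nonneg)
  have Lm [measurable]: "L \<in> borel_measurable (gauss V)" unfolding L_def by measurable
  have "(\<integral>\<^sup>+\<rho>. L \<rho> \<partial>gauss V) = (\<integral>\<^sup>+u. \<integral>\<^sup>+\<rho>. ennreal (exp (- (u * N \<rho>)\<^sup>2 / 2)) \<partial>gauss V \<partial>lborel)"
    unfolding L_def by (rule Fubini'[symmetric]) measurable
  also have "\<dots> = ennreal (sqrt (2 * pi) * gamma_const (real (card V)))"
    unfolding N_def nn_integral_gauss_exp_norm[OF V(1)]
    using V(2) by (intro nn_integral_inverse_power_quadratic) auto
  finally have LI: "(\<integral>\<^sup>+\<rho>. L \<rho> \<partial>gauss V) = ennreal (sqrt (2 * pi) * gamma_const (real (card V)))" .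
  have fin: "AE \<rho> in gauss V. L \<rho> \<noteq> \<infinity>"
    by (rule nn_integral_noteq_infinite) (auto simp: LI)
  have "AE \<rho> in gauss V. (\<integral>\<^sup>+u. g (u * N \<rho>) \<partial>lborel) = ennreal (1 / sqrt (2 * pi)) * L \<rho> * (\<integral>\<^sup>+u. g u \<partial>lborel)"
    using fin
  proof eventually_elim
    case (elim \<rho>)
    have "N \<rho> \<noteq> 0"
    proof
      assume "N \<rho> = 0"
      then have "L \<rho> = \<infinity>" unfolding L_def by simp
      then show False using elim by simp
    qed
    then have N: "N \<rho> > 0" using N0[of \<rho>] by simp
    have "L \<rho> = ennreal (sqrt (2 * pi) / N \<rho>)" unfolding L_def by (rule nn_integral_gaussian[OF N])
    then have L: "ennreal (1 / sqrt (2 * pi)) * L \<rho> = ennreal (1 / N \<rho>)"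
      using N by (simp add: ennreal_mult'[symmetric])
    have "(\<integral>\<^sup>+u. g (u * N \<rho>) \<partial>lborel) = ennreal \<bar>1 / N \<rho>\<bar> * (\<integral>\<^sup>+u. g ((0 + 1 / N \<rho> * u) * N \<rho>) \<partial>lborel)"
      using g N by (subst nn_integral_real_affine[where c = "1 / N \<rho>" and t = 0]) auto
    then show ?case unfolding L using N by simp
  qed
  then have "(\<integral>\<^sup>+\<rho>. \<integral>\<^sup>+u. g (u * N \<rho>) \<partial>lborel \<partial>gauss V) =
      (\<integral>\<^sup>+\<rho>. ennreal (1 / sqrt (2 * pi)) * L \<rho> * (\<integral>\<^sup>+u. g u \<partial>lborel) \<partial>gauss V)"
    by (rule nn_integral_cong_AE)
  also have "\<dots> = ennreal (1 / sqrt (2 * pi)) * ennreal (sqrt (2 * pi) * gamma_const (real (card V))) * (\<integral>\<^sup>+u. g u \<partial>lborel)"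
    by (simp add: nn_integral_multc nn_integral_cmult LI)
  also have "ennreal (1 / sqrt (2 * pi)) * ennreal (sqrt (2 * pi) * gamma_const (real (card V))) = ennreal (gamma_const (real (card V)))"
    by (simp add: ennreal_mult'[symmetric])
  finally show ?thesis unfolding N_def .
qed

section \<open>The integral of the characteristic function\<close>

lemma integrable_add_star:
  fixes f :: "_ \<Rightarrow> 'c::{banach, second_countable_topology}"
  assumes U: "finite U" "v \<notin> U" and f: "integrable (gauss (edges (insert v U))) f"
  shows "integrable (gauss (edges U) \<Otimes>\<^sub>M gauss U) (\<lambda>z. f (add_star v U (fst z) (snd z)))"
  unfolding add_star_def
  by (rule integral_assemble(1)[OF _ bij_star_code[OF U(2)] f]) (simp add: U finite_edges)

lemma haf_add_star_bhaf:
  assumes V: "finite V" "v \<notin> V"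
  shows "haf (insert v V) (add_star v V x a) = bhaf V a x"
  unfolding haf_add_star[OF V(1) order_refl V(2)] bhaf_def by (rule refl)

text \<open>The row of \<open>v\<close> is the border of the hafnian of \<open>V\<close>. Integrating this row last gives the first
  identity, integrating it first gives the second one.\<close>

lemma haf_char_border:
  assumes V: "finite V" "v \<notin> V"
  shows "haf_char (insert v V) u = (\<integral>\<rho>. border_char V \<rho> u \<partial>gauss V)"
    and "haf_char (insert v V) u =
      complex_of_real (\<integral>x. exp (- (\<Sum>l\<in>V. (u * haf (V - {l}) x)\<^sup>2) / 2) \<partial>gauss (edges V))"
proof -
  interpret pair_sigma_finite "gauss (edges V)" "gauss V" by (rule pair_sigma_finite_gauss)
  have int: "integrable (gauss (edges (insert v V))) (\<lambda>x. iexp (u * haf (insert v V) x))"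
    by (intro integrable_iexp_gauss borel_measurable_times borel_measurable_const measurable_haf order_refl)
  have 1: "haf_char (insert v V) u = (\<integral>x. \<integral>a. iexp (u * bhaf V a x) \<partial>gauss V \<partial>gauss (edges V))"
    unfolding haf_char_def integral_add_star[OF V int] haf_add_star_bhaf[OF V] by (rule refl)
  have int2: "integrable (gauss (edges V) \<Otimes>\<^sub>M gauss V) (\<lambda>(x, a). iexp (u * bhaf V a x))"
    using integrable_add_star[OF V int] by (simp add: haf_add_star_bhaf[OF V] split_def)
  show "haf_char (insert v V) u = (\<integral>\<rho>. border_char V \<rho> u \<partial>gauss V)"
    unfolding 1 border_char_def using Fubini_integral[OF int2] by simp
  have "(\<integral>a. iexp (u * bhaf V a x) \<partial>gauss V) =
      complex_of_real (exp (- (\<Sum>l\<in>V. (u * haf (V - {l}) x)\<^sup>2) / 2))" for x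
  proof -
    have "u * bhaf V a x = (\<Sum>l\<in>V. (u * haf (V - {l}) x) * a l)" for a
      by (simp add: bhaf_def sum_distrib_left mult_ac)
    then show ?thesis by (simp only: gauss_iexp_linear[OF V(1)])
  qed
  then show "haf_char (insert v V) u =
      complex_of_real (\<integral>x. exp (- (\<Sum>l\<in>V. (u * haf (V - {l}) x)\<^sup>2) / 2) \<partial>gauss (edges V))"
    unfolding 1 by (simp only: integral_complex_of_real)
qed

lemma measurable_haf_char [measurable]: "haf_char U \<in> borel_measurable borel"
proof -
  interpret sigma_finite_measure "gauss (edges U)" by (rule sigma_finite_gauss)
  have "haf U \<in> borel_measurable (gauss (edges U))" by (intro measurable_haf order_refl)
  then have [measurable]: "(\<lambda>z. haf U (snd z)) \<in> borel_measurable (borel \<Otimes>\<^sub>M gauss (edges U))"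
    by (rule measurable_compose[OF measurable_snd])
  have "(\<lambda>z. iexp (fst z * haf U (snd z))) \<in> borel_measurable (borel \<Otimes>\<^sub>M gauss (edges U))" by measurable
  then have "(\<lambda>(u, x). iexp (u * haf U x)) \<in> borel_measurable (borel \<Otimes>\<^sub>M gauss (edges U))"
    by (simp add: split_def)
  from borel_measurable_lebesgue_integral[OF this] show ?thesis
    unfolding haf_char_def by simp
qed

lemma norm_haf_char_le:
  assumes V: "finite V" "v \<notin> V" and w: "w \<in> V"
  shows "ennreal (norm (haf_char (insert v V) u)) \<le>
    (\<integral>\<^sup>+\<rho>. ennreal (norm (haf_char (V - {w}) (u * sqrt (\<Sum>q\<in>V. (\<rho> q)\<^sup>2)))) \<partial>gauss V)"
proof -
  interpret prob_space "gauss V" by (rule prob_space_gauss)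
  have m: "(\<lambda>\<rho>. norm (haf_char (V - {w}) (u * sqrt (\<Sum>q\<in>V. (\<rho> q)\<^sup>2)))) \<in> borel_measurable (gauss V)"
    by measurable
  have b: "norm (haf_char (V - {w}) t) \<le> 1" for t
  proof -
    interpret E: prob_space "gauss (edges (V - {w}))" by (rule prob_space_gauss)
    have "norm (haf_char (V - {w}) t) \<le> (\<integral>x. norm (iexp (t * haf (V - {w}) x)) \<partial>gauss (edges (V - {w})))"
      unfolding haf_char_def by (rule integral_norm_bound)
    then show ?thesis by (simp add: E.prob_space)
  qed
  have i: "integrable (gauss V) (\<lambda>\<rho>. norm (haf_char (V - {w}) (u * sqrt (\<Sum>q\<in>V. (\<rho> q)\<^sup>2))))"
    using b by (intro integrable_gauss_bounded[OF m, of 1]) auto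
  have "norm (haf_char (insert v V) u) \<le> (\<integral>\<rho>. norm (border_char V \<rho> u) \<partial>gauss V)"
    unfolding haf_char_border(1)[OF V] by (rule integral_norm_bound)
  also have "\<dots> \<le> (\<integral>\<rho>. norm (haf_char (V - {w}) (u * sqrt (\<Sum>q\<in>V. (\<rho> q)\<^sup>2))) \<partial>gauss V)"
  proof (rule Bochner_Integration.integral_mono')
    show "integrable (gauss V) (\<lambda>\<rho>. norm (haf_char (V - {w}) (u * sqrt (\<Sum>q\<in>V. (\<rho> q)\<^sup>2))))" by (rule i)
  qed (auto intro: norm_border_char_le_haf_char[OF V(1) w])
  finally have "ennreal (norm (haf_char (insert v V) u)) \<le>
      ennreal (\<integral>\<rho>. norm (haf_char (V - {w}) (u * sqrt (\<Sum>q\<in>V. (\<rho> q)\<^sup>2))) \<partial>gauss V)"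
    by (rule ennreal_leI)
  also have "\<dots> = (\<integral>\<^sup>+\<rho>. ennreal (norm (haf_char (V - {w}) (u * sqrt (\<Sum>q\<in>V. (\<rho> q)\<^sup>2)))) \<partial>gauss V)"
    by (rule nn_integral_eq_integral[symmetric, OF i]) auto
  finally show ?thesis .
qed

lemma nn_integral_haf_char_step:
  assumes V: "finite V" "v \<notin> V" and w: "w \<in> V" and card: "card V \<ge> 2"
  shows "(\<integral>\<^sup>+u. ennreal (norm (haf_char (insert v V) u)) \<partial>lborel) \<le>
    ennreal (gamma_const (real (card V))) * (\<integral>\<^sup>+u. ennreal (norm (haf_char (V - {w}) u)) \<partial>lborel)"
proof -
  interpret pair_sigma_finite "gauss V" lborel
    by (intro pair_sigma_finite.intro sigma_finite_gauss lborel.sigma_finite_measure_axioms)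
  have "(\<integral>\<^sup>+u. ennreal (norm (haf_char (insert v V) u)) \<partial>lborel) \<le>
      (\<integral>\<^sup>+u. \<integral>\<^sup>+\<rho>. ennreal (norm (haf_char (V - {w}) (u * sqrt (\<Sum>q\<in>V. (\<rho> q)\<^sup>2)))) \<partial>gauss V \<partial>lborel)"
    by (intro nn_integral_mono norm_haf_char_le V w)
  also have "\<dots> = (\<integral>\<^sup>+\<rho>. \<integral>\<^sup>+u. ennreal (norm (haf_char (V - {w}) (u * sqrt (\<Sum>q\<in>V. (\<rho> q)\<^sup>2)))) \<partial>lborel \<partial>gauss V)"
    by (rule Fubini') measurable
  also have "\<dots> = ennreal (gamma_const (real (card V))) * (\<integral>\<^sup>+u. ennreal (norm (haf_char (V - {w}) u)) \<partial>lborel)"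
    by (rule nn_integral_gauss_norm_scaling[OF V(1) card, of "\<lambda>t. ennreal (norm (haf_char (V - {w}) t))"]) measurable
  finally show ?thesis .
qed

text \<open>The induction removes two vertices at a time; for two vertices the characteristic function is that
  of a standard normal variable.\<close>

lemma nn_integral_haf_char_le:
  assumes "n \<ge> 1" "finite U" "card U = 2 * n"
  shows "(\<integral>\<^sup>+u. ennreal (norm (haf_char U u)) \<partial>lborel) \<le>
    ennreal (sqrt (2 * pi) * (\<Prod>r=2..n. gamma_const (2 * real r - 1)))"
  using assms
proof (induction n arbitrary: U rule: dec_induct)
  case base
  then obtain v w where U: "U = {v, w}" "v \<noteq> w" by (auto simp: card_2_iff)
  then have V: "U = insert v {w}" "finite {w}" "v \<notin> {w}" by auto
  interpret prob_space "gauss (edges {w})" by (rule prob_space_gauss)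
  have "haf_char U u = complex_of_real (exp (- (u * 1)\<^sup>2 / 2))" for u
    unfolding V(1) haf_char_border(2)[OF V(2,3)] by (simp add: prob_space)
  then have "norm (haf_char U u) = exp (- (u * 1)\<^sup>2 / 2)" for u by simp
  then show ?case by (simp only: nn_integral_gaussian[OF zero_less_one]) simp
next
  case (step n)
  then have "U \<noteq> {}" by auto
  then obtain v where v: "v \<in> U" by auto
  define V where "V = U - {v}"
  have V: "finite V" "v \<notin> V" "U = insert v V" "card V = 2 * n + 1"
    using v step.prems by (auto simp: V_def card_Diff_singleton)
  then have "V \<noteq> {}" by auto
  then obtain w where w: "w \<in> V" by auto
  have W: "finite (V - {w})" "card (V - {w}) = 2 * n" using V w by (auto simp: card_Diff_singleton)
  have pos: "gamma_const (2 * real r - 1) > 0" if "r \<ge> 2" for r :: nat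
    using that by (intro gamma_const_pos) auto
  have "(\<integral>\<^sup>+u. ennreal (norm (haf_char U u)) \<partial>lborel) \<le>
      ennreal (gamma_const (real (card V))) * (\<integral>\<^sup>+u. ennreal (norm (haf_char (V - {w}) u)) \<partial>lborel)"
    unfolding V(3) using V step.hyps by (intro nn_integral_haf_char_step w) auto
  also have "\<dots> \<le> ennreal (gamma_const (real (card V))) * ennreal (sqrt (2 * pi) * (\<Prod>r=2..n. gamma_const (2 * real r - 1)))"
    by (intro mult_left_mono step.IH W) auto
  also have "real (card V) = 2 * real (Suc n) - 1" by (simp add: V)
  also have "ennreal (gamma_const (2 * real (Suc n) - 1)) * ennreal (sqrt (2 * pi) * (\<Prod>r=2..n. gamma_const (2 * real r - 1))) =
      ennreal (sqrt (2 * pi) * (\<Prod>r=2..Suc n. gamma_const (2 * real r - 1)))"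
    using step.hyps pos[of "Suc n"]
    by (subst ennreal_mult'[symmetric]) (auto simp: prod.nat_ivl_Suc' mult_ac)
  finally show ?case .
qed

section \<open>Second moment and density of the Gaussian hafnian\<close>

lemma nn_integral_haf_marginal:
  assumes V: "finite V" "l \<in> V" and f: "f \<in> borel_measurable borel"
  shows "(\<integral>\<^sup>+x. f (haf (V - {l}) x) \<partial>gauss (edges V)) =
    (\<integral>\<^sup>+x. f (haf (V - {l}) x) \<partial>gauss (edges (V - {l})))"
proof -
  define W where "W = V - {l}"
  have W: "finite W" "l \<notin> W" "V = insert l W" using V by (auto simp: W_def)
  interpret prob_space "gauss W" by (rule prob_space_gauss)
  have "haf W \<in> borel_measurable (gauss (edges (insert l W)))" by (intro measurable_haf) blast
  then have "(\<lambda>x. f (haf W x)) \<in> borel_measurable (gauss (edges (insert l W)))"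
    by (rule measurable_compose[OF _ f])
  from nn_integral_add_star[OF W(1,2) this]
  have "(\<integral>\<^sup>+x. f (haf W x) \<partial>gauss (edges (insert l W))) = (\<integral>\<^sup>+x. f (haf W x) \<partial>gauss (edges W))"
    by (simp add: haf_add_star_old[OF order_refl W(2)] emeasure_space_1)
  then show ?thesis unfolding W(3)[symmetric] by (simp only: W_def)
qed

text \<open>Conditionally on the other edges, the second moment is the sum of the squares of \<open>card V\<close>
  hafnians with two vertices fewer.\<close>

lemma nn_integral_haf_square:
  assumes "finite U" "card U = 2 * n"
  shows "(\<integral>\<^sup>+x. ennreal ((haf U x)\<^sup>2) \<partial>gauss (edges U)) = ennreal (real (double_fact (2 * n - 1)))"
  using assms
proof (induction n arbitrary: U)
  case 0
  then have "U = {}" by simp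
  interpret prob_space "gauss (edges {} :: 'a set set)"
    by (rule prob_space_gauss)
  show ?case unfolding \<open>U = {}\<close> by (simp add: emeasure_space_1)
next
  case (Suc n)
  then have "U \<noteq> {}" by auto
  then obtain v where v: "v \<in> U" by auto
  define V where "V = U - {v}"
  have V: "finite V" "v \<notin> V" "U = insert v V" "card V = 2 * n + 1"
    using v Suc.prems by (auto simp: V_def card_Diff_singleton)
  have "(\<lambda>x. ennreal ((haf U x)\<^sup>2)) \<in> borel_measurable (gauss (edges U))"
    using measurable_haf[OF order_refl, of U] by measurable
  then have "(\<integral>\<^sup>+x. ennreal ((haf U x)\<^sup>2) \<partial>gauss (edges U)) =
      (\<integral>\<^sup>+x. \<integral>\<^sup>+a. ennreal ((haf (insert v V) (add_star v V x a))\<^sup>2) \<partial>gauss V \<partial>gauss (edges V))"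
    unfolding V(3) by (rule nn_integral_add_star[OF V(1,2)])
  also have "\<dots> = (\<integral>\<^sup>+x. ennreal (\<Sum>l\<in>V. (haf (V - {l}) x)\<^sup>2) \<partial>gauss (edges V))"
  proof (intro nn_integral_cong)
    fix x
    have "(\<integral>\<^sup>+a. ennreal ((haf (insert v V) (add_star v V x a))\<^sup>2) \<partial>gauss V) =
        (\<integral>\<^sup>+a. ennreal ((\<Sum>l\<in>V. haf (V - {l}) x * a l) ^ (2 * 1)) \<partial>gauss V)"
      by (simp add: haf_add_star[OF V(1) order_refl V(2)] mult.commute)
    also have "\<dots> = ennreal (\<Sum>l\<in>V. (haf (V - {l}) x)\<^sup>2)"
      unfolding nn_integral_gauss_linear_moment[OF V(1)] by simp
    finally show "(\<integral>\<^sup>+a. ennreal ((haf (insert v V) (add_star v V x a))\<^sup>2) \<partial>gauss V) =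
        ennreal (\<Sum>l\<in>V. (haf (V - {l}) x)\<^sup>2)" .
  qed
  also have "\<dots> = (\<integral>\<^sup>+x. (\<Sum>l\<in>V. ennreal ((haf (V - {l}) x)\<^sup>2)) \<partial>gauss (edges V))"
    by (simp add: sum_ennreal)
  also have "\<dots> = (\<Sum>l\<in>V. \<integral>\<^sup>+x. ennreal ((haf (V - {l}) x)\<^sup>2) \<partial>gauss (edges V))"
  proof (rule nn_integral_sum)
    fix l
    have "haf (V - {l}) \<in> borel_measurable (gauss (edges V))" by (intro measurable_haf) blast
    then show "(\<lambda>x. ennreal ((haf (V - {l}) x)\<^sup>2)) \<in> borel_measurable (gauss (edges V))" by measurable
  qed
  also have "\<dots> = (\<Sum>l\<in>V. ennreal (real (double_fact (2 * n - 1))))"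
  proof (intro sum.cong refl)
    fix l assume l: "l \<in> V"
    have "(\<integral>\<^sup>+x. ennreal ((haf (V - {l}) x)\<^sup>2) \<partial>gauss (edges V)) =
        (\<integral>\<^sup>+x. ennreal ((haf (V - {l}) x)\<^sup>2) \<partial>gauss (edges (V - {l})))"
      by (rule nn_integral_haf_marginal[OF V(1) l, of "\<lambda>t. ennreal (t\<^sup>2)"]) measurable
    also have "\<dots> = ennreal (real (double_fact (2 * n - 1)))"
      using V l by (intro Suc.IH) (auto simp: card_Diff_singleton)
    finally show "(\<integral>\<^sup>+x. ennreal ((haf (V - {l}) x)\<^sup>2) \<partial>gauss (edges V)) = ennreal (real (double_fact (2 * n - 1)))" .
  qed
  also have "\<dots> = ennreal (real (card V) * real (double_fact (2 * n - 1)))"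
    by (simp add: ennreal_mult' ennreal_of_nat_eq_real_of_nat)
  also have "real (card V) * real (double_fact (2 * n - 1)) = real (double_fact (2 * Suc n - 1))"
    unfolding V(4) by (cases n) (auto simp: algebra_simps)
  finally show ?case .
qed

text \<open>The passage from abstract families of random variables to the canonical product measure.\<close>

lemma distr_std_gaussian_family:
  assumes Z: "std_gaussian_family P I Z" and J: "finite J" and h: "inj_on h J" "h ` J \<subseteq> I"
  shows "(\<lambda>\<omega>. \<lambda>j\<in>J. Z (h j) \<omega>) \<in> P \<rightarrow>\<^sub>M gauss J"
    and "distr P (gauss J) (\<lambda>\<omega>. \<lambda>j\<in>J. Z (h j) \<omega>) = gauss J"
proof -
  interpret P: prob_space P using Z by (simp add: std_gaussian_family_def)
  have ind: "P.indep_vars (\<lambda>_. borel) Z I"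
    and dis: "\<And>i. i \<in> I \<Longrightarrow> distributed P lborel (Z i) std_normal_density"
    using Z by (auto simp: std_gaussian_family_def)
  have Zm: "Z i \<in> borel_measurable P" if "i \<in> I" for i
    using distributed_measurable[OF dis[OF that]] by simp
  have dZ: "distr P borel (Z i) = std_normal" if "i \<in> I" for i
  proof -
    have "distr P lborel (Z i) = std_normal" using distributed_distr_eq_density[OF dis[OF that]] .
    moreover have "distr P lborel (Z i) = distr P borel (Z i)" by (rule distr_cong) auto
    ultimately show ?thesis by simp
  qed
  have T: "(\<lambda>\<omega>. \<lambda>j\<in>J. Z (h j) \<omega>) \<in> P \<rightarrow>\<^sub>M Pi\<^sub>M J (\<lambda>_. borel)"
    using Zm h by (intro measurable_restrict) auto
  then show T': "(\<lambda>\<omega>. \<lambda>j\<in>J. Z (h j) \<omega>) \<in> P \<rightarrow>\<^sub>M gauss J"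
    by (simp cong: measurable_cong_sets add: sets_gauss)
  show "distr P (gauss J) (\<lambda>\<omega>. \<lambda>j\<in>J. Z (h j) \<omega>) = gauss J"
  proof (rule gauss_eqI[OF J])
    show "prob_space (distr P (gauss J) (\<lambda>\<omega>. \<lambda>j\<in>J. Z (h j) \<omega>))" by (rule P.prob_space_distr[OF T'])
    show "sets (distr P (gauss J) (\<lambda>\<omega>. \<lambda>j\<in>J. Z (h j) \<omega>)) = sets (Pi\<^sub>M J (\<lambda>_. borel))" by (simp add: sets_gauss)
    fix A assume A: "\<And>j. j \<in> J \<Longrightarrow> A j \<in> sets (borel :: real measure)"
    let ?g = "the_inv_into J h"
    have g: "?g (h j) = j" if "j \<in> J" for j using that h by (simp add: the_inv_into_f_f)
    have "emeasure (distr P (gauss J) (\<lambda>\<omega>. \<lambda>j\<in>J. Z (h j) \<omega>)) (Pi\<^sub>E J A) =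
        emeasure P ((\<lambda>\<omega>. \<lambda>j\<in>J. Z (h j) \<omega>) -` Pi\<^sub>E J A \<inter> space P)"
      using A J by (intro emeasure_distr[OF T']) (auto simp: sets_gauss intro!: sets_PiM_I_finite)
    also have "\<dots> = (\<Prod>j\<in>J. emeasure std_normal (A j))"
    proof (cases "J = {}")
      case True
      then show ?thesis by (simp add: P.emeasure_space_1 restrict_def vimage_def)
    next
      case False
      have "(\<lambda>\<omega>. \<lambda>j\<in>J. Z (h j) \<omega>) -` Pi\<^sub>E J A \<inter> space P = (\<Inter>i\<in>h ` J. Z i -` A (?g i) \<inter> space P)"
        using False g by (auto simp: PiE_iff)
      moreover have "P.prob (\<Inter>i\<in>h ` J. Z i -` A (?g i) \<inter> space P) = (\<Prod>i\<in>h ` J. P.prob (Z i -` A (?g i) \<inter> space P))"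
        using False J h A g by (intro P.indep_varsD[OF ind]) auto
      moreover have "\<dots> = (\<Prod>j\<in>J. P.prob (Z (h j) -` A j \<inter> space P))"
        using h g by (subst prod.reindex) auto
      moreover have "ennreal (P.prob (Z (h j) -` A j \<inter> space P)) = emeasure std_normal (A j)" if "j \<in> J" for j
      proof -
        have i: "h j \<in> I" using that h by auto
        have "emeasure std_normal (A j) = emeasure (distr P borel (Z (h j))) (A j)" by (simp only: dZ[OF i])
        also have "\<dots> = emeasure P (Z (h j) -` A j \<inter> space P)"
          using A[OF that] Zm[OF i] by (intro emeasure_distr) auto
        finally show ?thesis by (simp add: P.emeasure_eq_measure)
      qed
      ultimately show ?thesis
        by (simp add: P.emeasure_eq_measure prod_ennreal[symmetric])
    qed
    finally show "emeasure (distr P (gauss J) (\<lambda>\<omega>. \<lambda>j\<in>J. Z (h j) \<omega>)) (Pi\<^sub>E J A) = (\<Prod>j\<in>J. emeasure std_normal (A j))" .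
  qed
qed

lemma hafnian_eq_haf: "hafnian n S = haf {1..2 * n} (\<lambda>e\<in>edges {1..2 * n}. S (Min e) (Max e))"
  unfolding hafnian_def haf_def
proof (intro sum.cong prod.cong refl)
  fix m e assume "m \<in> perfect_matchings {1..2 * n}" "e \<in> m"
  then have "e \<in> edges {1..2 * n}" using perfect_matching_subset by blast
  then show "S (Min e) (Max e) = (\<lambda>e\<in>edges {1..2 * n}. S (Min e) (Max e)) e" by simp
qed

lemma edge_Min_Max:
  fixes e :: "nat set"
  assumes "e \<in> edges U"
  shows "Min e < Max e" "e = {Min e, Max e}" "Min e \<in> U" "Max e \<in> U"
proof -
  obtain a b where ab: "e = {a, b}" "a < b"
    using assms by (auto simp: edges_def card_2_iff neq_iff insert_commute)
  then have "Min e = a" "Max e = b" by auto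
  then show "Min e < Max e" "e = {Min e, Max e}" "Min e \<in> U" "Max e \<in> U"
    using ab assms by (auto simp: edges_def)
qed

lemma distr_sym_gaussian_matrix:
  assumes S: "sym_gaussian_matrix P m S"
  shows "(\<lambda>\<omega>. \<lambda>e\<in>edges {1..m}. S \<omega> (Min e) (Max e)) \<in> P \<rightarrow>\<^sub>M gauss (edges {1..m})"
    and "distr P (gauss (edges {1..m})) (\<lambda>\<omega>. \<lambda>e\<in>edges {1..m}. S \<omega> (Min e) (Max e)) = gauss (edges {1..m})"
proof -
  let ?h = "\<lambda>e::nat set. (Min e, Max e)"
  have Z: "std_gaussian_family P {(i, j). 1 \<le> i \<and> i < j \<and> j \<le> m} (\<lambda>(i, j) \<omega>. S \<omega> i j)"
    using S by (simp add: sym_gaussian_matrix_def)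
  have fin: "finite (edges {1..m})" by (simp add: finite_edges)
  have inj: "inj_on ?h (edges {1..m})"
    by (rule inj_onI) (metis edge_Min_Max(2) prod.inject)
  have img: "?h ` edges {1..m} \<subseteq> {(i, j). 1 \<le> i \<and> i < j \<and> j \<le> m}"
    using edge_Min_Max(1,3,4)[of _ "{1..m}"] by auto
  show "(\<lambda>\<omega>. \<lambda>e\<in>edges {1..m}. S \<omega> (Min e) (Max e)) \<in> P \<rightarrow>\<^sub>M gauss (edges {1..m})"
    using distr_std_gaussian_family(1)[OF Z fin inj img] by simp
  show "distr P (gauss (edges {1..m})) (\<lambda>\<omega>. \<lambda>e\<in>edges {1..m}. S \<omega> (Min e) (Max e)) = gauss (edges {1..m})"
    using distr_std_gaussian_family(2)[OF Z fin inj img] by simp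
qed

lemma distr_hafnian:
  assumes S: "sym_gaussian_matrix P (2 * n) S"
  shows "(\<lambda>\<omega>. hafnian n (S \<omega>)) \<in> borel_measurable P"
    and "distr P borel (\<lambda>\<omega>. hafnian n (S \<omega>)) = distr (gauss (edges {1..2 * n})) borel (haf {1..2 * n})"
proof -
  note T = distr_sym_gaussian_matrix[OF S]
  have m: "haf {1..2 * n} \<in> borel_measurable (gauss (edges {1..2 * n}))" by (intro measurable_haf order_refl)
  show "(\<lambda>\<omega>. hafnian n (S \<omega>)) \<in> borel_measurable P"
    unfolding hafnian_eq_haf by (rule measurable_compose[OF T(1) m])
  show "distr P borel (\<lambda>\<omega>. hafnian n (S \<omega>)) = distr (gauss (edges {1..2 * n})) borel (haf {1..2 * n})"
    unfolding hafnian_eq_haf using distr_distr[OF m T(1)] by (simp only: T(2) comp_def)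
qed

text \<open>The value at \<open>s = 0\<close>, where there is no density, is set to zero; this keeps all bounds valid and
  concerns a null event only.\<close>

definition mixed_normal :: "real \<Rightarrow> real \<Rightarrow> real" where
  "mixed_normal s y = (if s = 0 then 0 else normal_density 0 s y)"

lemma measurable_mixed_normal [measurable]:
  "(\<lambda>z. mixed_normal (fst z) (snd z)) \<in> borel_measurable (borel \<Otimes>\<^sub>M borel)"
  unfolding mixed_normal_def normal_density_def by measurable

lemma mixed_normal_nonneg: "mixed_normal s y \<ge> 0"
  by (simp add: mixed_normal_def)

lemma mixed_normal_zero: "s \<ge> 0 \<Longrightarrow> mixed_normal s 0 = 1 / sqrt (2 * pi) * (1 / s)"
  by (simp add: mixed_normal_def normal_density_def real_sqrt_mult)

lemma mixed_normal_le: "s \<ge> 0 \<Longrightarrow> mixed_normal s y \<le> mixed_normal s 0"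
  by (simp add: mixed_normal_def normal_density_def divide_right_mono)

lemma mixed_normal_even: "mixed_normal s (- y) = mixed_normal s y"
  by (simp add: mixed_normal_def normal_density_def)

lemma continuous_mixed_normal: "continuous_on UNIV (mixed_normal s)"
proof (cases "s = 0")
  case True
  then have "mixed_normal s = (\<lambda>_. 0)" by (simp add: mixed_normal_def fun_eq_iff)
  then show ?thesis by simp
next
  case False
  then have "mixed_normal s = (\<lambda>y. 1 / sqrt (2 * pi * s\<^sup>2) * exp (- (y - 0)\<^sup>2 / (2 * s\<^sup>2)))"
    by (simp add: mixed_normal_def normal_density_def fun_eq_iff)
  then show ?thesis using False by (auto intro!: continuous_intros)
qed

lemma nn_integral_std_normal_scale:
  assumes s: "s > 0" and g: "g \<in> borel_measurable borel"
  shows "(\<integral>\<^sup>+z. g (s * z) \<partial>std_normal) = (\<integral>\<^sup>+y. ennreal (mixed_normal s y) * g y \<partial>lborel)"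
proof -
  have "(\<integral>\<^sup>+z. g (s * z) \<partial>std_normal) = (\<integral>\<^sup>+z. ennreal (std_normal_density z) * g (s * z) \<partial>lborel)"
    by (rule nn_integral_std_normal) (rule measurable_compose[OF _ g], simp)
  also have "\<dots> = ennreal \<bar>1 / s\<bar> * (\<integral>\<^sup>+y. ennreal (std_normal_density (0 + 1 / s * y)) * g (s * (0 + 1 / s * y)) \<partial>lborel)"
    using s g by (subst nn_integral_real_affine[where c = "1 / s" and t = 0]) auto
  also have "\<dots> = (\<integral>\<^sup>+y. ennreal (1 / s) * (ennreal (std_normal_density (y / s)) * g y) \<partial>lborel)"
    using s g by (subst nn_integral_cmult[symmetric]) auto
  also have "\<dots> = (\<integral>\<^sup>+y. ennreal (mixed_normal s y) * g y \<partial>lborel)"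
  proof (intro nn_integral_cong)
    fix y
    have "1 / s * std_normal_density (y / s) = mixed_normal s y"
      using s by (simp add: mixed_normal_def normal_density_def power_divide real_sqrt_mult mult_ac)
    then have "ennreal (1 / s) * ennreal (std_normal_density (y / s)) = ennreal (mixed_normal s y)"
      using s by (simp add: ennreal_mult'[symmetric])
    then show "ennreal (1 / s) * (ennreal (std_normal_density (y / s)) * g y) = ennreal (mixed_normal s y) * g y"
      by (simp add: mult.assoc[symmetric])
  qed
  finally show ?thesis .
qed

text \<open>For a centred normal variable with random standard deviation \<open>s\<close>, the conditional density is at
  most a multiple of \<open>1 / s\<close>, with equality at zero. Integrability of \<open>1 / s\<close> therefore gives the
  bound at zero, and continuity by dominated convergence.\<close>

lemma mixture_density:
  assumes M: "prob_space M" and s [measurable]: "s \<in> borel_measurable M" and s0: "\<And>x. s x \<ge> 0"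
    and pos: "AE x in M. s x \<noteq> 0" and bd: "(\<integral>\<^sup>+x. ennreal (1 / s x) \<partial>M) \<le> ennreal K" and K: "K \<ge> 0"
  defines "f \<equiv> \<lambda>y. \<integral>x. mixed_normal (s x) y \<partial>M"
  shows "f y \<ge> 0" "f (- y) = f y" "f y \<le> f 0" "continuous_on UNIV f" "f 0 \<le> K / sqrt (2 * pi)"
    and "g \<in> borel_measurable borel \<Longrightarrow>
      (\<integral>\<^sup>+x. \<integral>\<^sup>+z. g (s x * z) \<partial>std_normal \<partial>M) = (\<integral>\<^sup>+y. ennreal (f y) * g y \<partial>lborel)"
proof -
  interpret M: prob_space M by fact
  have int1: "integrable M (\<lambda>x. 1 / s x)"
    using bd s0 by (intro integrableI_nonneg) (auto intro: le_less_trans)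
  then have int0: "integrable M (\<lambda>x. mixed_normal (s x) 0)"
    unfolding mixed_normal_zero[OF s0] by (rule integrable_mult_right)
  have m: "(\<lambda>x. mixed_normal (s x) y) \<in> borel_measurable M" for y
    using measurable_compose[OF _ measurable_mixed_normal, of "\<lambda>x. (s x, y)" M] by simp
  have int: "integrable M (\<lambda>x. mixed_normal (s x) y)" for y
    by (rule Bochner_Integration.integrable_bound[OF int0 m]) (simp add: mixed_normal_nonneg mixed_normal_le[OF s0])
  show "f y \<ge> 0" for y unfolding f_def by (intro Bochner_Integration.integral_nonneg mixed_normal_nonneg)
  show "f (- y) = f y" for y unfolding f_def by (simp add: mixed_normal_even)
  show "f y \<le> f 0" for y unfolding f_def by (intro integral_mono int mixed_normal_le s0)
  show "f 0 \<le> K / sqrt (2 * pi)"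
  proof -
    have e: "ennreal (\<integral>x. 1 / s x \<partial>M) = (\<integral>\<^sup>+x. ennreal (1 / s x) \<partial>M)"
      by (rule nn_integral_eq_integral[symmetric, OF int1]) (simp add: s0)
    have "ennreal (\<integral>x. 1 / s x \<partial>M) \<le> ennreal K" unfolding e by (rule bd)
    then have "(\<integral>x. 1 / s x \<partial>M) \<le> K" by (simp only: ennreal_le_iff[OF K])
    then have "1 / sqrt (2 * pi) * (\<integral>x. 1 / s x \<partial>M) \<le> 1 / sqrt (2 * pi) * K"
      by (intro mult_left_mono) auto
    moreover have "f 0 = 1 / sqrt (2 * pi) * (\<integral>x. 1 / s x \<partial>M)"
      unfolding f_def mixed_normal_zero[OF s0] by (rule integral_mult_right_zero)
    ultimately show ?thesis by simp
  qed
  show cont: "continuous_on UNIV f"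
  proof (rule continuous_at_imp_continuous_on, rule ballI)
    fix y
    show "isCont f y"
      unfolding continuous_at_sequentially
    proof (intro allI impI)
      fix Y :: "nat \<Rightarrow> real" assume Y: "Y \<longlonglongrightarrow> y"
      show "(f \<circ> Y) \<longlonglongrightarrow> f y"
        unfolding f_def comp_def
      proof (rule integral_dominated_convergence[where w = "\<lambda>x. mixed_normal (s x) 0"])
        show "AE x in M. (\<lambda>i. mixed_normal (s x) (Y i)) \<longlonglongrightarrow> mixed_normal (s x) y"
        proof (rule AE_I2)
          fix x
          have "isCont (mixed_normal (s x)) y"
            using continuous_mixed_normal[of "s x"] by (simp add: continuous_on_eq_continuous_at)
          then show "(\<lambda>i. mixed_normal (s x) (Y i)) \<longlonglongrightarrow> mixed_normal (s x) y"
            by (rule isCont_tendsto_compose[OF _ Y])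
        qed
      qed (auto simp: m int0 mixed_normal_nonneg mixed_normal_le[OF s0])
    qed
  qed
  assume g [measurable]: "g \<in> borel_measurable borel"
  interpret pair_sigma_finite M lborel
    by (intro pair_sigma_finite.intro M.sigma_finite_measure_axioms lborel.sigma_finite_measure_axioms)
  have mm: "(\<lambda>(x, y). ennreal (mixed_normal (s x) y) * g y) \<in> borel_measurable (M \<Otimes>\<^sub>M lborel)"
  proof -
    have "(\<lambda>z. (s (fst z), snd z)) \<in> M \<Otimes>\<^sub>M lborel \<rightarrow>\<^sub>M borel \<Otimes>\<^sub>M borel" by measurable
    from measurable_compose[OF this measurable_mixed_normal]
    have [measurable]: "(\<lambda>z. mixed_normal (s (fst z)) (snd z)) \<in> borel_measurable (M \<Otimes>\<^sub>M lborel)" by simp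
    have "(\<lambda>z. ennreal (mixed_normal (s (fst z)) (snd z)) * g (snd z)) \<in> borel_measurable (M \<Otimes>\<^sub>M lborel)"
      by measurable
    then show ?thesis by (simp add: split_def)
  qed
  have "(\<integral>\<^sup>+x. \<integral>\<^sup>+z. g (s x * z) \<partial>std_normal \<partial>M) = (\<integral>\<^sup>+x. \<integral>\<^sup>+y. ennreal (mixed_normal (s x) y) * g y \<partial>lborel \<partial>M)"
  proof (rule nn_integral_cong_AE)
    show "AE x in M. (\<integral>\<^sup>+z. g (s x * z) \<partial>std_normal) = (\<integral>\<^sup>+y. ennreal (mixed_normal (s x) y) * g y \<partial>lborel)"
      using pos
    proof eventually_elim
      case (elim x)
      then show ?case using s0[of x] by (intro nn_integral_std_normal_scale g) auto
    qed
  qed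
  also have "\<dots> = (\<integral>\<^sup>+y. \<integral>\<^sup>+x. ennreal (mixed_normal (s x) y) * g y \<partial>M \<partial>lborel)"
    by (rule Fubini'[symmetric, OF mm])
  also have "\<dots> = (\<integral>\<^sup>+y. ennreal (f y) * g y \<partial>lborel)"
  proof (intro nn_integral_cong)
    fix y
    have "(\<integral>\<^sup>+x. ennreal (mixed_normal (s x) y) * g y \<partial>M) = (\<integral>\<^sup>+x. ennreal (mixed_normal (s x) y) \<partial>M) * g y"
      using m by (intro nn_integral_multc) measurable
    also have "(\<integral>\<^sup>+x. ennreal (mixed_normal (s x) y) \<partial>M) = ennreal (f y)"
      unfolding f_def by (intro nn_integral_eq_integral int) (simp add: mixed_normal_nonneg)
    finally show "(\<integral>\<^sup>+x. ennreal (mixed_normal (s x) y) * g y \<partial>M) = ennreal (f y) * g y" .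
  qed
  finally show "(\<integral>\<^sup>+x. \<integral>\<^sup>+z. g (s x * z) \<partial>std_normal \<partial>M) = (\<integral>\<^sup>+y. ennreal (f y) * g y \<partial>lborel)" .
qed

text \<open>Conditionally on the edges that avoid \<open>v\<close>, the hafnian is normal with standard deviation \<open>t\<close>. The
  mean of \<open>1 / t\<close> is the integral of the characteristic function up to the factor \<open>sqrt (2 \<pi>)\<close>, and its
  finiteness excludes \<open>t = 0\<close>.\<close>

lemma haf_scaled_density:
  assumes n: "n \<ge> 1" and U: "finite U" "card U = 2 * n" and \<sigma>: "\<sigma> > 0"
  obtains f where "\<And>y. f y \<ge> 0" "\<And>y. f (- y) = f y" "\<And>y. f y \<le> f 0" "continuous_on UNIV f"
    "f 0 \<le> \<sigma> * (\<Prod>r=2..n. gamma_const (2 * real r - 1)) / sqrt (2 * pi)"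
    "distr (gauss (edges U)) borel (\<lambda>x. haf U x / \<sigma>) = density lborel (\<lambda>y. ennreal (f y))"
proof -
  have "U \<noteq> {}" using U n by auto
  then obtain v where v: "v \<in> U" by auto
  define V where "V = U - {v}"
  have V: "finite V" "v \<notin> V" "U = insert v V" using v U by (auto simp: V_def)
  define M where "M = gauss (edges V)"
  define \<pi>\<gamma> where "\<pi>\<gamma> = (\<Prod>r=2..n. gamma_const (2 * real r - 1))"
  have \<pi>\<gamma>: "\<pi>\<gamma> > 0" unfolding \<pi>\<gamma>_def by (intro prod_pos ballI gamma_const_pos) auto
  interpret M: prob_space M unfolding M_def by (rule prob_space_gauss)
  interpret pair_sigma_finite M lborel
    by (intro pair_sigma_finite.intro M.sigma_finite_measure_axioms lborel.sigma_finite_measure_axioms)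
  have hm [measurable]: "haf (V - {l}) \<in> borel_measurable M" for l
    unfolding M_def by (intro measurable_haf) blast
  define t where "t x = sqrt (\<Sum>l\<in>V. (haf (V - {l}) x)\<^sup>2)" for x
  have tm [measurable]: "t \<in> borel_measurable M" unfolding t_def by measurable
  have t0: "t x \<ge> 0" for x unfolding t_def by (simp add: sum_nonneg)
  define L where "L x = (\<integral>\<^sup>+u. ennreal (exp (- (u * t x)\<^sup>2 / 2)) \<partial>lborel)" for x
  have Lm [measurable]: "L \<in> borel_measurable M" unfolding L_def by measurable
  have norm_char: "ennreal (norm (haf_char U u)) = (\<integral>\<^sup>+x. ennreal (exp (- (u * t x)\<^sup>2 / 2)) \<partial>M)" for u
  proof -
    have m: "(\<lambda>x. exp (- (u * t x)\<^sup>2 / 2)) \<in> borel_measurable M" by measurable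
    have i: "integrable M (\<lambda>x. exp (- (u * t x)\<^sup>2 / 2))"
      by (rule M.integrable_const_bound[where B = 1, OF _ m]) auto
    have "(\<Sum>l\<in>V. (u * haf (V - {l}) x)\<^sup>2) = (u * t x)\<^sup>2" for x
      by (simp add: t_def power_mult_distrib sum_nonneg sum_distrib_left)
    then have "haf_char U u = complex_of_real (\<integral>x. exp (- (u * t x)\<^sup>2 / 2) \<partial>M)"
      unfolding V(3) haf_char_border(2)[OF V(1,2)] M_def by (simp only:)
    moreover have "(\<integral>x. exp (- (u * t x)\<^sup>2 / 2) \<partial>M) \<ge> 0" by (intro Bochner_Integration.integral_nonneg) auto
    ultimately have "norm (haf_char U u) = (\<integral>x. exp (- (u * t x)\<^sup>2 / 2) \<partial>M)" by simp
    then show ?thesis using nn_integral_eq_integral[OF i] by simp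
  qed
  have "(\<integral>\<^sup>+x. L x \<partial>M) = (\<integral>\<^sup>+u. \<integral>\<^sup>+x. ennreal (exp (- (u * t x)\<^sup>2 / 2)) \<partial>M \<partial>lborel)"
    unfolding L_def by (rule Fubini'[symmetric]) measurable
  also have "\<dots> = (\<integral>\<^sup>+u. ennreal (norm (haf_char U u)) \<partial>lborel)" by (simp only: norm_char)
  also have "\<dots> \<le> ennreal (sqrt (2 * pi) * \<pi>\<gamma>)"
    unfolding \<pi>\<gamma>_def by (rule nn_integral_haf_char_le[OF n U])
  finally have LI: "(\<integral>\<^sup>+x. L x \<partial>M) \<le> ennreal (sqrt (2 * pi) * \<pi>\<gamma>)" .
  have "AE x in M. L x \<noteq> \<infinity>"
    using LI by (intro nn_integral_noteq_infinite Lm) (auto simp: top_unique)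
  then have pos: "AE x in M. t x \<noteq> 0"
  proof eventually_elim
    case (elim x)
    show ?case
    proof
      assume "t x = 0"
      then have "L x = \<infinity>" unfolding L_def by simp
      then show False using elim by simp
    qed
  qed
  have inv: "ennreal (1 / (t x / \<sigma>)) \<le> ennreal (\<sigma> / sqrt (2 * pi)) * L x" for x
  proof (cases "t x = 0")
    case False
    then have "t x > 0" using t0[of x] by simp
    then show ?thesis using \<sigma> unfolding L_def
      by (subst nn_integral_gaussian) (auto simp: ennreal_mult'[symmetric])
  qed auto
  have bd: "(\<integral>\<^sup>+x. ennreal (1 / (t x / \<sigma>)) \<partial>M) \<le> ennreal (\<sigma> * \<pi>\<gamma>)"
  proof -
    have "(\<integral>\<^sup>+x. ennreal (1 / (t x / \<sigma>)) \<partial>M) \<le> (\<integral>\<^sup>+x. ennreal (\<sigma> / sqrt (2 * pi)) * L x \<partial>M)"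
      by (intro nn_integral_mono inv)
    also have "\<dots> = ennreal (\<sigma> / sqrt (2 * pi)) * (\<integral>\<^sup>+x. L x \<partial>M)" by (rule nn_integral_cmult[OF Lm])
    also have "\<dots> \<le> ennreal (\<sigma> / sqrt (2 * pi)) * ennreal (sqrt (2 * pi) * \<pi>\<gamma>)" by (intro mult_left_mono LI) auto
    also have "\<dots> = ennreal (\<sigma> * \<pi>\<gamma>)" using \<sigma> by (simp add: ennreal_mult'[symmetric])
    finally show ?thesis .
  qed
  define s where "s x = t x / \<sigma>" for x
  define f where "f y = (\<integral>x. mixed_normal (s x) y \<partial>M)" for y
  have sm: "s \<in> borel_measurable M" unfolding s_def by measurable
  have s0: "s x \<ge> 0" for x using t0 \<sigma> by (simp add: s_def)
  have spos: "AE x in M. s x \<noteq> 0" using pos \<sigma> by (simp add: s_def)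
  note mix = mixture_density[OF M.prob_space_axioms sm s0 spos bd[folded s_def], folded f_def]
  have K: "\<sigma> * \<pi>\<gamma> \<ge> 0" using \<sigma> \<pi>\<gamma> by simp
  have "distr (gauss (edges U)) borel (\<lambda>x. haf U x / \<sigma>) = density lborel (\<lambda>y. ennreal (f y))"
  proof (rule measure_eqI)
    fix A assume "A \<in> sets (distr (gauss (edges U)) borel (\<lambda>x. haf U x / \<sigma>))"
    then have A [measurable]: "A \<in> sets borel" by simp
    have hU: "haf U \<in> borel_measurable (gauss (edges U))" by (intro measurable_haf order_refl)
    then have hU': "(\<lambda>x. haf U x / \<sigma>) \<in> borel_measurable (gauss (edges U))" by measurable
    have mI: "(\<lambda>x. indicator A (haf U x / \<sigma>) :: ennreal) \<in> borel_measurable (gauss (edges U))"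
      using hU' by measurable
    have "emeasure (distr (gauss (edges U)) borel (\<lambda>x. haf U x / \<sigma>)) A =
        (\<integral>\<^sup>+y. indicator A y \<partial>distr (gauss (edges U)) borel (\<lambda>x. haf U x / \<sigma>))" by simp
    also have "\<dots> = (\<integral>\<^sup>+x. indicator A (haf U x / \<sigma>) \<partial>gauss (edges U))"
      by (rule nn_integral_distr[OF hU']) measurable
    also have "\<dots> = (\<integral>\<^sup>+x. \<integral>\<^sup>+a. indicator A (haf (insert v V) (add_star v V x a) / \<sigma>) \<partial>gauss V \<partial>M)"
      using mI unfolding V(3) M_def by (rule nn_integral_add_star[OF V(1,2)])
    also have "\<dots> = (\<integral>\<^sup>+x. \<integral>\<^sup>+z. indicator A (s x * z) \<partial>std_normal \<partial>M)"
    proof (intro nn_integral_cong)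
      fix x
      have e: "haf (insert v V) (add_star v V x a) / \<sigma> = (\<Sum>l\<in>V. (haf (V - {l}) x / \<sigma>) * a l)" for a
        by (simp add: haf_add_star[OF V(1) order_refl V(2)] sum_divide_distrib mult.commute)
      have "sqrt (\<Sum>l\<in>V. (haf (V - {l}) x / \<sigma>)\<^sup>2) = s x"
        using \<sigma> by (simp add: s_def t_def power_divide sum_divide_distrib[symmetric] real_sqrt_divide)
      then show "(\<integral>\<^sup>+a. indicator A (haf (insert v V) (add_star v V x a) / \<sigma>) \<partial>gauss V) =
          (\<integral>\<^sup>+z. indicator A (s x * z) \<partial>std_normal)"
        unfolding e by (subst nn_integral_gauss_linear[OF V(1)]) auto
    qed
    also have "\<dots> = (\<integral>\<^sup>+y. ennreal (f y) * indicator A y \<partial>lborel)"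
      by (rule mix(6)[OF K]) measurable
    also have "\<dots> = emeasure (density lborel (\<lambda>y. ennreal (f y))) A"
    proof -
      have "f \<in> borel_measurable borel" using mix(4)[OF K] by (rule borel_measurable_continuous_onI)
      then show ?thesis by (subst emeasure_density) auto
    qed
    finally show "emeasure (distr (gauss (edges U)) borel (\<lambda>x. haf U x / \<sigma>)) A =
        emeasure (density lborel (\<lambda>y. ennreal (f y))) A" .
  qed simp
  with mix(1-5)[OF K] show thesis by (intro that[of f]) (simp_all add: \<pi>\<gamma>_def)
qed

section \<open>Gamma quotients\<close>

lemma shifted_ratio_limit: "(\<lambda>m. (real m + a) / (real m + b)) \<longlonglongrightarrow> 1"
proof -
  have "filterlim (\<lambda>m. b + real m) at_top sequentially"
    by (rule filterlim_tendsto_add_at_top[OF tendsto_const filterlim_real_sequentially])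
  then have "(\<lambda>m. 1 + (a - b) / (b + real m)) \<longlonglongrightarrow> 1 + 0"
    by (intro tendsto_intros tendsto_divide_0[OF tendsto_const] filterlim_at_top_imp_at_infinity)
  moreover have "eventually (\<lambda>m. 1 + (a - b) / (b + real m) = (real m + a) / (real m + b)) sequentially"
    using eventually_gt_at_top[of "nat \<lceil>\<bar>b\<bar>\<rceil>"]
  proof eventually_elim
    case (elim m)
    then have "b + real m \<noteq> 0" by linarith
    then show ?case by (simp add: field_simps)
  qed
  ultimately show ?thesis by (simp add: filterlim_cong)
qed

definition gamma_ratio :: "real \<Rightarrow> real" where
  "gamma_ratio x = Gamma (x - 1 / 2) / Gamma x"

text \<open>Log-convexity of the Gamma function at the midpoint.\<close>

lemma Gamma_midpoint:
  assumes "(a::real) > 0" "b > 0"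
  shows "(Gamma ((a + b) / 2))\<^sup>2 \<le> Gamma a * Gamma b"
proof -
  have G: "Gamma a > 0" "Gamma b > 0" "Gamma ((a + b) / 2) > 0"
    using assms by (auto intro!: Gamma_real_pos)
  have "(ln \<circ> Gamma) ((1 - 1 / 2) *\<^sub>R a + (1 / 2) *\<^sub>R b) \<le> (1 - 1 / 2) * (ln \<circ> Gamma) a + (1 / 2) * (ln \<circ> Gamma) b"
    using assms by (intro convex_onD[OF log_convex_Gamma_real]) auto
  moreover have "(1 - 1 / 2) *\<^sub>R a + (1 / 2) *\<^sub>R b = (a + b) / 2" by (simp add: add_divide_distrib)
  ultimately have "ln (Gamma ((a + b) / 2)) \<le> (1 - 1 / 2) * ln (Gamma a) + (1 / 2) * ln (Gamma b)"
    by (simp only: comp_def)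
  moreover have aux: "2 * z \<le> p + q" if "z \<le> (1 - 1 / 2) * p + (1 / 2) * q" for z p q :: real
    using that by (simp add: field_simps)
  ultimately have "2 * ln (Gamma ((a + b) / 2)) \<le> ln (Gamma a) + ln (Gamma b)" by (intro aux)
  then have "ln ((Gamma ((a + b) / 2))\<^sup>2) \<le> ln (Gamma a * Gamma b)"
    using G by (simp add: ln_mult ln_realpow)
  then show ?thesis using G by (subst (asm) ln_le_cancel_iff) auto
qed

lemma gamma_ratio_pos: "x > 1 / 2 \<Longrightarrow> gamma_ratio x > 0"
  unfolding gamma_ratio_def by (intro divide_pos_pos Gamma_real_pos) auto

lemma gamma_ratio_le:
  assumes x: "x > 1"
  shows "(gamma_ratio x)\<^sup>2 \<le> 1 / (x - 1)"
proof -
  have G: "Gamma x > 0" "Gamma (x - 1) > 0" using x by (auto intro!: Gamma_real_pos)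
  have "x - 1 \<notin> \<int>\<^sub>\<le>\<^sub>0" using x by (auto elim!: nonpos_Ints_cases)
  then have e: "Gamma x = (x - 1) * Gamma (x - 1)"
    using Gamma_plus1[of "x - 1"] by simp
  have "(Gamma (x - 1 / 2))\<^sup>2 \<le> Gamma (x - 1) * Gamma x"
    using Gamma_midpoint[of "x - 1" x] x by (simp add: field_simps)
  then have "(gamma_ratio x)\<^sup>2 \<le> Gamma (x - 1) * Gamma x / (Gamma x)\<^sup>2"
    unfolding gamma_ratio_def power_divide using G by (intro divide_right_mono) auto
  also have "\<dots> = Gamma (x - 1) / Gamma x" using G by (simp add: power2_eq_square)
  also have "\<dots> = 1 / (x - 1)" unfolding e using G by simp
  finally show ?thesis .
qed

lemma gamma_ratio_ge:
  assumes x: "x > 1 / 2"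
  shows "1 / (x - 1 / 2) \<le> (gamma_ratio x)\<^sup>2"
proof -
  define y where "y = x - 1 / 2"
  have y: "y > 0" using x by (simp add: y_def)
  have G: "Gamma x > 0" "Gamma y > 0" using x y by (auto intro!: Gamma_real_pos)
  have "y \<notin> \<int>\<^sub>\<le>\<^sub>0" using y by (auto elim!: nonpos_Ints_cases)
  then have e: "Gamma (y + 1) = y * Gamma y" by (rule Gamma_plus1)
  have "(y + (y + 1)) / 2 = x" by (simp add: y_def)
  then have "(Gamma x)\<^sup>2 \<le> Gamma y * Gamma (y + 1)"
    using Gamma_midpoint[of y "y + 1"] y by simp
  then have "(Gamma x)\<^sup>2 / (y * (Gamma x)\<^sup>2) \<le> (Gamma y * (y * Gamma y)) / (y * (Gamma x)\<^sup>2)"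
    unfolding e using y G by (intro divide_right_mono) auto
  then have "1 / y \<le> (Gamma y)\<^sup>2 / (Gamma x)\<^sup>2"
    using y G by (simp add: power2_eq_square)
  then show ?thesis unfolding gamma_ratio_def y_def[symmetric] power_divide .
qed

lemma gamma_const_ratio:
  assumes d: "d > 1"
  shows "gamma_const d = gamma_ratio (d / 2) / sqrt 2"
proof -
  have "(2::real) powr (- 1 / 2) = inverse (sqrt 2)"
    using powr_minus[of "2::real" "1 / 2"] powr_half_sqrt[of 2] by (simp only: minus_divide_left zero_le_numeral)
  moreover have "(d - 1) / 2 = d / 2 - 1 / 2" by (rule diff_divide_distrib)
  ultimately show ?thesis
    unfolding gamma_const_eq[OF d] gamma_ratio_def by (simp only:) (simp only: divide_inverse mult_ac)
qed

lemma sqrt_gamma_const_limit: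
  "(\<lambda>k. sqrt (real k) * gamma_const (real k - real j)) \<longlonglongrightarrow> 1"
proof -
  have "(\<lambda>k. (sqrt (real k) * gamma_const (real k - real j))\<^sup>2) \<longlonglongrightarrow> 1"
  proof (rule tendsto_sandwich)
    have ev: "eventually (\<lambda>k. k > j + 2) sequentially" by (rule eventually_gt_at_top)
    have sq: "(sqrt (real k) * gamma_const (real k - real j))\<^sup>2 = real k / 2 * (gamma_ratio ((real k - real j) / 2))\<^sup>2"
      if "k > j + 2" for k
      using that by (simp add: gamma_const_ratio power_mult_distrib power_divide)
    show "eventually (\<lambda>k. real k / (real k - real j - 1) \<le> (sqrt (real k) * gamma_const (real k - real j))\<^sup>2) sequentially"
      using ev
    proof eventually_elim
      case (elim k)
      have "real k / 2 * (1 / ((real k - real j) / 2 - 1 / 2)) \<le> real k / 2 * (gamma_ratio ((real k - real j) / 2))\<^sup>2"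
        using elim by (intro mult_left_mono gamma_ratio_ge) auto
      also have "real k / 2 * (1 / ((real k - real j) / 2 - 1 / 2)) = real k / (real k - real j - 1)"
        by (simp add: diff_divide_distrib[symmetric])
      finally show ?case unfolding sq[OF elim] .
    qed
    show "eventually (\<lambda>k. (sqrt (real k) * gamma_const (real k - real j))\<^sup>2 \<le> real k / (real k - real j - 2)) sequentially"
      using ev
    proof eventually_elim
      case (elim k)
      have "real k / 2 * (gamma_ratio ((real k - real j) / 2))\<^sup>2 \<le> real k / 2 * (1 / ((real k - real j) / 2 - 1))"
        using elim by (intro mult_left_mono gamma_ratio_le) auto
      also have "real k / 2 * (1 / ((real k - real j) / 2 - 1)) = real k / (real k - real j - 2)"
        using elim by (simp add: field_simps)
      finally show ?case unfolding sq[OF elim] .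
    qed
    show "(\<lambda>k. real k / (real k - real j - 1)) \<longlonglongrightarrow> 1"
      using shifted_ratio_limit[of 0 "- real j - 1"] by (simp add: algebra_simps)
    show "(\<lambda>k. real k / (real k - real j - 2)) \<longlonglongrightarrow> 1"
      using shifted_ratio_limit[of 0 "- real j - 2"] by (simp add: algebra_simps)
  qed
  then have "(\<lambda>k. sqrt ((sqrt (real k) * gamma_const (real k - real j))\<^sup>2)) \<longlonglongrightarrow> sqrt 1"
    by (rule tendsto_real_sqrt)
  moreover have "eventually (\<lambda>k. sqrt ((sqrt (real k) * gamma_const (real k - real j))\<^sup>2) = sqrt (real k) * gamma_const (real k - real j)) sequentially"
    using eventually_gt_at_top[of "j + 2"]
  proof eventually_elim
    case (elim k)
    then have "gamma_const (real k - real j) > 0" by (intro gamma_const_pos) linarith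
    then show ?case by simp
  qed
  ultimately show ?thesis by (simp add: filterlim_cong)
qed

lemma gamma_product_limit:
  "(\<lambda>k. real k powr (real n / 2) * (\<Prod>j<n. gamma_const (real k - real j))) \<longlonglongrightarrow> 1"
proof -
  have "(\<lambda>k. \<Prod>j<n. sqrt (real k) * gamma_const (real k - real j)) \<longlonglongrightarrow> (\<Prod>j<n. 1)"
    by (intro tendsto_prod sqrt_gamma_const_limit)
  moreover have "eventually (\<lambda>k. (\<Prod>j<n. sqrt (real k) * gamma_const (real k - real j)) =
      real k powr (real n / 2) * (\<Prod>j<n. gamma_const (real k - real j))) sequentially"
    using eventually_gt_at_top[of 0]
  proof eventually_elim
    case (elim k)
    have "sqrt (real k) ^ n = real k powr (real n / 2)"
      using elim by (simp add: powr_half_sqrt[symmetric] powr_power)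
    then show ?case by (simp add: prod.distrib)
  qed
  ultimately show ?thesis by (simp add: filterlim_cong)
qed

text \<open>The eighth power of \<open>sqrt x * gamma_ratio x * ((x - 1) / x) powr (3 / 8)\<close>. Taking the eighth
  power turns the comparison of the values at \<open>x\<close> and \<open>x + 1\<close> into a polynomial inequality.\<close>

definition wallis_defect :: "real \<Rightarrow> real" where
  "wallis_defect x = x * (x - 1) ^ 3 * (gamma_ratio x) ^ 8"

lemma gamma_ratio_plus1: "x > 1 / 2 \<Longrightarrow> gamma_ratio (x + 1) = (x - 1 / 2) / x * gamma_ratio x"
proof -
  assume x: "x > 1 / 2"
  have "x \<notin> \<int>\<^sub>\<le>\<^sub>0" "x - 1 / 2 \<notin> \<int>\<^sub>\<le>\<^sub>0" using x by (auto elim!: nonpos_Ints_cases)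
  then have "Gamma (x + 1) = x * Gamma x" "Gamma (x - 1 / 2 + 1) = (x - 1 / 2) * Gamma (x - 1 / 2)"
    using Gamma_plus1[of x] Gamma_plus1[of "x - 1 / 2"] by blast+
  moreover have "x + 1 - 1 / 2 = x - 1 / 2 + 1" by simp
  ultimately show ?thesis unfolding gamma_ratio_def by (simp only: times_divide_times_eq)
qed

text \<open>After the functional equation of the Gamma function this is
  \<open>x ^ 6 * (x - 1) ^ 3 \<le> (x + 1) * (x - 1 / 2) ^ 8\<close>. In the variable \<open>t = x - 1\<close> the difference of
  the two sides has positive coefficients.\<close>

lemma wallis_defect_mono:
  assumes x: "x \<ge> 3 / 2"
  shows "wallis_defect x \<le> wallis_defect (x + 1)"
proof -
  define t where "t = x - 1"
  have t: "t \<ge> 0" "x = t + 1" using x by (auto simp: t_def)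
  have "(t + 2) * (2 * t + 1) ^ 8 - 256 * (t + 1) ^ 6 * t ^ 3 =
      2 + 33 * t + 240 * t ^ 2 + 752 * t ^ 3 + 1152 * t ^ 4 + 864 * t ^ 5 + 256 * t ^ 6"
    by algebra
  moreover have "\<dots> \<ge> 0" using t(1) by (intro add_nonneg_nonneg mult_nonneg_nonneg zero_le_power) auto
  ultimately have p: "256 * ((t + 1) ^ 6 * t ^ 3) \<le> (t + 2) * (2 * t + 1) ^ 8" by simp
  have "(x - 1 / 2) ^ 8 = ((2 * t + 1) / 2) ^ 8" unfolding t(2) by (simp add: add_divide_distrib add.commute)
  also have "\<dots> = (2 * t + 1) ^ 8 / 256" by (simp add: power_divide)
  finally have e: "(x - 1 / 2) ^ 8 = (2 * t + 1) ^ 8 / 256" .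
  have le_scale: "A \<le> B * (Y / 256)" if "256 * A \<le> B * Y" for A B Y :: real using that by simp
  have "x ^ 6 * (x - 1) ^ 3 = (t + 1) ^ 6 * t ^ 3" "x + 1 = t + 2" by (simp_all add: t(2))
  then have poly: "x ^ 6 * (x - 1) ^ 3 \<le> (x + 1) * (x - 1 / 2) ^ 8"
    unfolding e using le_scale[OF p] by (simp only:)
  have "x * (x - 1) ^ 3 = (x ^ 6 * (x - 1) ^ 3) / x ^ 5"
  proof -
    have "x ^ 6 = x * x ^ 5" using power_Suc[of x 5] by simp
    then show ?thesis using x by simp
  qed
  also have "\<dots> \<le> ((x + 1) * (x - 1 / 2) ^ 8) / x ^ 5" using x poly by (intro divide_right_mono) auto
  also have "\<dots> = (x + 1) * x ^ 3 * ((x - 1 / 2) / x) ^ 8"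
  proof -
    have e: "x ^ 8 = x ^ 3 * x ^ 5" using power_add[of x 3 5] by simp
    have aux: "a * y / q = a * p * (y / (p * q))" if "p \<noteq> 0" for a y p q :: real
      using that by simp
    show ?thesis unfolding power_divide e by (rule aux) (use x in auto)
  qed
  finally have "x * (x - 1) ^ 3 * gamma_ratio x ^ 8 \<le> (x + 1) * x ^ 3 * ((x - 1 / 2) / x) ^ 8 * gamma_ratio x ^ 8"
    by (intro mult_right_mono) auto
  also have "\<dots> = wallis_defect (x + 1)"
  proof -
    have "gamma_ratio (x + 1) = (x - 1 / 2) / x * gamma_ratio x" using x by (intro gamma_ratio_plus1) auto
    then show ?thesis unfolding wallis_defect_def by (simp only: power_mult_distrib add_diff_cancel_right' mult.assoc)
  qed
  finally show ?thesis unfolding wallis_defect_def .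
qed

text \<open>The sequence \<open>wallis_defect (x + m)\<close> increases in \<open>m\<close>, and log-convexity bounds it by
  a sequence with limit 1.\<close>

lemma wallis_defect_le_1:
  assumes x: "x \<ge> 3 / 2"
  shows "wallis_defect x \<le> 1"
proof -
  have le: "wallis_defect x \<le> wallis_defect (x + real m)" for m
  proof (induction m)
    case (Suc m)
    have "wallis_defect (x + real m) \<le> wallis_defect (x + real m + 1)" using x by (intro wallis_defect_mono) auto
    with Suc show ?case by (simp add: add_ac)
  qed simp
  have le2: "wallis_defect y \<le> y / (y - 1)" if y: "y > 1" for y
  proof -
    have "(gamma_ratio y) ^ 8 = ((gamma_ratio y)\<^sup>2) ^ 4" by (simp add: power_mult[symmetric])
    also have "\<dots> \<le> (1 / (y - 1)) ^ 4" using gamma_ratio_le[OF y] by (intro power_mono) auto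
    finally have "wallis_defect y \<le> y * (y - 1) ^ 3 * (1 / (y - 1)) ^ 4"
      unfolding wallis_defect_def using y by (intro mult_left_mono) auto
    also have "\<dots> = y / (y - 1)"
    proof -
      have "(1 / (y - 1)) ^ 4 = 1 / ((y - 1) * (y - 1) ^ 3)"
        using power_Suc[of "y - 1" 3] by (simp add: power_divide)
      then show ?thesis using y by simp
    qed
    finally show ?thesis .
  qed
  have "(\<lambda>m. (x + real m) / (x + real m - 1)) \<longlonglongrightarrow> 1"
    using shifted_ratio_limit[of x "x - 1"] by (simp add: algebra_simps)
  then show ?thesis
  proof (rule LIMSEQ_le_const, intro exI allI impI)
    fix m :: nat
    show "wallis_defect x \<le> (x + real m) / (x + real m - 1)"
      using le[of m] le2[of "x + real m"] x by linarith
  qed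
qed

lemma sqrt_gamma_const_le:
  assumes x: "x \<ge> 3 / 2"
  shows "sqrt (2 * x) * gamma_const (2 * x) \<le> (x / (x - 1)) powr (3 / 8)"
proof -
  have g: "gamma_ratio x > 0" using x by (intro gamma_ratio_pos) auto
  have e: "sqrt (2 * x) * gamma_const (2 * x) = sqrt x * gamma_ratio x"
    using x by (simp add: gamma_const_ratio real_sqrt_mult)
  have "(sqrt x * gamma_ratio x) ^ 8 = x ^ 4 * gamma_ratio x ^ 8"
  proof -
    have "sqrt x ^ 8 = ((sqrt x)\<^sup>2) ^ 4" by (simp add: power_mult[symmetric])
    then show ?thesis using x by (simp add: power_mult_distrib)
  qed
  also have "\<dots> = wallis_defect x * (x / (x - 1)) ^ 3"
  proof -
    have "x ^ 4 = x * x ^ 3" using power_Suc[of x 3] by simp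
    then show ?thesis using x unfolding wallis_defect_def power_divide by simp
  qed
  also have "\<dots> \<le> 1 * (x / (x - 1)) ^ 3" using wallis_defect_le_1[OF x] x by (intro mult_right_mono) auto
  also have "\<dots> = ((x / (x - 1)) powr (3 / 8)) ^ 8"
    using x by (simp add: powr_power)
  finally have "(sqrt x * gamma_ratio x) ^ 8 \<le> ((x / (x - 1)) powr (3 / 8)) ^ 8" .
  then show ?thesis unfolding e by (rule power_le_imp_le_base[of _ 7, simplified]) simp
qed

text \<open>Both sides are products over \<open>r\<close>; on the right-hand side the factors are
  \<open>((2 r - 1) / (2 r - 3)) powr (3 / 8)\<close>.\<close>

lemma double_fact_gamma_product_le:
  assumes "n \<ge> 1"
  shows "sqrt (real (double_fact (2 * n - 1))) * (\<Prod>r=2..n. gamma_const (2 * real r - 1)) \<le> (2 * real n - 1) powr (3 / 8)"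
  using assms
proof (induction n rule: dec_induct)
  case base
  then show ?case by simp
next
  case (step n)
  define x where "x = real n + 1 / 2"
  have x: "x \<ge> 3 / 2" using step.hyps by (simp add: x_def)
  have d: "double_fact (2 * Suc n - 1) = (2 * n + 1) * double_fact (2 * n - 1)"
    using step.hyps by (cases n) auto
  have p: "(\<Prod>r=2..Suc n. gamma_const (2 * real r - 1)) = gamma_const (2 * x) * (\<Prod>r=2..n. gamma_const (2 * real r - 1))"
  proof -
    have "2 * x = 2 * real (Suc n) - 1" by (simp add: x_def)
    then show ?thesis using step.hyps by (simp add: prod.nat_ivl_Suc')
  qed
  have nn: "(\<Prod>r=2..n. gamma_const (2 * real r - 1)) \<ge> 0"
    by (intro prod_nonneg ballI less_imp_le[OF gamma_const_pos]) auto
  have "real (2 * n + 1) = 2 * x" by (simp add: x_def)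
  then have "real (double_fact (2 * Suc n - 1)) = 2 * x * real (double_fact (2 * n - 1))"
    by (simp only: d of_nat_mult)
  then have "sqrt (real (double_fact (2 * Suc n - 1))) = sqrt (2 * x) * sqrt (real (double_fact (2 * n - 1)))"
    by (simp only: real_sqrt_mult[of "2 * x"])
  then have "sqrt (real (double_fact (2 * Suc n - 1))) * (\<Prod>r=2..Suc n. gamma_const (2 * real r - 1)) =
      (sqrt (2 * x) * gamma_const (2 * x)) * (sqrt (real (double_fact (2 * n - 1))) * (\<Prod>r=2..n. gamma_const (2 * real r - 1)))"
    unfolding p by simp
  also have "\<dots> \<le> (x / (x - 1)) powr (3 / 8) * (2 * real n - 1) powr (3 / 8)"
    using nn by (intro mult_mono sqrt_gamma_const_le x step.IH) auto
  also have "\<dots> = (x / (x - 1) * (2 * real n - 1)) powr (3 / 8)"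
    using step.hyps x by (intro powr_mult[symmetric])
  also have "x / (x - 1) * (2 * real n - 1) = 2 * real (Suc n) - 1"
    using x by (simp add: x_def field_simps)
  finally show ?case .
qed

lemma b_real_le:
  assumes n: "n \<ge> 1"
  shows "b_real n / 2 \<le> 1 / sqrt pi * real n powr (3 / 8)"
proof -
  have "b_real n / 2 = 1 / sqrt (2 * pi) * (sqrt (real (double_fact (2 * n - 1))) * (\<Prod>r=2..n. gamma_const (2 * real r - 1)))"
    by (simp add: b_real_def real_sqrt_divide real_sqrt_mult field_simps)
  also have "\<dots> \<le> 1 / sqrt (2 * pi) * (2 * real n - 1) powr (3 / 8)"
    by (intro mult_left_mono double_fact_gamma_product_le n) auto
  also have "\<dots> \<le> 1 / sqrt (2 * pi) * (sqrt 2 * real n powr (3 / 8))"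
  proof (intro mult_left_mono)
    have "(2 * real n - 1) powr (3 / 8) \<le> (2 * real n) powr (3 / 8)" using n by (intro powr_mono2) auto
    also have "\<dots> = 2 powr (3 / 8) * real n powr (3 / 8)" by (rule powr_mult)
    also have "\<dots> \<le> 2 powr (1 / 2) * real n powr (3 / 8)" by (intro mult_right_mono powr_mono) auto
    also have "2 powr (1 / 2) = sqrt (2::real)" by (rule powr_half_sqrt) simp
    finally show "(2 * real n - 1) powr (3 / 8) \<le> sqrt 2 * real n powr (3 / 8)" .
  qed auto
  also have "\<dots> = 1 / sqrt pi * real n powr (3 / 8)" by (simp add: real_sqrt_mult)
  finally show ?thesis .
qed

section \<open>Interpolation between Gram entries and independent entries\<close>

lemma nn_integral_gauss_restrict_mult:
  assumes I: "finite I" "A \<subseteq> I" and [measurable]: "f \<in> borel_measurable (gauss A)" "g \<in> borel_measurable (gauss (I - A))"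
  shows "(\<integral>\<^sup>+z. f (restrict z A) * g (restrict z (I - A)) \<partial>gauss I) =
    (\<integral>\<^sup>+x. f x \<partial>gauss A) * (\<integral>\<^sup>+y. g y \<partial>gauss (I - A))"
proof -
  let ?\<phi> = "\<lambda>i. if i \<in> A then Inl i else Inr i"
  have bij: "bij_betw ?\<phi> I (A <+> (I - A))"
    by (rule bij_betwI[where g = "case_sum id id"]) (use I in \<open>auto split: if_splits\<close>)
  have rA: "restrict (assemble ?\<phi> I x y) A = x" if "x \<in> space (gauss A)" for x y
    using that I(2) by (auto simp: assemble_def space_gauss PiE_iff extensional_def fun_eq_iff)
  have rB: "restrict (assemble ?\<phi> I x y) (I - A) = y" if "y \<in> space (gauss (I - A))" for x y
    using that by (auto simp: assemble_def space_gauss PiE_iff extensional_def fun_eq_iff)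
  have mA: "(\<lambda>z. restrict z A) \<in> gauss I \<rightarrow>\<^sub>M gauss A"
    using I(2) by (simp cong: measurable_cong_sets add: sets_gauss measurable_restrict_subset)
  have mB: "(\<lambda>z. restrict z (I - A)) \<in> gauss I \<rightarrow>\<^sub>M gauss (I - A)"
    by (simp cong: measurable_cong_sets add: sets_gauss measurable_restrict_subset)
  have "(\<integral>\<^sup>+z. f (restrict z A) * g (restrict z (I - A)) \<partial>gauss I) =
      (\<integral>\<^sup>+x. \<integral>\<^sup>+y. f (restrict (assemble ?\<phi> I x y) A) * g (restrict (assemble ?\<phi> I x y) (I - A)) \<partial>gauss (I - A) \<partial>gauss A)"
    by (intro nn_integral_assemble[OF I(1) bij] borel_measurable_times_ennreal
        measurable_compose[OF mA] measurable_compose[OF mB] assms)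
  also have "\<dots> = (\<integral>\<^sup>+x. \<integral>\<^sup>+y. f x * g y \<partial>gauss (I - A) \<partial>gauss A)"
    by (intro nn_integral_cong) (simp add: rA rB)
  also have "\<dots> = (\<integral>\<^sup>+x. f x \<partial>gauss A) * (\<integral>\<^sup>+y. g y \<partial>gauss (I - A))"
    by (simp add: nn_integral_cmult nn_integral_multc)
  finally show ?thesis .
qed

lemma nn_integral_gauss_marginal:
  assumes I: "finite I" "A \<subseteq> I" and f: "f \<in> borel_measurable (gauss A)"
  shows "(\<integral>\<^sup>+z. f (restrict z A) \<partial>gauss I) = (\<integral>\<^sup>+x. f x \<partial>gauss A)"
proof -
  interpret prob_space "gauss (I - A)" by (rule prob_space_gauss)
  show ?thesis using nn_integral_gauss_restrict_mult[OF I f, of "\<lambda>_. 1"] by (simp add: emeasure_space_1)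
qed

lemma nn_integral_gauss_indep:
  assumes I: "finite I" "A \<subseteq> I" "B \<subseteq> I" "A \<inter> B = {}"
    and f: "f \<in> borel_measurable (gauss A)" and g: "g \<in> borel_measurable (gauss B)"
  shows "(\<integral>\<^sup>+z. f (restrict z A) * g (restrict z B) \<partial>gauss I) =
    (\<integral>\<^sup>+z. f (restrict z A) \<partial>gauss I) * (\<integral>\<^sup>+z. g (restrict z B) \<partial>gauss I)"
proof -
  have B: "B \<subseteq> I - A" using I by auto
  have mB: "(\<lambda>z. restrict z B) \<in> gauss (I - A) \<rightarrow>\<^sub>M gauss B"
    using B by (simp cong: measurable_cong_sets add: sets_gauss measurable_restrict_subset)
  have rr: "restrict (restrict z (I - A)) B = restrict z B" for z :: "'a \<Rightarrow> real"
    using B by (simp add: restrict_restrict Int_absorb1)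
  have "(\<integral>\<^sup>+z. f (restrict z A) * g (restrict z B) \<partial>gauss I) =
      (\<integral>\<^sup>+x. f x \<partial>gauss A) * (\<integral>\<^sup>+y. g (restrict y B) \<partial>gauss (I - A))"
    using nn_integral_gauss_restrict_mult[OF I(1,2) f measurable_compose[OF mB g]] by (simp only: rr)
  also have "(\<integral>\<^sup>+y. g (restrict y B) \<partial>gauss (I - A)) = (\<integral>\<^sup>+y. g y \<partial>gauss B)"
    using I B by (intro nn_integral_gauss_marginal g) auto
  finally show ?thesis by (simp only: nn_integral_gauss_marginal[OF I(1,2) f] nn_integral_gauss_marginal[OF I(1,3) g])
qed

lemma nn_integral_gauss_component:
  assumes I: "finite I" "i \<in> I" and g: "g \<in> borel_measurable borel"
  shows "(\<integral>\<^sup>+z. g (z i) \<partial>gauss I) = (\<integral>\<^sup>+t. g t \<partial>std_normal)"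
proof -
  interpret product_sigma_finite "\<lambda>_. std_normal" by (rule product_sigma_finite_std_normal)
  have m: "(\<lambda>x. g (x i)) \<in> borel_measurable (gauss {i})"
    by (rule measurable_compose[OF measurable_gauss_component g]) simp
  have "(\<integral>\<^sup>+z. g (z i) \<partial>gauss I) = (\<integral>\<^sup>+z. g (restrict z {i} i) \<partial>gauss I)" by simp
  also have "\<dots> = (\<integral>\<^sup>+x. g (x i) \<partial>gauss {i})"
    using I by (intro nn_integral_gauss_marginal m) auto
  also have "\<dots> = (\<integral>\<^sup>+t. g t \<partial>std_normal)"
    unfolding gauss_def using g by (intro product_nn_integral_singleton) simp
  finally show ?thesis .
qed

lemma sum_fourth_power_le:
  fixes a :: "'i \<Rightarrow> real"
  assumes "finite A" "real (card A) \<le> N"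
  shows "(\<Sum>l\<in>A. a l) ^ 4 \<le> N ^ 3 * (\<Sum>l\<in>A. a l ^ 4)"
proof -
  have N: "N \<ge> 0" using assms(2) by (meson of_nat_0_le_iff order_trans)
  have sq: "(\<Sum>l\<in>A. b l)\<^sup>2 \<le> N * (\<Sum>l\<in>A. (b l)\<^sup>2)" for b :: "'i \<Rightarrow> real"
  proof -
    have "(\<Sum>l\<in>A. b l)\<^sup>2 \<le> (\<Sum>l\<in>A. (b l)\<^sup>2) * real (card A)" using sum_squared_le_sum_of_squares[of b A] by simp
    also have "\<dots> \<le> (\<Sum>l\<in>A. (b l)\<^sup>2) * N" using assms(2) by (intro mult_left_mono sum_nonneg) auto
    finally show ?thesis by (simp add: mult.commute)
  qed
  have "(\<Sum>l\<in>A. a l) ^ 4 = ((\<Sum>l\<in>A. a l)\<^sup>2)\<^sup>2" by (simp add: power_mult[symmetric])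
  also have "\<dots> \<le> (N * (\<Sum>l\<in>A. (a l)\<^sup>2))\<^sup>2" by (intro power_mono sq) auto
  also have "\<dots> = N\<^sup>2 * (\<Sum>l\<in>A. (a l)\<^sup>2)\<^sup>2" by (simp add: power_mult_distrib)
  also have "\<dots> \<le> N\<^sup>2 * (N * (\<Sum>l\<in>A. ((a l)\<^sup>2)\<^sup>2))" by (intro mult_left_mono sq) auto
  also have "\<dots> = N ^ 3 * (\<Sum>l\<in>A. a l ^ 4)"
    using power_Suc2[of N 2] by (simp add: power_mult[symmetric] mult.assoc)
  finally show ?thesis .
qed

text \<open>A common index set for all interpolating matrices: the coordinates of the vectors \<open>x\<^sub>i\<close> together
  with one fresh variable for every edge.\<close>

definition hyb_index :: "nat \<Rightarrow> 'v set \<Rightarrow> (nat \<times> 'v + 'v set) set" where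
  "hyb_index k U = ({1..k} \<times> U) <+> edges U"

text \<open>Inside \<open>W\<close> the edge weights are normalised Gram entries, elsewhere they are the fresh
  variables. The case \<open>W = U\<close> is the Gram hafnian and \<open>W = {}\<close> the hafnian with independent entries.\<close>

definition hyb :: "nat \<Rightarrow> 'v set \<Rightarrow> (nat \<times> 'v + 'v set \<Rightarrow> real) \<Rightarrow> 'v set \<Rightarrow> real" where
  "hyb k W z e = (if e \<subseteq> W then (\<Sum>a=1..k. \<Prod>i\<in>e. z (Inl (a, i))) / sqrt (real k) else z (Inr e))"

lemma finite_hyb_index: "finite U \<Longrightarrow> finite (hyb_index k U)"
  by (simp add: hyb_index_def finite_edges)

lemma hyb_index_mono: "U' \<subseteq> U \<Longrightarrow> hyb_index k U' \<subseteq> hyb_index k U"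
  unfolding hyb_index_def using edges_mono[of U' U] by (auto simp: Plus_def)

lemma hyb_cong:
  assumes "e \<in> edges U" "\<And>p. p \<in> hyb_index k U \<Longrightarrow> z p = z' p"
  shows "hyb k W z e = hyb k W z' e"
proof -
  have "z (Inl (a, i)) = z' (Inl (a, i))" if "a \<in> {1..k}" "i \<in> e" for a i
    using assms(1) that by (intro assms(2)) (auto simp: hyb_index_def edges_def)
  moreover have "z (Inr e) = z' (Inr e)" using assms(1) by (intro assms(2)) (auto simp: hyb_index_def)
  ultimately show ?thesis by (simp add: hyb_def)
qed

lemma haf_hyb_cong:
  assumes "\<And>p. p \<in> hyb_index k U \<Longrightarrow> z p = z' p"
  shows "haf U (hyb k W z) = haf U (hyb k W z')"
proof (rule haf_cong)
  fix e assume "e \<in> edges U"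
  then show "hyb k W z e = hyb k W z' e" by (rule hyb_cong[OF _ assms])
qed

lemma measurable_hyb [measurable (raw)]:
  assumes "e \<in> edges U"
  shows "(\<lambda>z. hyb k W z e) \<in> borel_measurable (gauss (hyb_index k U))"
proof -
  have "(\<lambda>z. z (Inl (a, i))) \<in> borel_measurable (gauss (hyb_index k U))" if "a \<in> {1..k}" "i \<in> e" for a i
    using assms that by (intro measurable_gauss_component) (auto simp: hyb_index_def edges_def)
  moreover have "(\<lambda>z. z (Inr e)) \<in> borel_measurable (gauss (hyb_index k U))"
    using assms by (intro measurable_gauss_component) (auto simp: hyb_index_def)
  ultimately show ?thesis unfolding hyb_def
    by (cases "e \<subseteq> W") (auto intro!: borel_measurable_divide borel_measurable_sum borel_measurable_prod)
qed

lemma measurable_haf_hyb [measurable (raw)]: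
  assumes "U' \<subseteq> U"
  shows "(\<lambda>z. haf U' (hyb k W z)) \<in> borel_measurable (gauss (hyb_index k U))"
  unfolding haf_def
proof (intro borel_measurable_sum borel_measurable_prod)
  fix m e assume "m \<in> perfect_matchings U'" "e \<in> m"
  then have "e \<in> edges U" using perfect_matching_subset edges_mono[OF assms] by blast
  then show "(\<lambda>z. hyb k W z e) \<in> borel_measurable (gauss (hyb_index k U))" by (rule measurable_hyb)
qed

text \<open>Given the \<open>z (q a)\<close>, the sum is a linear form in the independent variables \<open>z (p a)\<close>.\<close>

lemma nn_integral_sum_products:
  assumes I: "finite I" and p: "inj_on p K" "p ` K \<subseteq> I" and q: "inj_on q K" "q ` K \<subseteq> I"
    and pq: "p ` K \<inter> q ` K = {}" and K: "finite K"
  shows "(\<integral>\<^sup>+z. ennreal ((\<Sum>a\<in>K. z (p a) * z (q a)) ^ (2 * r)) \<partial>gauss I) =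
    ennreal (fact (2 * r) / (2 ^ r * fact r)) * (\<integral>\<^sup>+z. ennreal ((\<Sum>a\<in>K. (z (q a))\<^sup>2) ^ r) \<partial>gauss I)"
proof -
  define A where "A = I - p ` K"
  let ?g = "the_inv_into K p"
  let ?\<phi> = "\<lambda>i. if i \<in> p ` K then Inr (?g i) else Inl i"
  have g: "?g (p a) = a" if "a \<in> K" for a using p(1) that by (simp add: the_inv_into_f_f)
  have bij: "bij_betw ?\<phi> I (A <+> K)"
    by (rule bij_betwI[where g = "case_sum id p"]) (use p g in \<open>auto simp: A_def dest: inj_onD split: if_splits\<close>)
  have P: "assemble ?\<phi> I x y (p a) = y a" if "a \<in> K" for x y a
  proof -
    have "p a \<in> I" using p that by auto
    then show ?thesis using that g by (simp add: assemble_def)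
  qed
  have Q: "assemble ?\<phi> I x y (q a) = x (q a)" if "a \<in> K" for x y a
  proof -
    have "q a \<in> I" "q a \<notin> p ` K" using q pq that by auto
    then show ?thesis by (simp add: assemble_def)
  qed
  have pI: "p a \<in> I" "q a \<in> I" "q a \<in> A" if "a \<in> K" for a using p q pq that by (auto simp: A_def)
  have m: "(\<lambda>z. \<Sum>a\<in>K. z (p a) * z (q a)) \<in> borel_measurable (gauss I)"
    using pI by (intro borel_measurable_sum borel_measurable_times measurable_gauss_component) auto
  have m2: "(\<lambda>z. (\<Sum>a\<in>K. (z (q a))\<^sup>2) ^ r) \<in> borel_measurable (gauss J)" if "q ` K \<subseteq> J" for J
    using that by (intro borel_measurable_power borel_measurable_sum measurable_gauss_component) auto
  have "(\<integral>\<^sup>+z. ennreal ((\<Sum>a\<in>K. z (p a) * z (q a)) ^ (2 * r)) \<partial>gauss I) =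
      (\<integral>\<^sup>+x. \<integral>\<^sup>+y. ennreal ((\<Sum>a\<in>K. assemble ?\<phi> I x y (p a) * assemble ?\<phi> I x y (q a)) ^ (2 * r)) \<partial>gauss K \<partial>gauss A)"
    by (rule nn_integral_assemble[OF I bij]) (rule measurable_compose[OF m], measurable)
  also have "\<dots> = (\<integral>\<^sup>+x. \<integral>\<^sup>+y. ennreal ((\<Sum>a\<in>K. x (q a) * y a) ^ (2 * r)) \<partial>gauss K \<partial>gauss A)"
    by (simp add: P Q mult.commute cong: sum.cong)
  also have "\<dots> = (\<integral>\<^sup>+x. ennreal (fact (2 * r) / (2 ^ r * fact r)) * ennreal ((\<Sum>a\<in>K. (x (q a))\<^sup>2) ^ r) \<partial>gauss A)"
  proof -
    have c: "0 \<le> (fact (2 * r) / (2 ^ r * fact r) :: real)" by simp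
    show ?thesis unfolding nn_integral_gauss_linear_moment[OF K] ennreal_mult'[OF c] by (rule refl)
  qed
  also have "\<dots> = ennreal (fact (2 * r) / (2 ^ r * fact r)) * (\<integral>\<^sup>+x. ennreal ((\<Sum>a\<in>K. (x (q a))\<^sup>2) ^ r) \<partial>gauss A)"
    using pI by (intro nn_integral_cmult measurable_compose[OF m2 measurable_ennreal]) auto
  also have "(\<integral>\<^sup>+x. ennreal ((\<Sum>a\<in>K. (x (q a))\<^sup>2) ^ r) \<partial>gauss A) = (\<integral>\<^sup>+z. ennreal ((\<Sum>a\<in>K. (restrict z A (q a))\<^sup>2) ^ r) \<partial>gauss I)"
    using pI by (intro nn_integral_gauss_marginal[symmetric] I measurable_compose[OF m2 measurable_ennreal]) (auto simp: A_def)
  also have "\<dots> = (\<integral>\<^sup>+z. ennreal ((\<Sum>a\<in>K. (z (q a))\<^sup>2) ^ r) \<partial>gauss I)"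
    using pI by (simp cong: sum.cong)
  finally show ?thesis .
qed

lemma nn_integral_sum_squares:
  assumes I: "finite I" and q: "q ` K \<subseteq> I" and K: "finite K"
  shows "(\<integral>\<^sup>+z. ennreal (\<Sum>a\<in>K. (z (q a))\<^sup>2) \<partial>gauss I) = ennreal (real (card K))"
    and "(\<integral>\<^sup>+z. ennreal ((\<Sum>a\<in>K. (z (q a))\<^sup>2)\<^sup>2) \<partial>gauss I) \<le> ennreal (3 * (real (card K))\<^sup>2)"
proof -
  have m2: "(\<integral>\<^sup>+z. ennreal ((z (q a))\<^sup>2) \<partial>gauss I) = 1" if "a \<in> K" for a
    using nn_integral_gauss_component[OF I, of "q a" "\<lambda>t. ennreal (t\<^sup>2)"] nn_integral_std_normal_moment[of 1] that q
    by auto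
  have m4: "(\<integral>\<^sup>+z. ennreal ((z (q a)) ^ 4) \<partial>gauss I) = 3" if "a \<in> K" for a
    using nn_integral_gauss_component[OF I, of "q a" "\<lambda>t. ennreal (t ^ 4)"] nn_integral_std_normal_moment[of 2] that q
    by (auto simp: fact_numeral)
  have m: "(\<lambda>z. ennreal ((z (q a)) ^ r)) \<in> borel_measurable (gauss I)" if "a \<in> K" for a r
  proof -
    have "(\<lambda>z. z (q a)) \<in> borel_measurable (gauss I)"
      using q that by (intro measurable_gauss_component) auto
    then show ?thesis by (rule measurable_compose) measurable
  qed
  have "(\<integral>\<^sup>+z. ennreal (\<Sum>a\<in>K. (z (q a))\<^sup>2) \<partial>gauss I) = (\<integral>\<^sup>+z. (\<Sum>a\<in>K. ennreal ((z (q a))\<^sup>2)) \<partial>gauss I)"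
    by simp
  also have "\<dots> = (\<Sum>a\<in>K. \<integral>\<^sup>+z. ennreal ((z (q a))\<^sup>2) \<partial>gauss I)"
    by (intro nn_integral_sum m)
  also have "\<dots> = ennreal (real (card K))" by (simp add: m2 ennreal_of_nat_eq_real_of_nat)
  finally show "(\<integral>\<^sup>+z. ennreal (\<Sum>a\<in>K. (z (q a))\<^sup>2) \<partial>gauss I) = ennreal (real (card K))" .
  have "(\<integral>\<^sup>+z. ennreal ((\<Sum>a\<in>K. (z (q a))\<^sup>2)\<^sup>2) \<partial>gauss I) \<le>
      (\<integral>\<^sup>+z. ennreal (real (card K)) * (\<Sum>a\<in>K. ennreal ((z (q a)) ^ 4)) \<partial>gauss I)"
  proof (intro nn_integral_mono)
    fix z
    have "(\<Sum>a\<in>K. (z (q a))\<^sup>2)\<^sup>2 \<le> (\<Sum>a\<in>K. ((z (q a))\<^sup>2)\<^sup>2) * real (card K)"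
      using sum_squared_le_sum_of_squares[of "\<lambda>a. (z (q a))\<^sup>2" K] by simp
    also have "\<dots> = real (card K) * (\<Sum>a\<in>K. (z (q a)) ^ 4)" by (simp add: power_mult[symmetric])
    finally have "ennreal ((\<Sum>a\<in>K. (z (q a))\<^sup>2)\<^sup>2) \<le> ennreal (real (card K) * (\<Sum>a\<in>K. (z (q a)) ^ 4))"
      by (rule ennreal_leI)
    then show "ennreal ((\<Sum>a\<in>K. (z (q a))\<^sup>2)\<^sup>2) \<le> ennreal (real (card K)) * (\<Sum>a\<in>K. ennreal ((z (q a)) ^ 4))"
      by (simp add: ennreal_mult')
  qed
  also have "\<dots> = ennreal (real (card K)) * (\<Sum>a\<in>K. \<integral>\<^sup>+z. ennreal ((z (q a)) ^ 4) \<partial>gauss I)"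
    by (simp only: nn_integral_cmult[OF borel_measurable_sum[OF m]] nn_integral_sum[OF m])
  also have "\<dots> = ennreal (real (card K)) * ennreal (real (card K) * 3)"
    by (simp add: m4 ennreal_of_nat_eq_real_of_nat ennreal_mult')
  also have "\<dots> = ennreal (3 * (real (card K))\<^sup>2)"
    by (simp add: ennreal_mult'[symmetric] power2_eq_square mult_ac)
  finally show "(\<integral>\<^sup>+z. ennreal ((\<Sum>a\<in>K. (z (q a))\<^sup>2)\<^sup>2) \<partial>gauss I) \<le> ennreal (3 * (real (card K))\<^sup>2)" .
qed

text \<open>The variance of a chi-square variable, by adding one degree of freedom at a time.\<close>

lemma nn_integral_centred_sum_squares:
  assumes "finite K"
  shows "(\<integral>\<^sup>+x. ennreal ((\<Sum>a\<in>K. (x a)\<^sup>2 - 1)\<^sup>2) \<partial>gauss K) = ennreal (2 * real (card K))"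
  using assms
proof (induction K rule: finite_induct)
  case empty
  then show ?case by simp
next
  case (insert b K)
  interpret product_sigma_finite "\<lambda>_. std_normal" by (rule product_sigma_finite_std_normal)
  interpret N: prob_space std_normal by (rule prob_space_std_normal)
  interpret G: prob_space "gauss K" by (rule prob_space_gauss)
  have m: "(\<lambda>x. ennreal ((\<Sum>a\<in>L. (x a)\<^sup>2 - 1)\<^sup>2)) \<in> borel_measurable (gauss L)" for L :: "'a set"
    by measurable
  have inner: "(\<integral>\<^sup>+t. ennreal ((S + (t\<^sup>2 - 1))\<^sup>2) \<partial>std_normal) = ennreal (S\<^sup>2) + 2" for S :: real
  proof -
    have i: "integrable std_normal (\<lambda>t. t ^ 2)" "integrable std_normal (\<lambda>t. t ^ 4)"
      by (rule integrable_std_normal_distribution_moment)+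
    have e: "(S + (t\<^sup>2 - 1))\<^sup>2 = (S - 1)\<^sup>2 + 2 * (S - 1) * t ^ 2 + t ^ 4" for t :: real
    proof -
      have "t ^ 4 = t\<^sup>2 * t\<^sup>2" using power_add[of t 2 2] by simp
      then show ?thesis by (simp add: power2_eq_square algebra_simps)
    qed
    have "integrable std_normal (\<lambda>t. (S - 1)\<^sup>2 + 2 * (S - 1) * t ^ 2 + t ^ 4)"
      using i by (intro Bochner_Integration.integrable_add integrable_mult_right) auto
    then have "(\<integral>\<^sup>+t. ennreal ((S + (t\<^sup>2 - 1))\<^sup>2) \<partial>std_normal) =
        ennreal (\<integral>t. (S - 1)\<^sup>2 + 2 * (S - 1) * t ^ 2 + t ^ 4 \<partial>std_normal)"
      unfolding e[symmetric] by (intro nn_integral_eq_integral) auto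
    also have "(\<integral>t. (S - 1)\<^sup>2 + 2 * (S - 1) * t ^ 2 + t ^ 4 \<partial>std_normal) = (S - 1)\<^sup>2 + 2 * (S - 1) * 1 + 3"
      using i N.prob_space std_normal_distribution_even_moments(1)[of 1] std_normal_distribution_even_moments(1)[of 2]
      by (simp add: fact_numeral)
    also have "\<dots> = S\<^sup>2 + 2" by (simp add: power2_eq_square algebra_simps)
    finally show ?thesis by simp
  qed
  have "(\<integral>\<^sup>+x. ennreal ((\<Sum>a\<in>insert b K. (x a)\<^sup>2 - 1)\<^sup>2) \<partial>gauss (insert b K)) =
      (\<integral>\<^sup>+x. \<integral>\<^sup>+t. ennreal ((\<Sum>a\<in>insert b K. ((x(b := t)) a)\<^sup>2 - 1)\<^sup>2) \<partial>std_normal \<partial>gauss K)"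
    using product_nn_integral_insert[OF insert.hyps m[of "insert b K", unfolded gauss_def]] by (simp only: gauss_def)
  also have "\<dots> = (\<integral>\<^sup>+x. \<integral>\<^sup>+t. ennreal (((\<Sum>a\<in>K. (x a)\<^sup>2 - 1) + (t\<^sup>2 - 1))\<^sup>2) \<partial>std_normal \<partial>gauss K)"
  proof -
    have "(\<Sum>a\<in>insert b K. ((x(b := t)) a)\<^sup>2 - 1) = (\<Sum>a\<in>K. (x a)\<^sup>2 - 1) + (t\<^sup>2 - 1)" for x :: "'a \<Rightarrow> real" and t
    proof -
      have "(\<Sum>a\<in>K. ((x(b := t)) a)\<^sup>2 - 1) = (\<Sum>a\<in>K. (x a)\<^sup>2 - 1)"
        using insert.hyps by (intro sum.cong) auto
      then show ?thesis using insert.hyps by simp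
    qed
    then show ?thesis by (simp only:)
  qed
  also have "\<dots> = (\<integral>\<^sup>+x. ennreal ((\<Sum>a\<in>K. (x a)\<^sup>2 - 1)\<^sup>2) \<partial>gauss K) + 2"
    unfolding inner by (subst nn_integral_add[OF m]) (auto simp: G.emeasure_space_1)
  also have "\<dots> = ennreal (2 * real (card (insert b K)))"
    unfolding insert.IH using insert.hyps ennreal_plus[of "2 * real (card K)" 2] by (simp add: algebra_simps)
  finally show ?case .
qed

lemma distr_gauss_reindex:
  assumes p: "inj_on p K" "p ` K \<subseteq> I"
  shows "(\<lambda>z. \<lambda>a\<in>K. z (p a)) \<in> gauss I \<rightarrow>\<^sub>M gauss K"
    and "distr (gauss I) (gauss K) (\<lambda>z. \<lambda>a\<in>K. z (p a)) = gauss K"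
proof -
  have "(\<lambda>z. \<lambda>a\<in>K. z (p a)) \<in> gauss I \<rightarrow>\<^sub>M Pi\<^sub>M K (\<lambda>_. borel)"
    using p by (intro measurable_restrict measurable_gauss_component) auto
  then show "(\<lambda>z. \<lambda>a\<in>K. z (p a)) \<in> gauss I \<rightarrow>\<^sub>M gauss K"
    by (simp cong: measurable_cong_sets add: sets_gauss)
  show "distr (gauss I) (gauss K) (\<lambda>z. \<lambda>a\<in>K. z (p a)) = gauss K"
    unfolding gauss_def
    using distr_PiM_reindex[of I "\<lambda>_. std_normal" p K] p prob_space_std_normal by auto
qed

lemma nn_integral_gauss_reindex:
  assumes p: "inj_on p K" "p ` K \<subseteq> I" and f: "f \<in> borel_measurable (gauss K)"
  shows "(\<integral>\<^sup>+z. f (\<lambda>a\<in>K. z (p a)) \<partial>gauss I) = (\<integral>\<^sup>+x. f x \<partial>gauss K)"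
  using nn_integral_distr[OF distr_gauss_reindex(1)[OF p], of f] f
  by (simp add: distr_gauss_reindex(2)[OF p])

lemma hyb_pair_gram:
  "i \<noteq> j \<Longrightarrow> {i, j} \<subseteq> W \<Longrightarrow> hyb k W z {i, j} = (\<Sum>a=1..k. z (Inl (a, i)) * z (Inl (a, j))) / sqrt (real k)"
  by (simp add: hyb_def)

lemma nn_integral_hyb_fourth_power:
  assumes U: "finite U" and e: "e \<in> edges U" and k: "k \<ge> 1"
  shows "(\<integral>\<^sup>+z. ennreal ((hyb k W z e) ^ 4) \<partial>gauss (hyb_index k U)) \<le> 9"
proof (cases "e \<subseteq> W")
  case True
  obtain i j where ij: "e = {i, j}" "i \<noteq> j" using e by (auto simp: edges_def card_2_iff)
  then have iU: "i \<in> U" "j \<in> U" using e by auto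
  let ?S = "\<lambda>z. \<Sum>a=1..k. z (Inl (a, i)) * z (Inl (a, j))"
  have sub: "(\<lambda>a. Inl (a, l)) ` {1..k} \<subseteq> hyb_index k U" if "l \<in> U" for l
    using that by (auto simp: hyb_index_def)
  have "(\<lambda>a. Inl (a, i)) ` {1..k} \<inter> (\<lambda>a. Inl (a, j)) ` {1..k} = ({} :: (nat \<times> 'a + 'a set) set)"
    using ij(2) by auto
  then have S: "(\<integral>\<^sup>+z. ennreal ((?S z) ^ (2 * 2)) \<partial>gauss (hyb_index k U)) =
      ennreal (fact (2 * 2) / (2 ^ 2 * fact 2)) * (\<integral>\<^sup>+z. ennreal ((\<Sum>a=1..k. (z (Inl (a, j)))\<^sup>2) ^ 2) \<partial>gauss (hyb_index k U))"
    using U iU by (intro nn_integral_sum_products finite_hyb_index sub) (auto simp: inj_on_def)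
  have "(hyb k W z e) ^ 4 = (1 / (real k)\<^sup>2) * (?S z) ^ (2 * 2)" for z
  proof -
    have "sqrt (real k) ^ 4 = (real k)\<^sup>2" using power_mult[of "sqrt (real k)" 2 2] by simp
    then show ?thesis using hyb_pair_gram[OF ij(2), of W k z] True by (simp add: ij(1) power_divide)
  qed
  then have "(\<integral>\<^sup>+z. ennreal ((hyb k W z e) ^ 4) \<partial>gauss (hyb_index k U)) =
      (\<integral>\<^sup>+z. ennreal (1 / (real k)\<^sup>2) * ennreal ((?S z) ^ (2 * 2)) \<partial>gauss (hyb_index k U))"
    by (simp only: ennreal_mult' zero_le_divide_1_iff zero_le_power2)
  also have "\<dots> = ennreal (1 / (real k)\<^sup>2) * (\<integral>\<^sup>+z. ennreal ((?S z) ^ (2 * 2)) \<partial>gauss (hyb_index k U))"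
  proof (rule nn_integral_cmult)
    have "(\<lambda>z. ?S z) \<in> borel_measurable (gauss (hyb_index k U))"
      using iU by (intro borel_measurable_sum borel_measurable_times measurable_gauss_component) (auto simp: hyb_index_def)
    then show "(\<lambda>z. ennreal ((?S z) ^ (2 * 2))) \<in> borel_measurable (gauss (hyb_index k U))"
      by (rule measurable_compose) measurable
  qed
  also have "\<dots> \<le> ennreal (1 / (real k)\<^sup>2) * (ennreal 3 * ennreal (3 * (real k)\<^sup>2))"
    unfolding S using nn_integral_sum_squares(2)[OF finite_hyb_index[OF U] sub[OF iU(2)] finite_atLeastAtMost]
    by (intro mult_left_mono) (auto simp: fact_numeral intro!: mult_left_mono)
  also have "\<dots> = 9" using k by (subst ennreal_mult'[symmetric], simp, subst ennreal_mult'[symmetric], simp, simp)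
  finally show ?thesis .
next
  case False
  have "Inr e \<in> hyb_index k U" using e by (auto simp: hyb_index_def)
  then have "(\<integral>\<^sup>+z. ennreal ((z (Inr e)) ^ 4) \<partial>gauss (hyb_index k U)) = 3"
    using nn_integral_gauss_component[OF finite_hyb_index[OF U], of "Inr e" k "\<lambda>t. ennreal (t ^ 4)"]
      nn_integral_std_normal_moment[of 2] by (simp add: fact_numeral)
  then show ?thesis using False by (simp add: hyb_def)
qed

text \<open>In the expansion along \<open>v\<close> each edge weight \<open>w\<^sub>v\<^sub>l\<close> is independent of the hafnian that it
  multiplies, since the latter avoids \<open>v\<close> and \<open>l\<close>. So a bound on the fourth moment of one edge weight,
  uniform in \<open>k\<close> and \<open>W\<close>, propagates by induction; the constant is far from optimal.\<close>

lemma nn_integral_haf_hyb_fourth_power: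
  assumes U: "finite U" and k: "k \<ge> 1" and sub: "U' \<subseteq> U"
  defines "C \<equiv> 9 * (real (card U) + 1) ^ 4"
  shows "(\<integral>\<^sup>+z. ennreal ((haf U' (hyb k W z)) ^ 4) \<partial>gauss (hyb_index k U)) \<le> ennreal (C ^ card U')"
  using sub
proof (induction "card U'" arbitrary: U' rule: less_induct)
  case less
  define N where "N = real (card U) + 1"
  have N: "N \<ge> 1" by (simp add: N_def)
  have C: "C = 9 * N ^ 4" by (simp add: C_def N_def)
  have C1: "C \<ge> 1" unfolding C using one_le_power[OF N, of 4] by linarith
  have fin: "finite U'" using less.prems U finite_subset by blast
  interpret prob_space "gauss (hyb_index k U)" by (rule prob_space_gauss)
  show ?case
  proof (cases "U' = {}")
    case True
    then show ?thesis by (simp add: emeasure_space_1)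
  next
    case False
    then obtain v where v: "v \<in> U'" by auto
    have card: "real (card (U' - {v})) \<le> N"
      using card_mono[OF U, of "U' - {v}"] less.prems by (simp add: N_def) (meson Diff_subset of_nat_mono order_trans le_add_same_cancel1 zero_le_one)
    have cm: "card U' \<ge> 1" using fin v by (metis card_gt_0_iff empty_iff Suc_leI One_nat_def)
    have hm: "(\<lambda>z. ennreal ((hyb k W z {v, l}) ^ 4)) \<in> borel_measurable (gauss (hyb_index k V))"
      if "l \<in> V" "v \<in> V" "l \<noteq> v" for l V
      using that by (intro measurable_compose[OF measurable_hyb]) auto
    have Hm: "(\<lambda>z. ennreal ((haf R (hyb k W z)) ^ 4)) \<in> borel_measurable (gauss (hyb_index k V))"
      if "R \<subseteq> V" for R V
      using that by (intro measurable_compose[OF measurable_haf_hyb]) auto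
    have summand: "(\<integral>\<^sup>+z. ennreal ((hyb k W z {v, l}) ^ 4) * ennreal ((haf (U' - {v, l}) (hyb k W z)) ^ 4) \<partial>gauss (hyb_index k U)) \<le>
        ennreal (9 * C ^ (card U' - 1))" if l: "l \<in> U' - {v}" for l
    proof -
      let ?A = "hyb_index k {v, l}" and ?B = "hyb_index k (U' - {v, l})"
      have AB: "?A \<subseteq> hyb_index k U" "?B \<subseteq> hyb_index k U"
        using l v less.prems by (auto intro!: hyb_index_mono)
      have "edges {v, l} \<inter> edges (U' - {v, l}) = {}"
      proof -
        have False if "e \<in> edges {v, l}" "e \<in> edges (U' - {v, l})" for e
        proof -
          have "e = {}" using that by (auto simp: edges_def)
          then show False using that by (simp add: edges_def)
        qed
        then show ?thesis by blast
      qed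
      then have dis: "?A \<inter> ?B = {}" by (auto simp: hyb_index_def Plus_def)
      have rA: "hyb k W (restrict z ?A) {v, l} = hyb k W z {v, l}" for z
        using l by (intro hyb_cong[where U = "{v, l}"]) auto
      have rB: "haf (U' - {v, l}) (hyb k W (restrict z ?B)) = haf (U' - {v, l}) (hyb k W z)" for z
        by (intro haf_hyb_cong[where k = k]) auto
      have "(\<integral>\<^sup>+z. ennreal ((hyb k W z {v, l}) ^ 4) * ennreal ((haf (U' - {v, l}) (hyb k W z)) ^ 4) \<partial>gauss (hyb_index k U)) =
          (\<integral>\<^sup>+z. ennreal ((hyb k W z {v, l}) ^ 4) \<partial>gauss (hyb_index k U)) *
          (\<integral>\<^sup>+z. ennreal ((haf (U' - {v, l}) (hyb k W z)) ^ 4) \<partial>gauss (hyb_index k U))"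
        using nn_integral_gauss_indep[OF finite_hyb_index[OF U] AB dis hm[of l "{v, l}"] Hm[OF order_refl]] l
        by (simp add: rA rB)
      also have "\<dots> \<le> 9 * ennreal (C ^ card (U' - {v, l}))"
      proof (intro mult_mono)
        show "(\<integral>\<^sup>+z. ennreal ((hyb k W z {v, l}) ^ 4) \<partial>gauss (hyb_index k U)) \<le> 9"
          using l v less.prems by (intro nn_integral_hyb_fourth_power U k) auto
        have "U' - {v, l} \<subset> U'" using v by auto
        then show "(\<integral>\<^sup>+z. ennreal ((haf (U' - {v, l}) (hyb k W z)) ^ 4) \<partial>gauss (hyb_index k U)) \<le> ennreal (C ^ card (U' - {v, l}))"
          using less.prems fin by (intro less.hyps psubset_card_mono) auto
      qed auto
      also have "\<dots> \<le> 9 * ennreal (C ^ (card U' - 1))"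
      proof -
        have "card (U' - {v, l}) \<le> card (U' - {v})" using fin by (intro card_mono) auto
        then have "card (U' - {v, l}) \<le> card U' - 1" using v fin by (simp add: card_Diff_singleton)
        then show ?thesis using C1 by (intro mult_left_mono ennreal_leI power_increasing) auto
      qed
      also have "\<dots> = ennreal (9 * C ^ (card U' - 1))" by (simp add: ennreal_mult')
      finally show ?thesis .
    qed
    have "(\<integral>\<^sup>+z. ennreal ((haf U' (hyb k W z)) ^ 4) \<partial>gauss (hyb_index k U)) \<le>
        (\<integral>\<^sup>+z. ennreal (N ^ 3) * (\<Sum>l\<in>U' - {v}. ennreal ((hyb k W z {v, l}) ^ 4) * ennreal ((haf (U' - {v, l}) (hyb k W z)) ^ 4)) \<partial>gauss (hyb_index k U))"
    proof (intro nn_integral_mono)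
      fix z
      have "(haf U' (hyb k W z)) ^ 4 \<le> N ^ 3 * (\<Sum>l\<in>U' - {v}. (hyb k W z {v, l} * haf (U' - {v, l}) (hyb k W z)) ^ 4)"
        unfolding haf_expand[OF fin v] using fin card by (intro sum_fourth_power_le) auto
      then have "ennreal ((haf U' (hyb k W z)) ^ 4) \<le> ennreal (N ^ 3 * (\<Sum>l\<in>U' - {v}. (hyb k W z {v, l}) ^ 4 * (haf (U' - {v, l}) (hyb k W z)) ^ 4))"
        by (intro ennreal_leI) (simp add: power_mult_distrib)
      also have "\<dots> = ennreal (N ^ 3) * (\<Sum>l\<in>U' - {v}. ennreal ((hyb k W z {v, l}) ^ 4) * ennreal ((haf (U' - {v, l}) (hyb k W z)) ^ 4))"
        using N by (simp add: ennreal_mult' sum_ennreal[symmetric])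
      finally show "ennreal ((haf U' (hyb k W z)) ^ 4) \<le> \<dots>" .
    qed
    also have "\<dots> = ennreal (N ^ 3) * (\<Sum>l\<in>U' - {v}. \<integral>\<^sup>+z. ennreal ((hyb k W z {v, l}) ^ 4) * ennreal ((haf (U' - {v, l}) (hyb k W z)) ^ 4) \<partial>gauss (hyb_index k U))"
    proof -
      have m: "(\<lambda>z. ennreal ((hyb k W z {v, l}) ^ 4) * ennreal ((haf (U' - {v, l}) (hyb k W z)) ^ 4)) \<in> borel_measurable (gauss (hyb_index k U))"
        if "l \<in> U' - {v}" for l
        using that v less.prems by (intro borel_measurable_times_ennreal hm Hm) auto
      show ?thesis by (simp only: nn_integral_cmult[OF borel_measurable_sum[OF m]] nn_integral_sum[OF m])
    qed
    also have "\<dots> \<le> ennreal (N ^ 3) * (\<Sum>l\<in>U' - {v}. ennreal (9 * C ^ (card U' - 1)))"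
      by (intro mult_left_mono sum_mono summand) auto
    also have "\<dots> = ennreal (N ^ 3 * (real (card (U' - {v})) * (9 * C ^ (card U' - 1))))"
      using N by (simp add: ennreal_mult' ennreal_of_nat_eq_real_of_nat)
    also have "\<dots> \<le> ennreal (N ^ 3 * (N * (9 * C ^ (card U' - 1))))"
      using N C1 card by (intro ennreal_leI mult_left_mono mult_right_mono) auto
    also have "N ^ 3 * (N * (9 * C ^ (card U' - 1))) = C * C ^ (card U' - 1)"
      using power_Suc2[of N 3] by (simp add: C)
    also have "C * C ^ (card U' - 1) = C ^ card U'" using cm by (simp add: power_eq_if)
    finally show ?thesis .
  qed
qed

definition gram_error :: "nat \<Rightarrow> (nat \<times> 'v + 'v set \<Rightarrow> real) \<Rightarrow> 'v \<Rightarrow> 'v \<Rightarrow> real" where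
  "gram_error k x l m = (\<Sum>a=1..k. x (Inl (a, l)) * x (Inl (a, m))) / real k - (if l = m then 1 else 0)"

lemma measurable_gram_error:
  assumes "l \<in> U" "m \<in> U"
  shows "(\<lambda>x. gram_error k x l m) \<in> borel_measurable (gauss (hyb_index k U))"
  unfolding gram_error_def using assms
  by (intro borel_measurable_diff borel_measurable_divide borel_measurable_sum borel_measurable_times
      borel_measurable_const measurable_gauss_component) (auto simp: hyb_index_def)

lemma nn_integral_gram_error_square:
  assumes U: "finite U" and lm: "l \<in> U" "m \<in> U" and k: "k \<ge> 1"
  shows "(\<integral>\<^sup>+x. ennreal ((gram_error k x l m)\<^sup>2) \<partial>gauss (hyb_index k U)) \<le> ennreal (2 / real k)"
proof -
  let ?I = "hyb_index k U"
  have sub: "(\<lambda>a. Inl (a, l)) ` {1..k} \<subseteq> ?I" if "l \<in> U" for l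
    using that by (auto simp: hyb_index_def)
  have inj: "inj_on (\<lambda>a. Inl (a, l)) {1..k}" for l :: 'a by (auto simp: inj_on_def)
  have main: "(\<integral>\<^sup>+x. ennreal ((gram_error k x l m)\<^sup>2) \<partial>gauss ?I) = ennreal (c * real k / (real k)\<^sup>2)"
    if m: "S \<in> borel_measurable (gauss ?I)" and g: "\<And>x. gram_error k x l m = S x / real k"
      and S: "(\<integral>\<^sup>+x. ennreal ((S x)\<^sup>2) \<partial>gauss ?I) = ennreal (c * real k)" and c: "c \<ge> 0" for S c
  proof -
    have "(\<integral>\<^sup>+x. ennreal ((gram_error k x l m)\<^sup>2) \<partial>gauss ?I) = (\<integral>\<^sup>+x. ennreal (1 / (real k)\<^sup>2) * ennreal ((S x)\<^sup>2) \<partial>gauss ?I)"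
      unfolding g by (simp add: power_divide ennreal_mult'[symmetric])
    also have "\<dots> = ennreal (1 / (real k)\<^sup>2) * (\<integral>\<^sup>+x. ennreal ((S x)\<^sup>2) \<partial>gauss ?I)"
      by (rule nn_integral_cmult) (rule measurable_compose[OF m], measurable)
    also have "\<dots> = ennreal (c * real k / (real k)\<^sup>2)" unfolding S by (simp add: ennreal_mult'[symmetric])
    finally show ?thesis .
  qed
  have kk: "real k > 0" using k by simp
  show ?thesis
  proof (cases "l = m")
    case False
    let ?S = "\<lambda>x. \<Sum>a=1..k. x (Inl (a, l)) * x (Inl (a, m))"
    have "(\<lambda>a. Inl (a, l)) ` {1..k} \<inter> (\<lambda>a. Inl (a, m)) ` {1..k} = ({} :: (nat \<times> 'a + 'a set) set)"
      using False by auto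
    then have "(\<integral>\<^sup>+x. ennreal ((?S x) ^ (2 * 1)) \<partial>gauss ?I) =
        ennreal (fact (2 * 1) / (2 ^ 1 * fact 1)) * (\<integral>\<^sup>+z. ennreal ((\<Sum>a=1..k. (z (Inl (a, m)))\<^sup>2) ^ 1) \<partial>gauss ?I)"
      using U lm by (intro nn_integral_sum_products finite_hyb_index sub inj) auto
    also have "\<dots> = ennreal (1 * real k)"
      using nn_integral_sum_squares(1)[OF finite_hyb_index[OF U] sub[OF lm(2)] finite_atLeastAtMost] by simp
    finally have S: "(\<integral>\<^sup>+x. ennreal ((?S x)\<^sup>2) \<partial>gauss ?I) = ennreal (1 * real k)" by simp
    have m: "?S \<in> borel_measurable (gauss ?I)"
      using lm by (intro borel_measurable_sum borel_measurable_times measurable_gauss_component) (auto simp: hyb_index_def)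
    have "(\<integral>\<^sup>+x. ennreal ((gram_error k x l m)\<^sup>2) \<partial>gauss ?I) = ennreal (1 * real k / (real k)\<^sup>2)"
      by (rule main[OF m _ S]) (use False in \<open>auto simp: gram_error_def\<close>)
    also have "\<dots> \<le> ennreal (2 / real k)"
      using kk by (intro ennreal_leI) (simp add: power2_eq_square divide_right_mono)
    finally show ?thesis .
  next
    case True
    let ?S = "\<lambda>x. \<Sum>a=1..k. (x (Inl (a, l)))\<^sup>2 - 1"
    have "(\<integral>\<^sup>+x. ennreal ((\<Sum>a\<in>{1..k}. ((\<lambda>a\<in>{1..k}. x (Inl (a, l))) a)\<^sup>2 - 1)\<^sup>2) \<partial>gauss ?I) = ennreal (2 * real (card {1..k}))"
      unfolding nn_integral_centred_sum_squares[OF finite_atLeastAtMost, symmetric]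
      by (rule nn_integral_gauss_reindex[OF inj sub[OF lm(1)]]) measurable
    moreover have "(\<Sum>a\<in>{1..k}. ((\<lambda>a\<in>{1..k}. x (Inl (a, l))) a)\<^sup>2 - 1) = ?S x"
      for x :: "nat \<times> 'a + 'a set \<Rightarrow> real"
      by (intro sum.cong) auto
    ultimately have S: "(\<integral>\<^sup>+x. ennreal ((?S x)\<^sup>2) \<partial>gauss ?I) = ennreal (2 * real k)"
      by (simp only: card_atLeastAtMost add_diff_cancel_right' diff_Suc_1 Suc_eq_plus1)
    have m: "?S \<in> borel_measurable (gauss ?I)"
      using lm by (intro borel_measurable_sum borel_measurable_diff borel_measurable_power borel_measurable_const measurable_gauss_component) (auto simp: hyb_index_def)
    have "gram_error k x l m = ?S x / real k" for x
      using True kk by (simp add: gram_error_def sum_subtractf power2_eq_square diff_divide_distrib)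
    then have "(\<integral>\<^sup>+x. ennreal ((gram_error k x l m)\<^sup>2) \<partial>gauss ?I) = ennreal (2 * real k / (real k)\<^sup>2)"
      by (intro main[OF m _ S]) auto
    then show ?thesis using kk by (simp add: power2_eq_square)
  qed
qed

text \<open>The variables attached to \<open>v\<close> are the \<open>k\<close> coordinates of its vector and the fresh variables of the
  edges at \<open>v\<close>; the remaining ones form the index set of \<open>U\<close>.\<close>

definition split_code :: "'v \<Rightarrow> nat \<times> 'v + 'v set \<Rightarrow> (nat \<times> 'v + 'v set) + (nat + 'v)" where
  "split_code v i = (case i of
     Inl p \<Rightarrow> if snd p = v then Inr (Inl (fst p)) else Inl i
   | Inr e \<Rightarrow> (case star_code v e of Inl e \<Rightarrow> Inl (Inr e) | Inr l \<Rightarrow> Inr (Inr l)))"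

lemma bij_split_code:
  assumes v: "v \<notin> U"
  shows "bij_betw (split_code v) (hyb_index k (insert v U)) (hyb_index k U <+> ({1..k} <+> U))"
proof (rule bij_betwI[where g = "case_sum id (case_sum (\<lambda>a. Inl (a, v)) (\<lambda>l. Inr {v, l}))"])
  note bij = bij_star_code[OF v]
  have star: "star_code v e \<in> edges U <+> U" if "e \<in> edges (insert v U)" for e
    using bij that by (auto simp: bij_betw_def)
  have inv: "case_sum id (\<lambda>l. {v, l}) (star_code v e) = e" if e: "e \<in> edges (insert v U)" for e
  proof (cases "v \<in> e")
    case True
    then obtain l where l: "e = {v, l}" "l \<noteq> v" using e by (auto simp: edges_def card_2_iff)
    then show ?thesis by (simp add: star_code_pair)
  qed (simp add: star_code_def)
  show "split_code v \<in> hyb_index k (insert v U) \<rightarrow> hyb_index k U <+> ({1..k} <+> U)"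
  proof
    fix i assume "i \<in> hyb_index k (insert v U)"
    then consider a j where "i = Inl (a, j)" "a \<in> {1..k}" "j \<in> insert v U" | e where "i = Inr e" "e \<in> edges (insert v U)"
      by (auto simp: hyb_index_def)
    then show "split_code v i \<in> hyb_index k U <+> ({1..k} <+> U)"
    proof cases
      case 1
      then show ?thesis by (auto simp: split_code_def hyb_index_def)
    next
      case 2
      then show ?thesis using star[OF 2(2)] by (auto simp: split_code_def hyb_index_def)
    qed
  qed
  show "case_sum id (case_sum (\<lambda>a. Inl (a, v)) (\<lambda>l. Inr {v, l})) \<in> hyb_index k U <+> ({1..k} <+> U) \<rightarrow> hyb_index k (insert v U)"
  proof
    fix y assume "y \<in> hyb_index k U <+> ({1..k} <+> U)"
    then show "case_sum id (case_sum (\<lambda>a. Inl (a, v)) (\<lambda>l. Inr {v, l})) y \<in> hyb_index k (insert v U)"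
      using v subsetD[OF edges_mono[OF subset_insertI]] by (auto simp: hyb_index_def)
  qed
  show "case_sum id (case_sum (\<lambda>a. Inl (a, v)) (\<lambda>l. Inr {v, l})) (split_code v x) = x" if x: "x \<in> hyb_index k (insert v U)" for x
  proof (cases x)
    case (Inl p)
    then show ?thesis by (cases p) (auto simp: split_code_def)
  next
    case (Inr e)
    then have "e \<in> edges (insert v U)" using x by (auto simp: hyb_index_def)
    from inv[OF this] show ?thesis using Inr by (auto simp: split_code_def split: sum.splits)
  qed
  show "split_code v (case_sum id (case_sum (\<lambda>a. Inl (a, v)) (\<lambda>l. Inr {v, l})) y) = y" if y: "y \<in> hyb_index k U <+> ({1..k} <+> U)" for y
  proof -
    consider a j where "y = Inl (Inl (a, j))" "j \<in> U" | e where "y = Inl (Inr e)" "e \<in> edges U"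
      | a where "y = Inr (Inl a)" | l where "y = Inr (Inr l)" "l \<in> U"
      using y by (auto simp: hyb_index_def)
    then show ?thesis
    proof cases
      case 1
      then have "j \<noteq> v" using v by auto
      then show ?thesis using 1 by (simp add: split_code_def)
    next
      case 2
      then have "v \<notin> e" using v by (auto simp: edges_def)
      then show ?thesis using 2 by (simp add: split_code_def star_code_def)
    next
      case 3
      then show ?thesis by (simp add: split_code_def)
    next
      case 4
      then have "l \<noteq> v" using v by auto
      then show ?thesis using 4 by (simp add: split_code_def star_code_pair)
    qed
  qed
qed

definition add_vertex :: "nat \<Rightarrow> 'v \<Rightarrow> 'v set \<Rightarrow> (nat \<times> 'v + 'v set \<Rightarrow> real) \<Rightarrow> (nat + 'v \<Rightarrow> real) \<Rightarrow> nat \<times> 'v + 'v set \<Rightarrow> real" where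
  "add_vertex k v U = assemble (split_code v) (hyb_index k (insert v U))"

lemma add_vertex_simps:
  assumes v: "v \<notin> U"
  shows "p \<in> hyb_index k U \<Longrightarrow> add_vertex k v U x y p = x p"
    and "a \<in> {1..k} \<Longrightarrow> add_vertex k v U x y (Inl (a, v)) = y (Inl a)"
    and "l \<in> U \<Longrightarrow> add_vertex k v U x y (Inr {v, l}) = y (Inr l)"
proof -
  show "add_vertex k v U x y p = x p" if p: "p \<in> hyb_index k U"
  proof -
    have "p \<in> hyb_index k (insert v U)" using hyb_index_mono[of U "insert v U" k] p by blast
    moreover have "split_code v p = Inl p"
    proof (cases p)
      case (Inl q)
      then have "snd q \<noteq> v" using p v by (auto simp: hyb_index_def)
      then show ?thesis using Inl by (simp add: split_code_def)
    next
      case (Inr e)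
      then have "v \<notin> e" using p v by (auto simp: hyb_index_def edges_def)
      then show ?thesis using Inr by (simp add: split_code_def star_code_def)
    qed
    ultimately show ?thesis by (simp add: add_vertex_def assemble_def)
  qed
  show "add_vertex k v U x y (Inl (a, v)) = y (Inl a)" if "a \<in> {1..k}"
  proof -
    have "Inl (a, v) \<in> hyb_index k (insert v U)" using that by (auto simp: hyb_index_def)
    then show ?thesis by (simp add: add_vertex_def assemble_def split_code_def)
  qed
  show "add_vertex k v U x y (Inr {v, l}) = y (Inr l)" if "l \<in> U"
  proof -
    have "l \<noteq> v" using that v by auto
    moreover have "Inr {v, l} \<in> hyb_index k (insert v U)" using that calculation by (auto simp: hyb_index_def)
    ultimately show ?thesis by (simp add: add_vertex_def assemble_def split_code_def star_code_pair)
  qed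
qed

lemma haf_hyb_add_vertex_old:
  assumes v: "v \<notin> U" and U': "U' \<subseteq> U"
  shows "haf U' (hyb k W (add_vertex k v U x y)) = haf U' (hyb k W x)"
proof (rule haf_hyb_cong)
  fix p assume "p \<in> hyb_index k U'"
  then have "p \<in> hyb_index k U" using hyb_index_mono[OF U'] by blast
  then show "add_vertex k v U x y p = x p" by (rule add_vertex_simps(1)[OF v])
qed

lemma haf_hyb_insert_old:
  assumes v: "v \<notin> U" and U': "U' \<subseteq> U"
  shows "haf U' (hyb k (insert v W) x) = haf U' (hyb k W x)"
proof (rule haf_cong)
  fix e assume "e \<in> edges U'"
  then have "v \<notin> e" using v U' by (auto simp: edges_def)
  then show "hyb k (insert v W) x e = hyb k W x e" by (simp add: hyb_def subset_insert)
qed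

text \<open>The coefficients of the hafnian on \<open>insert v U\<close> as a linear form in the variables attached to \<open>v\<close>,
  when \<open>v\<close> belongs to the Gram part.\<close>

definition row_form :: "nat \<Rightarrow> 'v set \<Rightarrow> 'v set \<Rightarrow> (nat \<times> 'v + 'v set \<Rightarrow> real) \<Rightarrow> nat + 'v \<Rightarrow> real" where
  "row_form k U W x = case_sum
     (\<lambda>a. (\<Sum>l\<in>W. x (Inl (a, l)) * haf (U - {l}) (hyb k W x)) / sqrt (real k))
     (\<lambda>l. if l \<in> W then 0 else haf (U - {l}) (hyb k W x))"

lemma haf_hyb_add_vertex:
  assumes U: "finite U" and v: "v \<notin> U" and W: "W \<subseteq> U"
  shows "haf (insert v U) (hyb k (insert v W) (add_vertex k v U x y)) =
      (\<Sum>p\<in>{1..k} <+> U. row_form k U W x p * y p)"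
    and "haf (insert v U) (hyb k W (add_vertex k v U x y)) =
      (\<Sum>p\<in>U. haf (U - {p}) (hyb k W x) * y (Inr p))"
proof -
  let ?z = "add_vertex k v U x y"
  have finW: "finite W" using W U finite_subset by blast
  have old: "haf (U - {l}) (hyb k W ?z) = haf (U - {l}) (hyb k W x)"
    "haf (U - {l}) (hyb k (insert v W) ?z) = haf (U - {l}) (hyb k W x)" for l
  proof -
    show 1: "haf (U - {l}) (hyb k W ?z) = haf (U - {l}) (hyb k W x)"
      by (rule haf_hyb_add_vertex_old[OF v]) blast
    have "haf (U - {l}) (hyb k (insert v W) ?z) = haf (U - {l}) (hyb k W ?z)"
      by (rule haf_hyb_insert_old[OF v]) blast
    then show "haf (U - {l}) (hyb k (insert v W) ?z) = haf (U - {l}) (hyb k W x)" using 1 by simp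
  qed
  have fresh: "hyb k W' ?z {v, l} = y (Inr l)" if "l \<in> U" "\<not> {v, l} \<subseteq> W'" for l W'
    using that(2) add_vertex_simps(3)[OF v that(1)] by (simp only: hyb_def if_False)
  have gram: "hyb k (insert v W) ?z {v, l} = (\<Sum>a=1..k. y (Inl a) * x (Inl (a, l))) / sqrt (real k)" if l: "l \<in> W" for l
  proof -
    have lv: "v \<noteq> l" "l \<in> U" using l W v by auto
    have "?z (Inl (a, v)) * ?z (Inl (a, l)) = y (Inl a) * x (Inl (a, l))" if "a \<in> {1..k}" for a
    proof -
      have "Inl (a, l) \<in> hyb_index k U" using that lv by (auto simp: hyb_index_def)
      then show ?thesis using add_vertex_simps(1,2)[OF v] that by simp
    qed
    then have "(\<Sum>a=1..k. ?z (Inl (a, v)) * ?z (Inl (a, l))) = (\<Sum>a=1..k. y (Inl a) * x (Inl (a, l)))"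
      by (rule sum.cong[OF refl])
    then show ?thesis using hyb_pair_gram[OF lv(1), of "insert v W" k ?z] l by simp
  qed
  show "haf (insert v U) (hyb k W ?z) = (\<Sum>p\<in>U. haf (U - {p}) (hyb k W x) * y (Inr p))"
  proof -
    have "v \<notin> W" using v W by auto
    then show ?thesis unfolding haf_expand_insert[OF U v] old
      by (intro sum.cong refl) (simp add: fresh mult.commute)
  qed
  have "haf (insert v U) (hyb k (insert v W) ?z) =
      (\<Sum>l\<in>U. hyb k (insert v W) ?z {v, l} * haf (U - {l}) (hyb k W x))"
    unfolding haf_expand_insert[OF U v] old ..
  also have "\<dots> = (\<Sum>l\<in>W. hyb k (insert v W) ?z {v, l} * haf (U - {l}) (hyb k W x)) +
      (\<Sum>l\<in>U - W. hyb k (insert v W) ?z {v, l} * haf (U - {l}) (hyb k W x))"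
    using sum.subset_diff[OF W U, of "\<lambda>l. hyb k (insert v W) ?z {v, l} * haf (U - {l}) (hyb k W x)"] by simp
  also have "(\<Sum>l\<in>W. hyb k (insert v W) ?z {v, l} * haf (U - {l}) (hyb k W x)) =
      (\<Sum>l\<in>W. \<Sum>a=1..k. y (Inl a) * x (Inl (a, l)) * haf (U - {l}) (hyb k W x) / sqrt (real k))"
    by (intro sum.cong refl) (simp add: gram sum_distrib_right sum_divide_distrib)
  also have "\<dots> = (\<Sum>a=1..k. row_form k U W x (Inl a) * y (Inl a))"
    by (subst sum.swap) (simp add: row_form_def sum_distrib_left sum_distrib_right sum_divide_distrib mult_ac)
  also have "(\<Sum>l\<in>U - W. hyb k (insert v W) ?z {v, l} * haf (U - {l}) (hyb k W x)) = (\<Sum>l\<in>U. row_form k U W x (Inr l) * y (Inr l))"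
  proof -
    have "(\<Sum>l\<in>U. row_form k U W x (Inr l) * y (Inr l)) = (\<Sum>l\<in>U - W. row_form k U W x (Inr l) * y (Inr l))"
      using U by (intro sum.mono_neutral_right) (auto simp: row_form_def)
    also have "\<dots> = (\<Sum>l\<in>U - W. hyb k (insert v W) ?z {v, l} * haf (U - {l}) (hyb k W x))"
    proof (intro sum.cong refl)
      fix l assume l: "l \<in> U - W"
      then have "l \<noteq> v" using v by auto
      then have "\<not> {v, l} \<subseteq> insert v W" using l by auto
      then show "row_form k U W x (Inr l) * y (Inr l) = hyb k (insert v W) ?z {v, l} * haf (U - {l}) (hyb k W x)"
        using l by (simp add: row_form_def fresh mult.commute)
    qed
    finally show ?thesis by simp
  qed
  finally show "haf (insert v U) (hyb k (insert v W) ?z) = (\<Sum>p\<in>{1..k} <+> U. row_form k U W x p * y p)"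
    using U by (simp add: sum.Plus)
qed

text \<open>The Gram part contributes \<open>\<bar>\<Sum> h\<^sub>l x\<^sub>l\<bar>\<^sup>2 / k\<close> to the conditional variance instead of
  \<open>\<Sum> h\<^sub>l\<^sup>2\<close>.\<close>

lemma row_form_variance:
  assumes U: "finite U" and W: "W \<subseteq> U" and k: "k \<ge> 1"
  shows "(\<Sum>p\<in>{1..k} <+> U. (row_form k U W x p)\<^sup>2) - (\<Sum>l\<in>U. (haf (U - {l}) (hyb k W x))\<^sup>2) =
    (\<Sum>l\<in>W. \<Sum>m\<in>W. haf (U - {l}) (hyb k W x) * haf (U - {m}) (hyb k W x) * gram_error k x l m)"
proof -
  define h where "h l = haf (U - {l}) (hyb k W x)" for l
  have finW: "finite W" using W U finite_subset by blast
  have kk: "real k > 0" using k by simp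
  have "(\<Sum>p\<in>{1..k} <+> U. (row_form k U W x p)\<^sup>2) =
      (\<Sum>a=1..k. ((\<Sum>l\<in>W. x (Inl (a, l)) * h l) / sqrt (real k))\<^sup>2) + (\<Sum>l\<in>U. (if l \<in> W then 0 else h l)\<^sup>2)"
    unfolding row_form_def h_def using U by (simp add: sum.Plus)
  also have "(\<Sum>l\<in>U. (if l \<in> W then 0 else h l)\<^sup>2) = (\<Sum>l\<in>U - W. (h l)\<^sup>2)"
    using U by (intro sum.mono_neutral_cong_right) auto
  also have "(\<Sum>a=1..k. ((\<Sum>l\<in>W. x (Inl (a, l)) * h l) / sqrt (real k))\<^sup>2) =
      (\<Sum>a=1..k. \<Sum>l\<in>W. \<Sum>m\<in>W. h l * h m * (x (Inl (a, l)) * x (Inl (a, m)) / real k))"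
  proof (intro sum.cong refl)
    fix a
    have "((\<Sum>l\<in>W. x (Inl (a, l)) * h l) / sqrt (real k))\<^sup>2 = (\<Sum>l\<in>W. x (Inl (a, l)) * h l) * (\<Sum>l\<in>W. x (Inl (a, l)) * h l) / real k"
      using kk by (simp add: power_divide power2_eq_square)
    also have "\<dots> = (\<Sum>l\<in>W. \<Sum>m\<in>W. h l * h m * (x (Inl (a, l)) * x (Inl (a, m)) / real k))"
      unfolding sum_product sum_divide_distrib by (intro sum.cong refl) (simp add: mult_ac)
    finally show "((\<Sum>l\<in>W. x (Inl (a, l)) * h l) / sqrt (real k))\<^sup>2 =
      (\<Sum>l\<in>W. \<Sum>m\<in>W. h l * h m * (x (Inl (a, l)) * x (Inl (a, m)) / real k))" .
  qed
  also have "\<dots> = (\<Sum>l\<in>W. \<Sum>m\<in>W. h l * h m * (gram_error k x l m + (if l = m then 1 else 0)))"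
  proof -
    have "(\<Sum>a=1..k. \<Sum>l\<in>W. \<Sum>m\<in>W. h l * h m * (x (Inl (a, l)) * x (Inl (a, m)) / real k)) =
        (\<Sum>l\<in>W. \<Sum>m\<in>W. \<Sum>a=1..k. h l * h m * (x (Inl (a, l)) * x (Inl (a, m)) / real k))"
      by (subst sum.swap, rule sum.cong[OF refl], rule sum.swap)
    then show ?thesis
      by (simp add: gram_error_def sum_distrib_left[symmetric] sum_divide_distrib[symmetric])
  qed
  also have "\<dots> = (\<Sum>l\<in>W. \<Sum>m\<in>W. h l * h m * gram_error k x l m) + (\<Sum>l\<in>W. (h l)\<^sup>2)"
  proof -
    have "(\<Sum>m\<in>W. h l * h m * (if l = m then 1 else 0)) = (h l)\<^sup>2" if "l \<in> W" for l
    proof -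
      have "(\<Sum>m\<in>W. h l * h m * (if l = m then 1 else 0)) = (\<Sum>m\<in>W. if l = m then h l * h m else 0)"
        by (intro sum.cong refl) auto
      then show ?thesis using finW that by (simp add: power2_eq_square)
    qed
    then show ?thesis by (simp add: ring_distribs sum.distrib)
  qed
  finally show ?thesis
    using sum.subset_diff[OF W U, of "\<lambda>l. (h l)\<^sup>2"] by (simp add: h_def)
qed

definition hyb_const :: "nat \<Rightarrow> real" where
  "hyb_const c = (real c + 1)\<^sup>2 * (2 * (9 * (real c + 1) ^ 4) ^ c + 2)"

lemma hyb_const_nonneg: "hyb_const c \<ge> 0"
  unfolding hyb_const_def by (intro mult_nonneg_nonneg add_nonneg_nonneg zero_le_power) auto

lemma abs_product_error_le:
  fixes p q e s :: real
  assumes s: "s > 0"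
  shows "\<bar>p * q * e\<bar> \<le> (p ^ 4 + q ^ 4) / s + s * e\<^sup>2"
proof -
  have am: "2 * (a * b) \<le> a\<^sup>2 + b\<^sup>2" for a b :: real
    using zero_le_power2[of "a - b"] by (simp add: power2_eq_square algebra_simps)
  have "2 * \<bar>p * q * e\<bar> = 2 * ((\<bar>p * q\<bar> / sqrt s) * (sqrt s * \<bar>e\<bar>))"
    using s by (simp add: abs_mult)
  also have "\<dots> \<le> (\<bar>p * q\<bar> / sqrt s)\<^sup>2 + (sqrt s * \<bar>e\<bar>)\<^sup>2" by (rule am)
  also have "\<dots> = (p\<^sup>2 * q\<^sup>2) / s + s * e\<^sup>2"
    using s by (simp add: power_divide power_mult_distrib)
  also have "\<dots> \<le> (p ^ 4 + q ^ 4) / s + s * e\<^sup>2"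
  proof -
    have "2 * (p\<^sup>2 * q\<^sup>2) \<le> p ^ 4 + q ^ 4" using am[of "p\<^sup>2" "q\<^sup>2"] by (simp add: power_mult[symmetric])
    moreover have "p\<^sup>2 * q\<^sup>2 \<ge> 0" by simp
    ultimately have "p\<^sup>2 * q\<^sup>2 \<le> p ^ 4 + q ^ 4" by linarith
    then show ?thesis using s by (intro add_right_mono divide_right_mono) auto
  qed
  finally show ?thesis using abs_ge_zero[of "p * q * e"] by linarith
qed

text \<open>The fourth moments of the hafnians are bounded, and the mean square of \<open>gram_error\<close> is at most
  \<open>2 / k\<close>. The weighted inequality between arithmetic and geometric means with weight \<open>sqrt k\<close> balances
  these two bounds.\<close>

lemma nn_integral_variance_error:
  assumes U: "finite U" and W: "W \<subseteq> U" and k: "k \<ge> 1"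
  shows "(\<integral>\<^sup>+x. ennreal \<bar>(\<Sum>p\<in>{1..k} <+> U. (row_form k U W x p)\<^sup>2) - (\<Sum>l\<in>U. (haf (U - {l}) (hyb k W x))\<^sup>2)\<bar> \<partial>gauss (hyb_index k U))
    \<le> ennreal (hyb_const (card U) / sqrt (real k))"
proof -
  define h where "h l x = haf (U - {l}) (hyb k W x)" for l x
  define N where "N = real (card U) + 1"
  define M where "M = (9 * N ^ 4) ^ card U"
  define s where "s = sqrt (real k)"
  have s: "s > 0" "s * s = real k" using k by (auto simp: s_def)
  have finW: "finite W" using W U finite_subset by blast
  have N1: "N \<ge> 1" by (simp add: N_def)
  have c1: "9 * N ^ 4 \<ge> 1" using one_le_power[OF N1, of 4] by linarith
  have M0: "M \<ge> 0" unfolding M_def using c1 by (intro zero_le_power) auto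
  have hm: "(\<lambda>x. ennreal ((h l x) ^ 4)) \<in> borel_measurable (gauss (hyb_index k U))" for l
    unfolding h_def by (intro measurable_compose[OF measurable_haf_hyb]) auto
  have em: "(\<lambda>x. ennreal ((gram_error k x l m)\<^sup>2)) \<in> borel_measurable (gauss (hyb_index k U))"
    if "l \<in> W" "m \<in> W" for l m
    using that W by (intro measurable_compose[OF measurable_gram_error]) auto
  have h4: "(\<integral>\<^sup>+x. ennreal ((h l x) ^ 4) \<partial>gauss (hyb_index k U)) \<le> ennreal M" for l
  proof -
    have "(\<integral>\<^sup>+x. ennreal ((h l x) ^ 4) \<partial>gauss (hyb_index k U)) \<le> ennreal ((9 * N ^ 4) ^ card (U - {l}))"
      unfolding h_def N_def by (rule nn_integral_haf_hyb_fourth_power[OF U k]) blast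
    also have "\<dots> \<le> ennreal M"
      unfolding M_def using c1 U by (intro ennreal_leI power_increasing card_mono) auto
    finally show ?thesis .
  qed
  have "(\<integral>\<^sup>+x. ennreal \<bar>(\<Sum>p\<in>{1..k} <+> U. (row_form k U W x p)\<^sup>2) - (\<Sum>l\<in>U. (haf (U - {l}) (hyb k W x))\<^sup>2)\<bar> \<partial>gauss (hyb_index k U)) \<le>
      (\<integral>\<^sup>+x. (\<Sum>l\<in>W. \<Sum>m\<in>W. ennreal (1 / s) * (ennreal ((h l x) ^ 4) + ennreal ((h m x) ^ 4)) +
        ennreal s * ennreal ((gram_error k x l m)\<^sup>2)) \<partial>gauss (hyb_index k U))"
  proof (intro nn_integral_mono)
    fix x
    have "\<bar>\<Sum>l\<in>W. \<Sum>m\<in>W. h l x * h m x * gram_error k x l m\<bar> \<le>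
        (\<Sum>l\<in>W. \<Sum>m\<in>W. \<bar>h l x * h m x * gram_error k x l m\<bar>)"
      by (rule order_trans[OF sum_abs sum_mono[OF sum_abs]])
    also have "\<dots> \<le> (\<Sum>l\<in>W. \<Sum>m\<in>W. ((h l x) ^ 4 + (h m x) ^ 4) / s + s * (gram_error k x l m)\<^sup>2)"
      by (intro sum_mono abs_product_error_le s)
    finally have "ennreal \<bar>\<Sum>l\<in>W. \<Sum>m\<in>W. h l x * h m x * gram_error k x l m\<bar> \<le>
        ennreal (\<Sum>l\<in>W. \<Sum>m\<in>W. ((h l x) ^ 4 + (h m x) ^ 4) / s + s * (gram_error k x l m)\<^sup>2)"
      by (rule ennreal_leI)
    also have "\<dots> = (\<Sum>l\<in>W. \<Sum>m\<in>W. ennreal (((h l x) ^ 4 + (h m x) ^ 4) / s + s * (gram_error k x l m)\<^sup>2))"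
      using s by (subst sum_ennreal[symmetric], intro sum_nonneg, simp, intro sum.cong refl, subst sum_ennreal[symmetric]) auto
    also have "\<dots> = (\<Sum>l\<in>W. \<Sum>m\<in>W. ennreal (1 / s) * (ennreal ((h l x) ^ 4) + ennreal ((h m x) ^ 4)) +
        ennreal s * ennreal ((gram_error k x l m)\<^sup>2))"
    proof (intro sum.cong refl)
      fix l m
      have "((h l x) ^ 4 + (h m x) ^ 4) / s + s * (gram_error k x l m)\<^sup>2 = 1 / s * ((h l x) ^ 4 + (h m x) ^ 4) + s * (gram_error k x l m)\<^sup>2"
        by simp
      then show "ennreal (((h l x) ^ 4 + (h m x) ^ 4) / s + s * (gram_error k x l m)\<^sup>2) =
          ennreal (1 / s) * (ennreal ((h l x) ^ 4) + ennreal ((h m x) ^ 4)) + ennreal s * ennreal ((gram_error k x l m)\<^sup>2)"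
        using s by (simp only: ennreal_plus ennreal_mult' zero_le_mult_iff less_imp_le zero_le_power2 zero_le_even_power'
            zero_le_divide_1_iff add_nonneg_nonneg even_numeral zero_le_even_power simp_thms)
    qed
    finally show "ennreal \<bar>(\<Sum>p\<in>{1..k} <+> U. (row_form k U W x p)\<^sup>2) - (\<Sum>l\<in>U. (haf (U - {l}) (hyb k W x))\<^sup>2)\<bar> \<le> \<dots>"
      unfolding row_form_variance[OF U W k] h_def .
  qed
  also have "\<dots> = (\<Sum>l\<in>W. \<Sum>m\<in>W. ennreal (1 / s) * ((\<integral>\<^sup>+x. ennreal ((h l x) ^ 4) \<partial>gauss (hyb_index k U)) +
        (\<integral>\<^sup>+x. ennreal ((h m x) ^ 4) \<partial>gauss (hyb_index k U))) +
      ennreal s * (\<integral>\<^sup>+x. ennreal ((gram_error k x l m)\<^sup>2) \<partial>gauss (hyb_index k U)))"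
  proof -
    have m1: "(\<lambda>x. ennreal (1 / s) * (ennreal ((h l x) ^ 4) + ennreal ((h m x) ^ 4))) \<in> borel_measurable (gauss (hyb_index k U))" for l m
      by (intro borel_measurable_times_ennreal borel_measurable_add borel_measurable_const hm)
    have m2: "(\<lambda>x. ennreal s * ennreal ((gram_error k x l m)\<^sup>2)) \<in> borel_measurable (gauss (hyb_index k U))"
      if "l \<in> W" "m \<in> W" for l m
      by (intro borel_measurable_times_ennreal borel_measurable_const em that)
    have m3: "(\<lambda>x. ennreal ((h l x) ^ 4) + ennreal ((h m x) ^ 4)) \<in> borel_measurable (gauss (hyb_index k U))" for l m
      by (intro borel_measurable_add hm)
    have m12: "(\<lambda>x. ennreal (1 / s) * (ennreal ((h l x) ^ 4) + ennreal ((h m x) ^ 4)) + ennreal s * ennreal ((gram_error k x l m)\<^sup>2)) \<in> borel_measurable (gauss (hyb_index k U))"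
      if "l \<in> W" "m \<in> W" for l m
      by (intro borel_measurable_add m1 m2 that)
    have "(\<integral>\<^sup>+x. (\<Sum>l\<in>W. \<Sum>m\<in>W. ennreal (1 / s) * (ennreal ((h l x) ^ 4) + ennreal ((h m x) ^ 4)) +
        ennreal s * ennreal ((gram_error k x l m)\<^sup>2)) \<partial>gauss (hyb_index k U)) =
        (\<Sum>l\<in>W. \<Sum>m\<in>W. \<integral>\<^sup>+x. ennreal (1 / s) * (ennreal ((h l x) ^ 4) + ennreal ((h m x) ^ 4)) +
        ennreal s * ennreal ((gram_error k x l m)\<^sup>2) \<partial>gauss (hyb_index k U))"
      by (subst nn_integral_sum[OF borel_measurable_sum[OF m12]], assumption, assumption, intro sum.cong refl,
          rule nn_integral_sum[OF m12])
    also have "\<dots> = (\<Sum>l\<in>W. \<Sum>m\<in>W. ennreal (1 / s) * ((\<integral>\<^sup>+x. ennreal ((h l x) ^ 4) \<partial>gauss (hyb_index k U)) +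
        (\<integral>\<^sup>+x. ennreal ((h m x) ^ 4) \<partial>gauss (hyb_index k U))) +
      ennreal s * (\<integral>\<^sup>+x. ennreal ((gram_error k x l m)\<^sup>2) \<partial>gauss (hyb_index k U)))"
      by (intro sum.cong refl)
         (simp only: nn_integral_add[OF m1 m2] nn_integral_cmult[OF m3] nn_integral_cmult[OF em] nn_integral_add[OF hm hm])
    finally show ?thesis .
  qed
  also have "\<dots> \<le> (\<Sum>l\<in>W. \<Sum>m\<in>W. ennreal (1 / s) * (ennreal M + ennreal M) + ennreal s * ennreal (2 / real k))"
    using W by (intro sum_mono add_mono mult_left_mono h4 nn_integral_gram_error_square U k) auto
  also have "\<dots> = (\<Sum>l\<in>W. \<Sum>m\<in>W. ennreal ((2 * M + 2) / s))"
  proof -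
    have "ennreal (1 / s) * (ennreal M + ennreal M) + ennreal s * ennreal (2 / real k) = ennreal ((2 * M + 2) / s)"
    proof -
      have "ennreal (1 / s) * (ennreal M + ennreal M) + ennreal s * ennreal (2 / real k) =
          ennreal (1 / s * (M + M) + s * (2 / real k))"
      proof -
        have 1: "ennreal (1 / s) * ennreal (M + M) = ennreal (1 / s * (M + M))"
          using s by (intro ennreal_mult'[symmetric]) auto
        have 2: "ennreal s * ennreal (2 / real k) = ennreal (s * (2 / real k))"
          using s by (intro ennreal_mult'[symmetric]) auto
        have 3: "ennreal (1 / s * (M + M) + s * (2 / real k)) = ennreal (1 / s * (M + M)) + ennreal (s * (2 / real k))"
          using s M0 by (intro ennreal_plus) auto
        show ?thesis by (simp only: ennreal_plus[OF M0 M0, symmetric] 1 2 3)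
      qed
      also have "1 / s * (M + M) + s * (2 / real k) = (2 * M + 2) / s"
        unfolding s(2)[symmetric] using s(1) by (simp add: add_divide_distrib)
      finally show ?thesis .
    qed
    then show ?thesis by simp
  qed
  also have "\<dots> = ennreal (real (card W) * (real (card W) * ((2 * M + 2) / s)))"
    by (simp only: sum_constant ennreal_of_nat_eq_real_of_nat ennreal_mult'[OF of_nat_0_le_iff])
  also have "\<dots> \<le> ennreal (N * (N * ((2 * M + 2) / s)))"
  proof -
    have "real (card W) \<le> N" using card_mono[OF U W] by (simp add: N_def)
    then show ?thesis using N1 M0 s by (intro ennreal_leI mult_mono) auto
  qed
  also have "N * (N * ((2 * M + 2) / s)) = hyb_const (card U) / sqrt (real k)"
    unfolding hyb_const_def N_def[symmetric] M_def[symmetric] s_def[symmetric] by (simp add: power2_eq_square)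
  finally show ?thesis .
qed

text \<open>Both hafnians are conditionally normal, so the means of \<open>f\<close> are means of one function of the
  conditional variance, which is Lipschitz by assumption.\<close>

lemma hyb_step:
  fixes f :: "real \<Rightarrow> 'b::{banach, second_countable_topology}"
  assumes U: "finite U" and v: "v \<notin> U" and W: "W \<subseteq> U" and k: "k \<ge> 1"
    and f: "f \<in> borel_measurable borel" and L: "L \<ge> 0"
    and lip: "\<And>A B. A \<ge> 0 \<Longrightarrow> B \<ge> 0 \<Longrightarrow>
      norm ((\<integral>t. f (sqrt A * t) \<partial>std_normal) - (\<integral>t. f (sqrt B * t) \<partial>std_normal)) \<le> L * \<bar>A - B\<bar>"
    and int: "\<And>W. integrable (gauss (hyb_index k (insert v U))) (\<lambda>z. f (haf (insert v U) (hyb k W z)))"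
  shows "norm ((\<integral>z. f (haf (insert v U) (hyb k (insert v W) z)) \<partial>gauss (hyb_index k (insert v U))) -
      (\<integral>z. f (haf (insert v U) (hyb k W z)) \<partial>gauss (hyb_index k (insert v U)))) \<le> L * (hyb_const (card U) / sqrt (real k))"
proof -
  let ?G = "gauss (hyb_index k U)"
  define \<Phi> where "\<Phi> A = (\<integral>t. f (sqrt A * t) \<partial>std_normal)" for A
  define V1 where "V1 x = (\<Sum>p\<in>{1..k} <+> U. (row_form k U W x p)\<^sup>2)" for x
  define V0 where "V0 x = (\<Sum>l\<in>U. (haf (U - {l}) (hyb k W x))\<^sup>2)" for x
  have fin: "finite (hyb_index k (insert v U))" using U by (simp add: finite_hyb_index)
  have finP: "finite ({1..k} <+> U)" using U by simp
  note bij = bij_split_code[OF v, of k]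
  interpret pair_sigma_finite ?G "gauss ({1..k} <+> U)" by (rule pair_sigma_finite_gauss)
  have inner: "(\<integral>y. f (haf (insert v U) (hyb k (insert v W) (add_vertex k v U x y))) \<partial>gauss ({1..k} <+> U)) = \<Phi> (V1 x)" for x
    unfolding haf_hyb_add_vertex(1)[OF U v W] integral_gauss_linear[OF finP f] \<Phi>_def V1_def by (rule refl)
  have inner0: "(\<integral>y. f (haf (insert v U) (hyb k W (add_vertex k v U x y))) \<partial>gauss ({1..k} <+> U)) = \<Phi> (V0 x)" for x
  proof -
    define c where "c = case_sum (\<lambda>_::nat. 0) (\<lambda>l. haf (U - {l}) (hyb k W x))"
    have "(\<Sum>l\<in>U. haf (U - {l}) (hyb k W x) * y (Inr l)) = (\<Sum>p\<in>{1..k} <+> U. c p * y p)" for y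
      using U by (simp add: sum.Plus c_def)
    moreover have "(\<Sum>p\<in>{1..k} <+> U. (c p)\<^sup>2) = V0 x" using U by (simp add: sum.Plus c_def V0_def)
    ultimately show ?thesis
      unfolding haf_hyb_add_vertex(2)[OF U v W] using integral_gauss_linear[OF finP f, of c] by (simp add: \<Phi>_def)
  qed
  have E: "integrable ?G (\<lambda>x. \<integral>y. f (haf (insert v U) (hyb k W' (add_vertex k v U x y))) \<partial>gauss ({1..k} <+> U))"
    "(\<integral>z. f (haf (insert v U) (hyb k W' z)) \<partial>gauss (hyb_index k (insert v U))) =
      (\<integral>x. \<integral>y. f (haf (insert v U) (hyb k W' (add_vertex k v U x y))) \<partial>gauss ({1..k} <+> U) \<partial>?G)" for W'
    unfolding add_vertex_def
    using integrable_fst'[OF integral_assemble(1)[OF fin bij int[of W']]] integral_assemble(2)[OF fin bij int[of W']]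
    by simp_all
  have i1: "integrable ?G (\<lambda>x. \<Phi> (V1 x))" "integrable ?G (\<lambda>x. \<Phi> (V0 x))"
    using E(1)[of "insert v W"] E(1)[of W] by (simp_all only: inner inner0)
  have i: "integrable ?G (\<lambda>x. \<Phi> (V1 x) - \<Phi> (V0 x))" using i1 by (rule Bochner_Integration.integrable_diff)
  have "(\<integral>z. f (haf (insert v U) (hyb k (insert v W) z)) \<partial>gauss (hyb_index k (insert v U))) -
      (\<integral>z. f (haf (insert v U) (hyb k W z)) \<partial>gauss (hyb_index k (insert v U))) = (\<integral>x. \<Phi> (V1 x) - \<Phi> (V0 x) \<partial>?G)"
    unfolding E(2) inner inner0 using i1 by simp
  moreover have "ennreal (norm (\<integral>x. \<Phi> (V1 x) - \<Phi> (V0 x) \<partial>?G)) \<le> ennreal (L * (hyb_const (card U) / sqrt (real k)))"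
  proof -
    have "ennreal (norm (\<integral>x. \<Phi> (V1 x) - \<Phi> (V0 x) \<partial>?G)) \<le> (\<integral>\<^sup>+x. ennreal (norm (\<Phi> (V1 x) - \<Phi> (V0 x))) \<partial>?G)"
      by (rule integral_norm_bound_ennreal[OF i])
    also have "\<dots> \<le> (\<integral>\<^sup>+x. ennreal L * ennreal \<bar>V1 x - V0 x\<bar> \<partial>?G)"
    proof (intro nn_integral_mono)
      fix x
      have "norm (\<Phi> (V1 x) - \<Phi> (V0 x)) \<le> L * \<bar>V1 x - V0 x\<bar>"
        unfolding \<Phi>_def by (rule lip) (auto simp: V1_def V0_def sum_nonneg)
      then show "ennreal (norm (\<Phi> (V1 x) - \<Phi> (V0 x))) \<le> ennreal L * ennreal \<bar>V1 x - V0 x\<bar>"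
        using L by (simp add: ennreal_mult'[symmetric] ennreal_leI)
    qed
    also have "\<dots> = ennreal L * (\<integral>\<^sup>+x. ennreal \<bar>V1 x - V0 x\<bar> \<partial>?G)"
    proof (rule nn_integral_cmult)
      have "(\<lambda>x. V1 x - V0 x) = (\<lambda>x. \<Sum>l\<in>W. \<Sum>m\<in>W. haf (U - {l}) (hyb k W x) * haf (U - {m}) (hyb k W x) * gram_error k x l m)"
        unfolding V1_def V0_def row_form_variance[OF U W k] ..
      moreover have "\<dots> \<in> borel_measurable ?G"
        using W by (intro borel_measurable_sum borel_measurable_times measurable_haf_hyb measurable_gram_error) auto
      ultimately have "(\<lambda>x. V1 x - V0 x) \<in> borel_measurable ?G" by simp
      then show "(\<lambda>x. ennreal \<bar>V1 x - V0 x\<bar>) \<in> borel_measurable ?G"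
        by (rule measurable_compose) measurable
    qed
    also have "\<dots> \<le> ennreal L * ennreal (hyb_const (card U) / sqrt (real k))"
      unfolding V1_def V0_def by (intro mult_left_mono nn_integral_variance_error U W k) auto
    finally show ?thesis using L by (simp add: ennreal_mult'[symmetric])
  qed
  ultimately show ?thesis
    using L hyb_const_nonneg[of "card U"] by (simp add: ennreal_le_iff)
qed

lemma hyb_total:
  fixes f :: "real \<Rightarrow> 'b::{banach, second_countable_topology}"
  assumes U: "finite U" and k: "k \<ge> 1"
    and f: "f \<in> borel_measurable borel" and L: "L \<ge> 0"
    and lip: "\<And>A B. A \<ge> 0 \<Longrightarrow> B \<ge> 0 \<Longrightarrow>
      norm ((\<integral>t. f (sqrt A * t) \<partial>std_normal) - (\<integral>t. f (sqrt B * t) \<partial>std_normal)) \<le> L * \<bar>A - B\<bar>"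
    and int: "\<And>W. integrable (gauss (hyb_index k U)) (\<lambda>z. f (haf U (hyb k W z)))"
    and W: "W \<subseteq> U"
  shows "norm ((\<integral>z. f (haf U (hyb k W z)) \<partial>gauss (hyb_index k U)) -
      (\<integral>z. f (haf U (hyb k {} z)) \<partial>gauss (hyb_index k U))) \<le>
    real (card W) * (L * (hyb_const (card U - 1) / sqrt (real k)))"
proof -
  have finW: "finite W" using W U finite_subset by blast
  define E where "E W = (\<integral>z. f (haf U (hyb k W z)) \<partial>gauss (hyb_index k U))" for W
  show ?thesis unfolding E_def[symmetric] using finW W
  proof (induction W rule: finite_induct)
    case empty
    then show ?case by simp
  next
    case (insert v W)
    define U' where "U' = U - {v}"
    have U': "finite U'" "v \<notin> U'" "U = insert v U'" "W \<subseteq> U'" "card U' = card U - 1"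
      using U insert by (auto simp: U'_def card_Diff_singleton)
    have "norm (E (insert v W) - E W) \<le> L * (hyb_const (card U - 1) / sqrt (real k))"
      using hyb_step[OF U'(1,2,4) k f L lip int[unfolded U'(3)]] unfolding E_def U'(3)[symmetric] U'(5) .
    moreover have "norm (E W - E {}) \<le> real (card W) * (L * (hyb_const (card U - 1) / sqrt (real k)))"
      using insert by auto
    moreover have "E (insert v W) - E {} = (E (insert v W) - E W) + (E W - E {})" by simp
    then have "norm (E (insert v W) - E {}) \<le> norm (E (insert v W) - E W) + norm (E W - E {})"
      by (metis norm_triangle_ineq)
    moreover have "real (card (insert v W)) * x = x + real (card W) * x" for x
      using insert.hyps by (simp add: ring_distribs)
    ultimately show ?case by (simp only:)
  qed
qed

section \<open>Limits of Gram hafnians\<close>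

lemma haf_scale:
  assumes "finite U" "card U = 2 * n"
  shows "haf U (\<lambda>e. c * w e) = c ^ n * haf U w"
  using assms
proof (induction n arbitrary: U)
  case 0
  then show ?case by simp
next
  case (Suc n)
  then have "U \<noteq> {}" by auto
  then obtain v where v: "v \<in> U" by auto
  have "haf (U - {v, l}) (\<lambda>e. c * w e) = c ^ n * haf (U - {v, l}) w" if l: "l \<in> U - {v}" for l
  proof (rule Suc.IH)
    have "U - {v, l} = U - {v} - {l}" by auto
    then show "card (U - {v, l}) = 2 * n" using l v Suc.prems by (simp add: card_Diff_singleton)
  qed (use Suc.prems in simp)
  then show ?case
    unfolding haf_expand[OF Suc.prems(1) v] by (simp add: sum_distrib_left mult_ac)
qed

text \<open>The hafnian is homogeneous of degree \<open>n\<close>, so the normalisation \<open>k powr (- n / 2)\<close> amounts to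
  dividing each Gram entry by \<open>sqrt k\<close>.\<close>

lemma distr_scaled_gram_hafnian:
  assumes X: "gaussian_matrix Q k (2 * n) X" and k: "k \<ge> 1"
  defines "U \<equiv> {1..2 * n}"
  shows "(\<lambda>\<omega>. real k powr (- (real n / 2)) * gram_hafnian k n (X \<omega>)) \<in> borel_measurable Q"
    and "distr Q borel (\<lambda>\<omega>. real k powr (- (real n / 2)) * gram_hafnian k n (X \<omega>)) =
      distr (gauss (hyb_index k U)) borel (\<lambda>z. haf U (hyb k U z))"
proof -
  let ?J = "{1..k} \<times> U"
  define T where "T \<omega> = (\<lambda>p\<in>?J. X \<omega> (fst p) (snd p))" for \<omega>
  define g where "g x = haf U (\<lambda>e. (\<Sum>a=1..k. \<Prod>i\<in>e. x (a, i)) / sqrt (real k))" for x :: "nat \<times> nat \<Rightarrow> real"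
  have U: "finite U" "card U = 2 * n" by (auto simp: U_def)
  have Z: "std_gaussian_family Q ?J (\<lambda>(a, i) \<omega>. X \<omega> a i)"
    using X by (simp add: gaussian_matrix_def U_def)
  have T: "T \<in> Q \<rightarrow>\<^sub>M gauss ?J" "distr Q (gauss ?J) T = gauss ?J"
    using distr_std_gaussian_family[OF Z, of ?J "\<lambda>p. p"] U unfolding T_def by (auto simp: split_def)
  have gm: "g \<in> borel_measurable (gauss ?J)"
    unfolding g_def haf_def
  proof (intro borel_measurable_sum borel_measurable_prod borel_measurable_divide borel_measurable_const)
    fix m e a i assume "m \<in> perfect_matchings U" "e \<in> m" "a \<in> {1..k}" "i \<in> e"
    then have "(a, i) \<in> ?J" using perfect_matching_subset by (fastforce simp: edges_def)
    then show "(\<lambda>x. x (a, i)) \<in> borel_measurable (gauss ?J)" by (rule measurable_gauss_component)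
  qed
  have gT: "g (T \<omega>) = real k powr (- (real n / 2)) * gram_hafnian k n (X \<omega>)" for \<omega>
  proof -
    have "g (T \<omega>) = haf U (\<lambda>e. (1 / sqrt (real k)) * (\<lambda>e\<in>edges U. gram k (X \<omega>) (Min e) (Max e)) e)"
      unfolding g_def
    proof (rule haf_cong)
      fix e assume e: "e \<in> edges U"
      note mm = edge_Min_Max[OF e]
      have "(\<Prod>i\<in>e. T \<omega> (a, i)) = X \<omega> a (Min e) * X \<omega> a (Max e)" if "a \<in> {1..k}" for a
      proof -
        have "(\<Prod>i\<in>{Min e, Max e}. T \<omega> (a, i)) = X \<omega> a (Min e) * X \<omega> a (Max e)"
          using mm(1,3,4) that by (simp add: T_def)
        then show ?thesis using mm(2) by simp
      qed
      then show "(\<Sum>a=1..k. \<Prod>i\<in>e. T \<omega> (a, i)) / sqrt (real k) =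
          (1 / sqrt (real k)) * (\<lambda>e\<in>edges U. gram k (X \<omega>) (Min e) (Max e)) e"
        using e by (simp add: gram_def)
    qed
    also have "\<dots> = (1 / sqrt (real k)) ^ n * haf U (\<lambda>e\<in>edges U. gram k (X \<omega>) (Min e) (Max e))"
      by (rule haf_scale[OF U])
    also have "haf U (\<lambda>e\<in>edges U. gram k (X \<omega>) (Min e) (Max e)) = gram_hafnian k n (X \<omega>)"
      unfolding gram_hafnian_def hafnian_eq_haf U_def by (rule refl)
    also have "(1 / sqrt (real k)) ^ n = real k powr (- (real n / 2))"
    proof -
      have "sqrt (real k) ^ n = real k powr (real n / 2)"
        using k by (simp add: powr_half_sqrt[symmetric] powr_power)
      then show ?thesis by (simp add: power_divide powr_minus_divide)
    qed
    finally show ?thesis .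
  qed
  show "(\<lambda>\<omega>. real k powr (- (real n / 2)) * gram_hafnian k n (X \<omega>)) \<in> borel_measurable Q"
    using measurable_compose[OF T(1) gm] by (simp only: gT)
  have p: "inj_on Inl ?J" "Inl ` ?J \<subseteq> hyb_index k U" by (auto simp: hyb_index_def)
  note R = distr_gauss_reindex[OF p]
  have gR: "g (\<lambda>q\<in>?J. z (Inl q)) = haf U (hyb k U z)" for z :: "nat \<times> nat + nat set \<Rightarrow> real"
    unfolding g_def
  proof (rule haf_cong)
    fix e assume e: "e \<in> edges U"
    then have eU: "e \<subseteq> U" by (simp add: edges_def)
    then have "(\<Prod>i\<in>e. (\<lambda>q\<in>?J. z (Inl q)) (a, i)) = (\<Prod>i\<in>e. z (Inl (a, i)))" if "a \<in> {1..k}" for a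
      using that by (intro prod.cong) auto
    then show "(\<Sum>a=1..k. \<Prod>i\<in>e. (\<lambda>q\<in>?J. z (Inl q)) (a, i)) / sqrt (real k) = hyb k U z e"
      using eU by (simp add: hyb_def)
  qed
  have "distr Q borel (\<lambda>\<omega>. real k powr (- (real n / 2)) * gram_hafnian k n (X \<omega>)) = distr (gauss ?J) borel g"
    using distr_distr[OF gm T(1)] by (simp only: T(2) comp_def gT)
  also have "\<dots> = distr (gauss (hyb_index k U)) borel (\<lambda>z. haf U (hyb k U z))"
    using distr_distr[OF gm R(1)] by (simp only: R(2) comp_def gR)
  finally show "distr Q borel (\<lambda>\<omega>. real k powr (- (real n / 2)) * gram_hafnian k n (X \<omega>)) =
      distr (gauss (hyb_index k U)) borel (\<lambda>z. haf U (hyb k U z))" .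
qed

lemma distr_haf_hyb_empty:
  "distr (gauss (hyb_index k U)) borel (\<lambda>z. haf U (hyb k {} z)) = distr (gauss (edges U)) borel (haf U)"
proof -
  have p: "inj_on Inr (edges U)" "Inr ` edges U \<subseteq> hyb_index k U" by (auto simp: hyb_index_def)
  note R = distr_gauss_reindex[OF p]
  have m: "haf U \<in> borel_measurable (gauss (edges U))" by (intro measurable_haf order_refl)
  have "haf U (\<lambda>e\<in>edges U. z (Inr e)) = haf U (hyb k {} z)" for z
    by (rule haf_cong) (auto simp: hyb_def edges_def)
  then show ?thesis using distr_distr[OF m R(1)] by (simp only: R(2) comp_def)
qed

lemma integrable_haf_hyb_square:
  assumes U: "finite U" and k: "k \<ge> 1"
  shows "integrable (gauss (hyb_index k U)) (\<lambda>z. (haf U (hyb k W z))\<^sup>2)"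
proof (rule integrableI_nonneg)
  interpret prob_space "gauss (hyb_index k U)" by (rule prob_space_gauss)
  have m: "(\<lambda>z. haf U (hyb k W z)) \<in> borel_measurable (gauss (hyb_index k U))"
    by (intro measurable_haf_hyb order_refl)
  then show "(\<lambda>z. (haf U (hyb k W z))\<^sup>2) \<in> borel_measurable (gauss (hyb_index k U))"
    by (rule borel_measurable_power)
  have "(\<integral>\<^sup>+z. ennreal ((haf U (hyb k W z))\<^sup>2) \<partial>gauss (hyb_index k U)) \<le>
      (\<integral>\<^sup>+z. 1 + ennreal ((haf U (hyb k W z)) ^ 4) \<partial>gauss (hyb_index k U))"
  proof (intro nn_integral_mono)
    fix z
    have "t\<^sup>2 \<le> 1 + t ^ 4" for t :: real
    proof -
      have "2 * t\<^sup>2 \<le> 1 + (t\<^sup>2)\<^sup>2"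
        using zero_le_power2[of "1 - t\<^sup>2"] by (simp add: power2_diff)
      moreover have "(t\<^sup>2)\<^sup>2 = t ^ 4" by (simp add: power_mult[symmetric])
      ultimately show ?thesis using zero_le_power2[of t] by linarith
    qed
    then have "ennreal ((haf U (hyb k W z))\<^sup>2) \<le> ennreal (1 + (haf U (hyb k W z)) ^ 4)" by (rule ennreal_leI)
    then show "ennreal ((haf U (hyb k W z))\<^sup>2) \<le> 1 + ennreal ((haf U (hyb k W z)) ^ 4)" by simp
  qed
  also have "\<dots> = 1 + (\<integral>\<^sup>+z. ennreal ((haf U (hyb k W z)) ^ 4) \<partial>gauss (hyb_index k U))"
    by (subst nn_integral_add) (auto simp: emeasure_space_1 intro: measurable_compose[OF m])
  also have "\<dots> < \<infinity>"
    using nn_integral_haf_hyb_fourth_power[OF U k order_refl, of W] by (auto simp: le_less_trans)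
  finally show "(\<integral>\<^sup>+z. ennreal ((haf U (hyb k W z))\<^sup>2) \<partial>gauss (hyb_index k U)) < \<infinity>" .
qed simp

lemma exp_minus_lipschitz:
  assumes "(a::real) \<ge> 0" "b \<ge> 0"
  shows "\<bar>exp (- a) - exp (- b)\<bar> \<le> \<bar>a - b\<bar>"
proof -
  have *: "\<bar>exp (- a) - exp (- b)\<bar> \<le> \<bar>a - b\<bar>" if ab: "0 \<le> a" "a \<le> b" for a b :: real
  proof -
    have "exp (- a) - exp (- b) = exp (- a) * (1 - exp (- (b - a)))"
      by (simp add: ring_distribs mult_exp_exp)
    also have "\<dots> \<le> 1 * (b - a)"
    proof (rule mult_mono)
      show "1 - exp (- (b - a)) \<le> b - a" using exp_ge_add_one_self[of "- (b - a)"] by linarith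
    qed (use ab in auto)
    finally show ?thesis using ab by simp
  qed
  show ?thesis using *[of a b] *[of b a] assms by (cases "a \<le> b") (auto simp: abs_minus_commute)
qed

lemma tendsto_gram_hafnian:
  fixes f :: "real \<Rightarrow> 'b::{banach, second_countable_topology}"
  assumes X: "\<And>k. k \<ge> 1 \<Longrightarrow> gaussian_matrix (Q k) k (2 * n) (X k)"
    and f: "f \<in> borel_measurable borel" and L: "L \<ge> 0"
    and lip: "\<And>A B. A \<ge> 0 \<Longrightarrow> B \<ge> 0 \<Longrightarrow>
      norm ((\<integral>t. f (sqrt A * t) \<partial>std_normal) - (\<integral>t. f (sqrt B * t) \<partial>std_normal)) \<le> L * \<bar>A - B\<bar>"
    and int: "\<And>k W. k \<ge> 1 \<Longrightarrow> integrable (gauss (hyb_index k {1..2 * n})) (\<lambda>z. f (haf {1..2 * n} (hyb k W z)))"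
  shows "(\<lambda>k. \<integral>\<omega>. f (real k powr (- (real n / 2)) * gram_hafnian k n (X k \<omega>)) \<partial>Q k) \<longlonglongrightarrow>
    (\<integral>x. f (haf {1..2 * n} x) \<partial>gauss (edges {1..2 * n}))"
proof (rule LIM_zero_cancel, rule Lim_null_comparison)
  let ?U = "{1..2 * n}"
  define K where "K = real (card ?U) * (L * hyb_const (card ?U - 1))"
  show "eventually (\<lambda>k. norm ((\<integral>\<omega>. f (real k powr (- (real n / 2)) * gram_hafnian k n (X k \<omega>)) \<partial>Q k) -
      (\<integral>x. f (haf ?U x) \<partial>gauss (edges ?U))) \<le> K / sqrt (real k)) sequentially"
    using eventually_ge_at_top[of 1]
  proof eventually_elim
    case (elim k)
    note D = distr_scaled_gram_hafnian[OF X[OF elim] elim]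
    have mh: "(\<lambda>z. haf ?U (hyb k W z)) \<in> borel_measurable (gauss (hyb_index k ?U))" for W
      by (intro measurable_haf_hyb order_refl)
    have mU: "haf ?U \<in> borel_measurable (gauss (edges ?U))" by (intro measurable_haf order_refl)
    have 1: "(\<integral>\<omega>. f (real k powr (- (real n / 2)) * gram_hafnian k n (X k \<omega>)) \<partial>Q k) =
        (\<integral>z. f (haf ?U (hyb k ?U z)) \<partial>gauss (hyb_index k ?U))"
      using integral_distr[OF D(1) f] integral_distr[OF mh f] by (simp only: D(2))
    have 2: "(\<integral>x. f (haf ?U x) \<partial>gauss (edges ?U)) = (\<integral>z. f (haf ?U (hyb k {} z)) \<partial>gauss (hyb_index k ?U))"
      using integral_distr[OF mU f] integral_distr[OF mh f, of "{}"] by (simp only: distr_haf_hyb_empty)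
    show ?case
      unfolding 1 2 using hyb_total[OF finite_atLeastAtMost elim f L lip int[OF elim] order_refl] by (simp add: K_def)
  qed
  have "filterlim (\<lambda>k. sqrt (real k)) at_top sequentially"
    by (rule filterlim_compose[OF sqrt_at_top filterlim_real_sequentially])
  then show "(\<lambda>k. K / sqrt (real k)) \<longlonglongrightarrow> 0"
    by (intro tendsto_divide_0[OF tendsto_const] filterlim_at_top_imp_at_infinity)
qed

lemma integral_std_normal_iexp:
  "(\<integral>t. iexp (u * (sqrt A * t)) \<partial>std_normal) = complex_of_real (exp (- (u * sqrt A)\<^sup>2 / 2))"
proof -
  have "(\<integral>t. iexp (u * (sqrt A * t)) \<partial>std_normal) = char std_normal (u * sqrt A)"
    unfolding char_def by (simp add: mult_ac)
  then show ?thesis by (simp add: char_std_normal_distribution)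
qed

lemma integral_std_normal_square:
  assumes "A \<ge> 0"
  shows "(\<integral>t. (sqrt A * t)\<^sup>2 \<partial>std_normal) = A"
  using assms std_normal_distribution_even_moments(1)[of 1] by (simp add: power_mult_distrib)

lemma char_gram_hafnian_tendsto:
  assumes X: "\<And>k. k \<ge> 1 \<Longrightarrow> gaussian_matrix (Q k) k (2 * n) (X k)"
  shows "(\<lambda>k. \<integral>\<omega>. iexp (u * (real k powr (- (real n / 2)) * gram_hafnian k n (X k \<omega>))) \<partial>Q k) \<longlonglongrightarrow>
    (\<integral>x. iexp (u * haf {1..2 * n} x) \<partial>gauss (edges {1..2 * n}))"
proof (rule tendsto_gram_hafnian[OF X, where f = "\<lambda>t. iexp (u * t)" and L = "u\<^sup>2 / 2"])
  fix A B :: real assume AB: "A \<ge> 0" "B \<ge> 0"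
  have "norm (complex_of_real (exp (- (u * sqrt A)\<^sup>2 / 2)) - complex_of_real (exp (- (u * sqrt B)\<^sup>2 / 2))) =
      \<bar>exp (- (u\<^sup>2 * A / 2)) - exp (- (u\<^sup>2 * B / 2))\<bar>"
    using AB by (simp add: power_mult_distrib flip: of_real_diff)
  also have "\<dots> \<le> \<bar>u\<^sup>2 * A / 2 - u\<^sup>2 * B / 2\<bar>" using AB by (intro exp_minus_lipschitz) auto
  also have "u\<^sup>2 * A / 2 - u\<^sup>2 * B / 2 = u\<^sup>2 / 2 * (A - B)" by (simp add: algebra_simps diff_divide_distrib)
  also have "\<bar>u\<^sup>2 / 2 * (A - B)\<bar> = u\<^sup>2 / 2 * \<bar>A - B\<bar>" by (simp add: abs_mult)
  finally show "norm ((\<integral>t. iexp (u * (sqrt A * t)) \<partial>std_normal) - (\<integral>t. iexp (u * (sqrt B * t)) \<partial>std_normal)) \<le> u\<^sup>2 / 2 * \<bar>A - B\<bar>"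
    unfolding integral_std_normal_iexp .
next
  fix k :: nat and W
  show "integrable (gauss (hyb_index k {1..2 * n})) (\<lambda>z. iexp (u * haf {1..2 * n} (hyb k W z)))"
    by (intro integrable_iexp_gauss borel_measurable_times borel_measurable_const measurable_haf_hyb order_refl)
qed auto

lemma square_gram_hafnian_tendsto:
  assumes X: "\<And>k. k \<ge> 1 \<Longrightarrow> gaussian_matrix (Q k) k (2 * n) (X k)"
  shows "(\<lambda>k. \<integral>\<omega>. (real k powr (- (real n / 2)) * gram_hafnian k n (X k \<omega>))\<^sup>2 \<partial>Q k) \<longlonglongrightarrow>
    (\<integral>x. (haf {1..2 * n} x)\<^sup>2 \<partial>gauss (edges {1..2 * n}))"
  by (rule tendsto_gram_hafnian[OF X, where f = "\<lambda>t. t\<^sup>2" and L = 1])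
     (auto simp: integral_std_normal_square intro!: integrable_haf_hyb_square)

lemma integral_haf_square:
  assumes "finite U" "card U = 2 * n"
  shows "(\<integral>x. (haf U x)\<^sup>2 \<partial>gauss (edges U)) = real (double_fact (2 * n - 1))"
proof -
  have "haf U \<in> borel_measurable (gauss (edges U))" by (intro measurable_haf order_refl)
  then have "(\<integral>x. (haf U x)\<^sup>2 \<partial>gauss (edges U)) = enn2real (\<integral>\<^sup>+x. ennreal ((haf U x)\<^sup>2) \<partial>gauss (edges U))"
    by (intro integral_eq_nn_integral) auto
  then show ?thesis by (simp add: nn_integral_haf_square[OF assms])
qed

section \<open>The limit theorem and the density bound\<close>

theorem theorem2p3:
  fixes n :: nat
    and P :: "'a measure" and S :: "'a \<Rightarrow> nat \<Rightarrow> nat \<Rightarrow> real"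
    and Q :: "nat \<Rightarrow> 'b measure" and X :: "nat \<Rightarrow> 'b \<Rightarrow> nat \<Rightarrow> nat \<Rightarrow> real"
    and H :: "'a \<Rightarrow> real" and Hhat :: "'a \<Rightarrow> real" and \<sigma>sym :: real
    and Hk :: "nat \<Rightarrow> 'b \<Rightarrow> real" and \<sigma>k :: "nat \<Rightarrow> real"
  assumes "n \<ge> 1"
    and "sym_gaussian_matrix P (2 * n) S"
    and "\<And>k. k \<ge> 1 \<Longrightarrow> gaussian_matrix (Q k) k (2 * n) (X k)"
  defines "H \<equiv> \<lambda>\<omega>. hafnian n (S \<omega>)"
    and "Hhat \<equiv> \<lambda>\<omega>. H \<omega> / sqrt (real (double_fact (2 * n - 1)))"
    and "\<sigma>sym \<equiv> rms P H"
    and "Hk \<equiv> \<lambda>k \<omega>. gram_hafnian k n (X k \<omega>)"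
    and "\<sigma>k \<equiv> \<lambda>k. rms (Q k) (Hk k)"
  shows "weak_conv_m
           (\<lambda>k. distr (Q k) borel (\<lambda>\<omega>. real k powr (- (real n / 2)) * Hk k \<omega>))
           (distr P borel H)
    \<and> (\<lambda>k. real k powr (- (real n / 2)) * \<sigma>k k) \<longlonglongrightarrow> \<sigma>sym
    \<and> \<sigma>sym\<^sup>2 = real (double_fact (2 * n - 1))
    \<and> (\<lambda>k. B_real (Q k) k n (X k)) \<longlonglongrightarrow> b_real n
    \<and> (\<exists>f :: real \<Rightarrow> real.
          distributed P lborel Hhat f
        \<and> (\<forall>x. 0 \<le> f x)
        \<and> bounded (range f)
        \<and> continuous_on UNIV f
        \<and> (\<forall>x. f (- x) = f x)
        \<and> (\<forall>x. f x \<le> f 0)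
        \<and> (SUP x. \<bar>f x\<bar>) = f 0
        \<and> f 0 \<le> b_real n / 2
        \<and> b_real n / 2 \<le> 1 / sqrt pi * real n powr (3 / 8))
    \<and> (\<forall>z \<epsilon> :: real. \<epsilon> \<ge> 0 \<longrightarrow>
          measure P {\<omega> \<in> space P. \<bar>H \<omega> - z\<bar> \<le> \<epsilon> * \<sigma>sym} \<le> min 1 (b_real n * \<epsilon>)
        \<and> min 1 (b_real n * \<epsilon>) \<le> min 1 (2 / sqrt pi * real n powr (3 / 8) * \<epsilon>))"
proof -
  note n = assms(1) and S = assms(2) and X = assms(3)
  define U where "U = {1..2 * n}"
  have U: "finite U" "card U = 2 * n" by (auto simp: U_def)
  define \<sigma> where "\<sigma> = sqrt (real (double_fact (2 * n - 1)))"
  have df: "double_fact m > 0" for m by (induction m rule: double_fact.induct) auto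
  have \<sigma>: "\<sigma> > 0" "\<sigma>\<^sup>2 = real (double_fact (2 * n - 1))" using df[of "2 * n - 1"] by (auto simp: \<sigma>_def)
  interpret P: prob_space P using S by (simp add: sym_gaussian_matrix_def std_gaussian_family_def)
  have Qp: "prob_space (Q k)" if "k \<ge> 1" for k
    using X[OF that] by (simp add: gaussian_matrix_def std_gaussian_family_def)
  have H: "H \<in> borel_measurable P" "distr P borel H = distr (gauss (edges U)) borel (haf U)"
    using distr_hafnian[OF S] unfolding H_def U_def by auto
  have hU: "haf U \<in> borel_measurable (gauss (edges U))" by (intro measurable_haf order_refl)
  have Hint: "(\<integral>\<omega>. g (H \<omega>) \<partial>P) = (\<integral>x. g (haf U x) \<partial>gauss (edges U))" if "g \<in> borel_measurable borel"
    for g :: "real \<Rightarrow> real"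
    using integral_distr[OF H(1) that] integral_distr[OF hU that] by (simp only: H(2))

  have H2: "(\<integral>\<omega>. (H \<omega>)\<^sup>2 \<partial>P) = \<sigma>\<^sup>2"
    using Hint[of "\<lambda>t. t\<^sup>2"] integral_haf_square[OF U] \<sigma>(2) by simp
  have \<sigma>sym: "\<sigma>sym = \<sigma>"
    unfolding \<sigma>sym_def rms_def H2 using \<sigma>(1) by (intro real_sqrt_unique) auto

  have Y: "(\<lambda>\<omega>. real k powr (- (real n / 2)) * Hk k \<omega>) \<in> borel_measurable (Q k)" if "k \<ge> 1" for k
    unfolding Hk_def by (rule distr_scaled_gram_hafnian(1)[OF X[OF that] that])

  have weak: "weak_conv_m (\<lambda>k. distr (Q k) borel (\<lambda>\<omega>. real k powr (- (real n / 2)) * Hk k \<omega>)) (distr P borel H)"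
  proof -
    define M where "M k = distr (Q k) borel (\<lambda>\<omega>. real k powr (- (real n / 2)) * Hk k \<omega>)" for k
    \<comment> \<open>The index is shifted because nothing is known about \<open>Q 0\<close>.\<close>
    have "weak_conv_m (\<lambda>k. M (k + 1)) (distr P borel H)"
    proof (rule levy_continuity)
      show "real_distribution (M (k + 1))" for k
        unfolding M_def by (rule prob_space.real_distribution_distr[OF Qp Y]) auto
      show "real_distribution (distr P borel H)" by (rule P.real_distribution_distr[OF H(1)])
      fix t
      have cM: "char (M k) t = (\<integral>\<omega>. iexp (t * (real k powr (- (real n / 2)) * gram_hafnian k n (X k \<omega>))) \<partial>Q k)"
        if "k \<ge> 1" for k
        unfolding char_def M_def by (subst integral_distr[OF Y[OF that]]) (auto simp: Hk_def)
      have "char (distr P borel H) t = (\<integral>x. iexp (t * haf U x) \<partial>gauss (edges U))"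
        unfolding char_def H(2) by (subst integral_distr[OF hU]) auto
      moreover have "(\<lambda>k. \<integral>\<omega>. iexp (t * (real (k + 1) powr (- (real n / 2)) * gram_hafnian (k + 1) n (X (k + 1) \<omega>))) \<partial>Q (k + 1))
          \<longlonglongrightarrow> (\<integral>x. iexp (t * haf U x) \<partial>gauss (edges U))"
        unfolding U_def by (rule LIMSEQ_ignore_initial_segment[OF char_gram_hafnian_tendsto[OF X]])
      ultimately show "(\<lambda>k. char (M (k + 1)) t) \<longlonglongrightarrow> char (distr P borel H) t"
        by (simp only: cM le_add2)
    qed
    then show ?thesis
      unfolding weak_conv_m_def weak_conv_def M_def[symmetric] by (auto intro: LIMSEQ_offset[where k = 1])
  qed

  have rmsk: "(\<lambda>k. real k powr (- (real n / 2)) * \<sigma>k k) \<longlonglongrightarrow> \<sigma>sym"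
  proof -
    have "(\<lambda>k. sqrt (\<integral>\<omega>. (real k powr (- (real n / 2)) * gram_hafnian k n (X k \<omega>))\<^sup>2 \<partial>Q k)) \<longlonglongrightarrow>
        sqrt (\<integral>x. (haf U x)\<^sup>2 \<partial>gauss (edges U))"
      unfolding U_def by (rule tendsto_real_sqrt[OF square_gram_hafnian_tendsto[OF X]])
    moreover have "sqrt (\<integral>\<omega>. (real k powr (- (real n / 2)) * gram_hafnian k n (X k \<omega>))\<^sup>2 \<partial>Q k) =
        real k powr (- (real n / 2)) * \<sigma>k k" for k
      by (simp add: \<sigma>k_def rms_def Hk_def power_mult_distrib real_sqrt_mult)
    moreover have "sqrt (\<integral>x. (haf U x)\<^sup>2 \<partial>gauss (edges U)) = \<sigma>sym"
      unfolding integral_haf_square[OF U] \<sigma>sym by (simp add: \<sigma>_def)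
    ultimately show ?thesis by simp
  qed

  define \<Gamma> where "\<Gamma> = (\<Prod>r=2..n. gamma_const (2 * real r - 1))"
  have b: "b_real n = sqrt (2 / pi) * \<sigma> * \<Gamma>" by (simp add: b_real_def \<sigma>_def \<Gamma>_def)
  have B: "(\<lambda>k. B_real (Q k) k n (X k)) \<longlonglongrightarrow> b_real n"
  proof -
    have "(\<lambda>k. sqrt (2 / pi) * (real k powr (- (real n / 2)) * \<sigma>k k) *
        (real k powr (real n / 2) * (\<Prod>j<n. gamma_const (real k - real j))) * \<Gamma>) \<longlonglongrightarrow> sqrt (2 / pi) * \<sigma>sym * 1 * \<Gamma>"
      by (intro tendsto_mult tendsto_const rmsk gamma_product_limit)
    moreover have "eventually (\<lambda>k. sqrt (2 / pi) * (real k powr (- (real n / 2)) * \<sigma>k k) *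
        (real k powr (real n / 2) * (\<Prod>j<n. gamma_const (real k - real j))) * \<Gamma> = B_real (Q k) k n (X k)) sequentially"
      using eventually_ge_at_top[of 1]
    proof eventually_elim
      case (elim k)
      have "real k powr (- (real n / 2)) * real k powr (real n / 2) = 1"
        using elim by (simp add: powr_add[symmetric])
      moreover have "c * (x * y) * (z * p) * g = c * y * p * g" if "x * z = 1" for c x y z p g :: real
      proof -
        have "c * (x * y) * (z * p) * g = (x * z) * (c * y * p * g)" by (simp only: mult_ac)
        then show ?thesis by (simp only: that mult_1_left)
      qed
      ultimately have "sqrt (2 / pi) * (real k powr (- (real n / 2)) * \<sigma>k k) *
          (real k powr (real n / 2) * (\<Prod>j<n. gamma_const (real k - real j))) * \<Gamma> =
          sqrt (2 / pi) * \<sigma>k k * (\<Prod>j<n. gamma_const (real k - real j)) * \<Gamma>"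
        by blast
      then show ?case by (simp only: B_real_def \<sigma>k_def Hk_def \<Gamma>_def)
    qed
    ultimately show ?thesis unfolding b \<sigma>sym by (simp add: filterlim_cong)
  qed

  have "\<exists>f. (\<forall>y. f y \<ge> 0) \<and> (\<forall>y. f (- y) = f y) \<and> (\<forall>y. f y \<le> f 0) \<and> continuous_on UNIV f \<and>
      f 0 \<le> \<sigma> * \<Gamma> / sqrt (2 * pi) \<and>
      distr (gauss (edges U)) borel (\<lambda>x. haf U x / \<sigma>) = density lborel (\<lambda>y. ennreal (f y))"
    by (rule haf_scaled_density[OF n U \<sigma>(1), folded \<Gamma>_def]) (intro exI conjI allI)
  then obtain f :: "real \<Rightarrow> real" where f: "\<forall>y. f y \<ge> 0" "\<forall>y. f (- y) = f y" "\<forall>y. f y \<le> f 0" "continuous_on UNIV f"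
    "f 0 \<le> \<sigma> * \<Gamma> / sqrt (2 * pi)"
    and fd: "distr (gauss (edges U)) borel (\<lambda>x. haf U x / \<sigma>) = density lborel (\<lambda>y. ennreal (f y))"
    by (elim exE conjE)
  have fm [measurable]: "f \<in> borel_measurable borel" using f(4) by (rule borel_measurable_continuous_onI)
  have Hh: "Hhat = (\<lambda>\<omega>. H \<omega> / \<sigma>)" by (simp add: Hhat_def \<sigma>_def)
  have Hhm: "Hhat \<in> borel_measurable P" unfolding Hh using H(1) by measurable
  have dHh: "distr P borel Hhat = density lborel (\<lambda>y. ennreal (f y))"
  proof -
    have d: "(\<lambda>t. t / \<sigma>) \<in> borel_measurable borel" by measurable
    have "distr P borel Hhat = distr (distr P borel H) borel (\<lambda>t. t / \<sigma>)"
      unfolding Hh using distr_distr[OF d H(1)] by (simp add: comp_def)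
    also have "\<dots> = distr (gauss (edges U)) borel (\<lambda>x. haf U x / \<sigma>)"
      unfolding H(2) using distr_distr[OF d hU] by (simp add: comp_def)
    finally show ?thesis by (simp only: fd)
  qed
  have dist: "distributed P lborel Hhat f"
  proof -
    have "distr P lborel Hhat = distr P borel Hhat" by (rule distr_cong) auto
    then show ?thesis using Hhm by (simp add: distributed_def dHh)
  qed
  have f0: "f 0 \<le> b_real n / 2"
  proof -
    have "sqrt (2 / pi) / 2 = 1 / sqrt (2 * pi)"
      by (simp add: real_sqrt_divide real_sqrt_mult field_simps)
    moreover have "b_real n / 2 = sqrt (2 / pi) / 2 * (\<sigma> * \<Gamma>)" unfolding b by simp
    ultimately have "b_real n / 2 = \<sigma> * \<Gamma> / sqrt (2 * pi)" by simp
    then show ?thesis using f(5) by simp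
  qed
  have bb: "b_real n / 2 \<le> 1 / sqrt pi * real n powr (3 / 8)" by (rule b_real_le[OF n])
  have sup: "(SUP x. \<bar>f x\<bar>) = f 0"
    by (rule cSup_eq_maximum) (use f(1,3) in \<open>auto intro: rev_image_eqI[of 0]\<close>)
  have bdd: "bounded (range f)"
    unfolding bounded_iff using f(1,3) by (auto intro!: exI[of _ "f 0"])

  have small_ball: "measure P {\<omega> \<in> space P. \<bar>H \<omega> - z\<bar> \<le> \<epsilon> * \<sigma>sym} \<le> min 1 (b_real n * \<epsilon>)" if \<epsilon>: "\<epsilon> \<ge> 0" for z \<epsilon>
  proof -
    let ?I = "{z / \<sigma> - \<epsilon>..z / \<sigma> + \<epsilon>}"
    have "{\<omega> \<in> space P. \<bar>H \<omega> - z\<bar> \<le> \<epsilon> * \<sigma>sym} = Hhat -` ?I \<inter> space P"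
    proof -
      have eqv: "\<bar>h - z\<bar> \<le> \<epsilon> * \<sigma> \<longleftrightarrow> h / \<sigma> \<in> ?I" for h
      proof -
        have "h / \<sigma> \<in> ?I \<longleftrightarrow> \<bar>h / \<sigma> - z / \<sigma>\<bar> \<le> \<epsilon>" by (auto simp: abs_le_iff)
        also have "\<bar>h / \<sigma> - z / \<sigma>\<bar> = \<bar>h - z\<bar> / \<sigma>"
          using \<sigma>(1) by (simp add: diff_divide_distrib[symmetric] abs_divide)
        finally show ?thesis using \<sigma>(1) by (simp only: pos_divide_le_eq)
      qed
      show ?thesis unfolding \<sigma>sym Hh eqv by blast
    qed
    then have "emeasure P {\<omega> \<in> space P. \<bar>H \<omega> - z\<bar> \<le> \<epsilon> * \<sigma>sym} = emeasure (distr P borel Hhat) ?I"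
      using emeasure_distr[OF Hhm, of ?I] by simp
    also have "\<dots> = (\<integral>\<^sup>+y. ennreal (f y) * indicator ?I y \<partial>lborel)"
      unfolding dHh by (rule emeasure_density) auto
    also have "\<dots> \<le> (\<integral>\<^sup>+y. ennreal (f 0) * indicator ?I y \<partial>lborel)"
      by (intro nn_integral_mono mult_right_mono ennreal_leI f(3)[rule_format]) auto
    also have "\<dots> = ennreal (f 0) * ennreal (2 * \<epsilon>)"
      using \<epsilon> by (subst nn_integral_cmult_indicator) auto
    also have "\<dots> = ennreal (f 0 * (2 * \<epsilon>))" using f(1) by (simp add: ennreal_mult')
    also have "\<dots> \<le> ennreal (b_real n * \<epsilon>)"
      using mult_right_mono[OF f0 \<epsilon>] by (intro ennreal_leI) simp
    finally have "ennreal (measure P {\<omega> \<in> space P. \<bar>H \<omega> - z\<bar> \<le> \<epsilon> * \<sigma>sym}) \<le> ennreal (b_real n * \<epsilon>)"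
      by (simp add: P.emeasure_eq_measure)
    moreover have "b_real n * \<epsilon> \<ge> 0" using f0 f(1)[rule_format, of 0] \<epsilon> by (intro mult_nonneg_nonneg) auto
    ultimately have "measure P {\<omega> \<in> space P. \<bar>H \<omega> - z\<bar> \<le> \<epsilon> * \<sigma>sym} \<le> b_real n * \<epsilon>"
      by (simp add: ennreal_le_iff)
    then show ?thesis using P.prob_le_1 by simp
  qed
  have mins: "min 1 (b_real n * \<epsilon>) \<le> min 1 (2 / sqrt pi * real n powr (3 / 8) * \<epsilon>)" if \<epsilon>: "\<epsilon> \<ge> 0" for \<epsilon>
  proof -
    have "b_real n \<le> 2 / sqrt pi * real n powr (3 / 8)" using bb by (simp add: mult.commute)
    then have "b_real n * \<epsilon> \<le> 2 / sqrt pi * real n powr (3 / 8) * \<epsilon>" using \<epsilon> by (rule mult_right_mono)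
    then show ?thesis by (rule min.mono[OF order_refl])
  qed
  show ?thesis
  proof (intro conjI exI[of _ f] allI impI)
    show "distributed P lborel Hhat (\<lambda>x. ennreal (f x))" by (rule dist)
    show "\<sigma>sym\<^sup>2 = real (double_fact (2 * n - 1))" unfolding \<sigma>sym by (rule \<sigma>(2))
    fix z \<epsilon> :: real assume \<epsilon>: "\<epsilon> \<ge> 0"
    show "measure P {\<omega> \<in> space P. \<bar>H \<omega> - z\<bar> \<le> \<epsilon> * \<sigma>sym} \<le> min 1 (b_real n * \<epsilon>)" by (rule small_ball[OF \<epsilon>])
    show "min 1 (b_real n * \<epsilon>) \<le> min 1 (2 / sqrt pi * real n powr (3 / 8) * \<epsilon>)" by (rule mins[OF \<epsilon>])
  qed (rule weak rmsk B f(1-3)[rule_format] f(4) bdd sup f0 bb)+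
qed

end
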